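(* Suppose $K$ is a number field, and for each place $v$ of $K$, let $y_v\in\mathbb R$. Then there exists a unique consistent map $c\in\mathcal J^*$ such that $$c(L,w)=\frac{[L_w:K_v]}{[L:K]}\,y_v$$ for all $v\in M_K$, all finite extensions $L/K$, and all places $w$ of $L$ dividing $v$. Moreover, if $\Phi_c(\alpha)\in\mathbb Q$ for all $\alpha\in K^\times$, then $c\in\mathcal I^*$.
   Context: Fix an algebraic closure $\overline{\mathbb Q}$ of $\mathbb Q$; number fields are subfields of $\overline{\mathbb Q}$ of finite degree over $\mathbb Q$. Let $\overline{\mathbb Q}^\times_{\mathrm{tors}}$ be the group of roots of unity in $\overline{\mathbb Q}^\times$ and let $\mathcal G = \overline{\mathbb Q}^\times/\overline{\mathbb Q}^\times_{\mathrm{tors}}$. It is a vector space over $\mathbb Q$, with vector addition $(\alpha,\beta)\mapsto\alpha\beta$ and scalar multiplication $(r,\alpha)\mapsto\alpha^r$. For a number field $K$, $M_K$ is the set of all places of $K$ (Archimedean and non-Archimedean). For $v\in M_K$, $K_v$ is the completion of $K$ at $v$, $p_v$ is the place of $\mathbb Q$ below $v$, $\mathbb Q_v=\mathbb Q_{p_v}$, and $\|\cdot\|_v$ is the unique extension to $K_v$ of the usual $p_v$-adic absolute value on $\mathbb Q_v$ (the usual absolute value if $p_v=\infty$). If $L/K$ is a finite extension and $w\in M_L$ divides (lies above) $v\in M_K$, write $w\mid v$. Let $\mathcal J = \{(K,v): [K:\mathbb Q]<\infty,\ v\in M_K\}$. A map $c:\mathcal J\to\mathbb R$ is called consistent if $c(K,v)=\sum_{w\mid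 v}c(L,w)$ for all number fields $K$, all $v\in M_K$, and all finite extensions $L/K$ (sum over places $w$ of $L$ dividing $v$). $\mathcal J^*$ denotes the $\mathbb R$-vector space of all consistent maps, with pointwise operations. For $c\in\mathcal J^*$ and $\alpha\in\overline{\mathbb Q}^\times$, set $\Phi_c(\alpha)=\sum_{v\in M_K}c(K,v)\log\|\alpha\|_v$, where $K$ is any number field containing $\alpha$. This does not depend on the choice of $K$ and is unchanged when $\alpha$ is multiplied by a root of unity, so $\Phi_c:\mathcal G\to\mathbb R$ is a well-defined $\mathbb Q$-linear map. Finally, $\mathcal I^*=\{c\in\mathcal J^*:\Phi_c(\alpha)\in\mathbb Q\text{ for all }\alpha\in\mathcal G\}$. *)

theory Defs
  imports "HOL-Algebra.Algebraic_Closure_Type" "HOL-Analysis.Infinite_Sum"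
begin

section \<open>Number fields\<close>

type_synonym Qbar = "rat alg_closure"

text \<open>
  Number fields are subsets of the type \<^typ>\<open>Qbar\<close>; degrees of extensions are the
  dimensions of HOL-Algebra, taken in the ring structure carried by the whole type.
\<close>

abbreviation Qbar_ring :: "Qbar ring"
  where "Qbar_ring \<equiv> ring_of_type_algebra"

definition finite_extension :: "Qbar set \<Rightarrow> Qbar set \<Rightarrow> bool"
  where "finite_extension K L \<longleftrightarrow>
    subfield K Qbar_ring \<and> subfield L Qbar_ring \<and> K \<subseteq> L \<and> ring.finite_dimension Qbar_ring K L"

definition number_field :: "Qbar set \<Rightarrow> bool"
  where "number_field K \<longleftrightarrow> finite_extension \<rat> K"

definition ext_degree :: "Qbar set \<Rightarrow> Qbar set \<Rightarrow> nat"
  where "ext_degree K L = ring.dim Qbar_ring K L"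


section \<open>Places\<close>

text \<open>
  Absolute values on \<open>K\<close> are taken in \<open>extensional K\<close>, so that two of them are equal
  as soon as they agree on \<open>K\<close>.
\<close>

definition nontrivial_absolute_values :: "Qbar set \<Rightarrow> (Qbar \<Rightarrow> real) set"
  where "nontrivial_absolute_values K = {f \<in> extensional K.
    (\<forall>x\<in>K. 0 \<le> f x) \<and>
    (\<forall>x\<in>K. f x = 0 \<longleftrightarrow> x = 0) \<and>
    (\<forall>x\<in>K. \<forall>y\<in>K. f (x * y) = f x * f y) \<and>
    (\<forall>x\<in>K. \<forall>y\<in>K. f (x + y) \<le> f x + f y) \<and>
    (\<exists>x\<in>K. x \<noteq> 0 \<and> f x \<noteq> 1)}"

definition absolute_value_equiv :: "Qbar set \<Rightarrow> ((Qbar \<Rightarrow> real) \<times> (Qbar \<Rightarrow> real)) set"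
  where "absolute_value_equiv K =
    {(f, g). f \<in> nontrivial_absolute_values K \<and> g \<in> nontrivial_absolute_values K \<and>
             (\<exists>s>0. \<forall>x\<in>K. g x = f x powr s)}"

type_synonym place = "(Qbar \<Rightarrow> real) set"

definition places :: "Qbar set \<Rightarrow> place set"
  where "places K = nontrivial_absolute_values K // absolute_value_equiv K"

text \<open>The place \<open>w\<close> (of an extension of \<open>K\<close>) divides the place \<open>v\<close> of \<open>K\<close>.\<close>

definition divides_place :: "Qbar set \<Rightarrow> place \<Rightarrow> place \<Rightarrow> bool"
  where "divides_place K w v \<longleftrightarrow> (\<lambda>f. restrict f K) ` w \<subseteq> v"

definition padic_abs :: "nat \<Rightarrow> rat \<Rightarrow> real"
  where "padic_abs p r = (if r = 0 then 0 else
    real p powi (int (multiplicity (int p) (snd (quotient_of r)))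
                 - int (multiplicity (int p) (fst (quotient_of r)))))"

definition usual_abs_rat :: "(rat \<Rightarrow> real) set"
  where "usual_abs_rat = insert (\<lambda>r. real_of_rat \<bar>r\<bar>) (padic_abs ` {p. prime p})"

text \<open>
  The unique representative of the place that restricts to one of the usual absolute values
  of \<open>\<rat>\<close>: on \<open>K\<close> it is the restriction of the unique extension to \<open>K\<^sub>v\<close> of the
  usual absolute value of \<open>\<rat>\<^sub>v\<close>.
\<close>

definition place_norm :: "place \<Rightarrow> Qbar \<Rightarrow> real"
  where "place_norm v = (THE f. f \<in> v \<and> (\<lambda>r. f (of_rat r)) \<in> usual_abs_rat)"


section \<open>Completions and local degrees\<close>

definition cauchy_ring :: "Qbar set \<Rightarrow> place \<Rightarrow> (nat \<Rightarrow> Qbar) ring"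
  where "cauchy_ring K v =
    \<lparr> carrier = {s. (\<forall>n. s n \<in> K) \<and>
                    (\<forall>e>0. \<exists>N. \<forall>m\<ge>N. \<forall>n\<ge>N. place_norm v (s m - s n) < e)},
      monoid.mult = (\<lambda>s t n. s n * t n),
      one = (\<lambda>n. 1),
      ring.zero = (\<lambda>n. 0),
      add = (\<lambda>s t n. s n + t n) \<rparr>"

definition null_ideal :: "Qbar set \<Rightarrow> place \<Rightarrow> (nat \<Rightarrow> Qbar) set"
  where "null_ideal K v =
    {s \<in> carrier (cauchy_ring K v). (\<lambda>n. place_norm v (s n)) \<longlonglongrightarrow> 0}"

definition completion :: "Qbar set \<Rightarrow> place \<Rightarrow> (nat \<Rightarrow> Qbar) set ring"
  where "completion K v = cauchy_ring K v Quot null_ideal K v"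

text \<open>
  The natural map \<open>K\<^sub>v \<rightarrow> L\<^sub>w\<close> for \<open>w\<close> dividing \<open>v\<close>: all members of a class \<open>A\<close> of
  Cauchy sequences in \<open>K\<close> lie in one and the same class of Cauchy sequences in \<open>L\<close>,
  which is therefore the value of the union.
\<close>

definition completion_map :: "Qbar set \<Rightarrow> place \<Rightarrow> (nat \<Rightarrow> Qbar) set \<Rightarrow> (nat \<Rightarrow> Qbar) set"
  where "completion_map L w A = (\<Union>s\<in>A. null_ideal L w +>\<^bsub>cauchy_ring L w\<^esub> s)"

definition local_degree :: "Qbar set \<Rightarrow> place \<Rightarrow> Qbar set \<Rightarrow> place \<Rightarrow> nat"
  where "local_degree K v L w =
    ring.dim (completion L w)
      (completion_map L w ` carrier (completion K v)) (carrier (completion L w))"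


section \<open>Consistent maps\<close>

definition index_set :: "(Qbar set \<times> place) set"
  where "index_set = {(K, v). number_field K \<and> v \<in> places K}"

text \<open>
  Maps on the index set are represented by total functions vanishing off it, so that
  equality and the pointwise vector space operations are those of the function type.
\<close>

definition consistent_maps :: "(Qbar set \<times> place \<Rightarrow> real) set"
  where "consistent_maps = {c. (\<forall>j. j \<notin> index_set \<longrightarrow> c j = 0) \<and>
    (\<forall>K v L. number_field K \<and> v \<in> places K \<and> finite_extension K L \<longrightarrow>
       c (K, v) = (\<Sum>w \<in> {w \<in> places L. divides_place K w v}. c (L, w)))}"

text \<open>
  The value does not depend on the number field chosen.  For \<open>\<alpha> \<noteq> 0\<close> only finitely
  many terms of the sum are nonzero.
\<close>

definition Phi :: "(Qbar set \<times> place \<Rightarrow> real) \<Rightarrow> Qbar \<Rightarrow> real"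
  where "Phi c \<alpha> = (let K = (SOME K. number_field K \<and> \<alpha> \<in> K)
    in \<Sum>\<^sub>\<infinity>v\<in>places K. c (K, v) * ln (place_norm v \<alpha>))"

definition roots_of_unity :: "Qbar set"
  where "roots_of_unity = {\<zeta>. \<exists>n>0. \<zeta> ^ n = 1}"

definition Qbar_mod_torsion :: "Qbar set monoid"
  where "Qbar_mod_torsion = units_of Qbar_ring Mod roots_of_unity"

text \<open>
  \<^const>\<open>Phi\<close> on the quotient group; it is constant on cosets, so each image is a singleton.
\<close>

definition Phi_quot :: "(Qbar set \<times> place \<Rightarrow> real) \<Rightarrow> Qbar set \<Rightarrow> real"
  where "Phi_quot c A = the_elem (Phi c ` A)"

definition rational_consistent_maps :: "(Qbar set \<times> place \<Rightarrow> real) set"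
  where "rational_consistent_maps =
    {c \<in> consistent_maps. \<forall>A\<in>carrier Qbar_mod_torsion. Phi_quot c A \<in> \<rat>}"

definition has_local_degree_values ::
    "Qbar set \<Rightarrow> (place \<Rightarrow> real) \<Rightarrow> (Qbar set \<times> place \<Rightarrow> real) \<Rightarrow> bool"
  where "has_local_degree_values K y c \<longleftrightarrow>
    (\<forall>v\<in>places K. \<forall>L. finite_extension K L \<longrightarrow>
       (\<forall>w\<in>places L. divides_place K w v \<longrightarrow>
          c (L, w) = real (local_degree K v L w) / real (ext_degree K L) * y v))"

end

theory Submission
  imports Defs
begin

text \<open>
  The heart of the matter is the identity \<open>\<Sum> [L\<^sub>w : K\<^sub>v] = [L : K]\<close>, the sum being over the places \<open>w\<close> of \<open>L\<close> above
  \<open>v\<close> (\<open>sum_local_degrees\<close>).  Together with the tower law for local degrees it says that the prescribed values are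
  consistent on the number fields containing \<open>K\<close>.  The values on any other number field \<open>F\<close> are then forced by
  consistency, since \<open>F\<close> and \<open>K\<close> have a common extension, and they do not depend on the choice of this extension
  (\<open>consistent_map_unique\<close>, \<open>consistent_map_extension\<close>).

  Completions enter at a single point.  A finite family in \<open>L\<close> is called a local basis at \<open>w\<close> if its \<open>K\<close>-span is
  \<open>w\<close>-dense in \<open>L\<close> and if the coefficients of a combination over \<open>K\<close> are bounded by a constant times the value of the
  combination.  Such a family is a basis of \<open>L\<^sub>w\<close> over \<open>K\<^sub>v\<close>, so that its size is the local degree
  (\<open>local_degree_eq_card_local_basis\<close>).  The tower law and the invariance under isomorphisms
  are immediate for local bases.

  The sum of the local degrees is at most \<open>[L : K]\<close>, because weak approximation turns the union of local bases at different
  places into a family that is linearly independent over \<open>K\<close>.  For the converse one may assume \<open>L = K(\<alpha>)\<close>.  The absolute value \<open>v\<close>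
  extends to a field containing all conjugates of \<open>\<alpha>\<close>: a submultiplicative norm extending \<open>v\<close> exists, and a minimal one,
  provided by Zorn's lemma, is multiplicative (\<open>extension_exists\<close>).  Evaluation at the
  conjugates pulls this extension back to places of \<open>L\<close> above \<open>v\<close>.  A polynomial in \<open>\<alpha>\<close> of degree below \<open>[L : K]\<close> that is small at
  all these places is small at all conjugates, so by Lagrange interpolation its coefficients are small.  If there were fewer
  than \<open>[L : K]\<close> elements in all local bases together, linear algebra over \<open>K\<close> would produce a polynomial that is small
  at all these places but has a large coefficient.

  Ostrowski's theorem is what makes the normalized representative of a place well defined.

  For the rationality statement, the linear form of \<open>c\<close> is additive, and it takes the same value at elements conjugate over
  \<open>K\<close>, since isomorphisms over \<open>K\<close> preserve local degrees.  Its value at \<open>\<alpha>\<close> is therefore \<open>1/d\<close> times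
  its value at the product of the \<open>d\<close> conjugates of \<open>\<alpha>\<close>, which lies in \<open>K\<close>.
\<close>

section \<open>Linear algebra over subfields\<close>

lemma Qbar_ring_simps [simp]:
  "carrier Qbar_ring = UNIV" "x \<otimes>\<^bsub>Qbar_ring\<^esub> y = x * y" "x \<oplus>\<^bsub>Qbar_ring\<^esub> y = x + y"
  "\<one>\<^bsub>Qbar_ring\<^esub> = 1" "\<zero>\<^bsub>Qbar_ring\<^esub> = 0"
  by (simp_all add: ring_of_type_algebra_def)

lemma Qbar_ring_field: "field Qbar_ring"
  by (rule field_from_type_algebra)

lemma Qbar_a_inv [simp]: "\<ominus>\<^bsub>Qbar_ring\<^esub> x = - x"
proof -
  interpret field Qbar_ring by (rule Qbar_ring_field)
  show ?thesis
    using minus_equality[of "- x" x] by simp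
qed

lemma Qbar_m_inv: "x \<noteq> 0 \<Longrightarrow> inv\<^bsub>Qbar_ring\<^esub> x = inverse x"
proof -
  assume x: "x \<noteq> 0"
  interpret field Qbar_ring by (rule Qbar_ring_field)
  show ?thesis
    using inv_char[of x "inverse x"] x by simp
qed

lemma subfield_Qbar_iff:
  "subfield K Qbar_ring \<longleftrightarrow> 0 \<in> K \<and> 1 \<in> K \<and> (\<forall>x\<in>K. \<forall>y\<in>K. x + y \<in> K \<and> x * y \<in> K) \<and>
     (\<forall>x\<in>K. - x \<in> K \<and> inverse x \<in> K)"
proof
  interpret field Qbar_ring by (rule Qbar_ring_field)
  assume K: "subfield K Qbar_ring"
  have "inverse x \<in> K" if "x \<in> K" for x
    using subfield_m_inv(1)[OF K, of x] that Qbar_m_inv[of x] by (cases "x = 0") auto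
  thus "0 \<in> K \<and> 1 \<in> K \<and> (\<forall>x\<in>K. \<forall>y\<in>K. x + y \<in> K \<and> x * y \<in> K) \<and>
     (\<forall>x\<in>K. - x \<in> K \<and> inverse x \<in> K)"
    using subringE[OF subfieldE(1)[OF K]] by auto
next
  interpret field Qbar_ring by (rule Qbar_ring_field)
  assume *: "0 \<in> K \<and> 1 \<in> K \<and> (\<forall>x\<in>K. \<forall>y\<in>K. x + y \<in> K \<and> x * y \<in> K) \<and>
     (\<forall>x\<in>K. - x \<in> K \<and> inverse x \<in> K)"
  show "subfield K Qbar_ring"
  proof (rule subfieldI')
    show "subring K Qbar_ring"
      by (rule subringI) (use * in auto)
    show "inv\<^bsub>Qbar_ring\<^esub> k \<in> K" if "k \<in> K - {\<zero>\<^bsub>Qbar_ring\<^esub>}" for k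
      using that * Qbar_m_inv[of k] by auto
  qed
qed

locale Qbar_subfield =
  fixes K :: "Qbar set"
  assumes subfield: "subfield K Qbar_ring"
begin

lemma zero_mem [simp, intro]: "0 \<in> K"
  and one_mem [simp, intro]: "1 \<in> K"
  and add_mem [intro]: "x \<in> K \<Longrightarrow> y \<in> K \<Longrightarrow> x + y \<in> K"
  and mult_mem [intro]: "x \<in> K \<Longrightarrow> y \<in> K \<Longrightarrow> x * y \<in> K"
  and uminus_mem [intro]: "x \<in> K \<Longrightarrow> - x \<in> K"
  and inverse_mem [intro]: "x \<in> K \<Longrightarrow> inverse x \<in> K"
  using subfield unfolding subfield_Qbar_iff by auto

lemma diff_mem [intro]: "x \<in> K \<Longrightarrow> y \<in> K \<Longrightarrow> x - y \<in> K"
  using add_mem[of x "- y"] uminus_mem[of y] by simp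

lemma divide_mem [intro]: "x \<in> K \<Longrightarrow> y \<in> K \<Longrightarrow> x / y \<in> K"
  using mult_mem[of x "inverse y"] inverse_mem[of y] by (simp add: divide_inverse)

lemma power_mem [intro]: "x \<in> K \<Longrightarrow> x ^ n \<in> K"
  by (induction n) auto

lemma sum_mem [intro]: "(\<And>i. i \<in> I \<Longrightarrow> f i \<in> K) \<Longrightarrow> sum f I \<in> K"
  by (induction I rule: infinite_finite_induct) auto

lemma of_nat_mem [simp, intro]: "of_nat n \<in> K"
  by (induction n) auto

lemma of_int_mem [simp, intro]: "of_int n \<in> K"
  by (cases n) (auto simp del: of_nat_Suc)

lemma of_rat_mem [simp, intro]: "of_rat r \<in> K"
  by (cases r) (simp add: of_rat_rat divide_mem)

lemma Rats_subset: "\<rat> \<subseteq> K"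
  by (auto elim!: Rats_cases)

end

lemma Rats_subfield: "subfield \<rat> Qbar_ring"
  unfolding subfield_Qbar_iff by (auto intro: Rats_add Rats_mult Rats_minus_iff Rats_inverse)

definition lin_span :: "Qbar set \<Rightarrow> 'i set \<Rightarrow> ('i \<Rightarrow> Qbar) \<Rightarrow> Qbar set"
  where "lin_span K I x = {\<Sum>i\<in>I. a i * x i | a. \<forall>i\<in>I. a i \<in> K}"

definition lin_indep :: "Qbar set \<Rightarrow> 'i set \<Rightarrow> ('i \<Rightarrow> Qbar) \<Rightarrow> bool"
  where "lin_indep K I x \<longleftrightarrow>
    (\<forall>a. (\<forall>i\<in>I. a i \<in> K) \<and> (\<Sum>i\<in>I. a i * x i) = 0 \<longrightarrow> (\<forall>i\<in>I. a i = 0))"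

lemma lin_spanE:
  assumes "z \<in> lin_span K I x"
  obtains a where "\<forall>i\<in>I. a i \<in> K" "z = (\<Sum>i\<in>I. a i * x i)"
  using assms unfolding lin_span_def by blast

text \<open>
  Gaussian elimination: the equation with the new coefficient is solved for one unknown, which
  is then eliminated from the remaining equations.
\<close>

lemma homogeneous_system_solvable:
  assumes "Qbar_subfield K" "finite E" "finite J" "card E < card J"
    and "\<And>e j. e \<in> E \<Longrightarrow> j \<in> J \<Longrightarrow> m e j \<in> K"
  shows "\<exists>a. (\<forall>j\<in>J. a j \<in> K) \<and> (\<exists>j\<in>J. a j \<noteq> 0) \<and> (\<forall>e\<in>E. (\<Sum>j\<in>J. m e j * a j) = 0)"
  using assms(2-)
proof (induction E arbitrary: J m rule: finite_induct)
  case empty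
  interpret Qbar_subfield K by fact
  from empty have "J \<noteq> {}" by auto
  then obtain j where "j \<in> J" by blast
  thus ?case by (intro exI[of _ "\<lambda>_. 1"]) auto
next
  case (insert e E J m)
  interpret Qbar_subfield K by fact
  show ?case
  proof (cases "\<forall>j\<in>J. m e j = 0")
    case True
    have "card E < card J" using insert.prems insert.hyps by simp
    hence "\<exists>a. (\<forall>j\<in>J. a j \<in> K) \<and> (\<exists>j\<in>J. a j \<noteq> 0) \<and> (\<forall>e'\<in>E. (\<Sum>j\<in>J. m e' j * a j) = 0)"
      by (rule insert.IH[OF insert.prems(1)]) (use insert.prems(3) in auto)
    with True show ?thesis by auto
  next
    case False
    then obtain k where k: "k \<in> J" "m e k \<noteq> 0" by blast
    define m' where "m' e' j = m e' j - m e' k * m e j / m e k" for e' j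
    have fin: "finite (J - {k})" and cd: "card E < card (J - {k})"
      using insert.prems insert.hyps k by auto
    have m'K: "m' e' j \<in> K" if "e' \<in> E" "j \<in> J - {k}" for e' j
      unfolding m'_def using insert.prems(3) that k by (intro diff_mem divide_mem mult_mem) auto
    have "\<exists>a. (\<forall>j\<in>J - {k}. a j \<in> K) \<and> (\<exists>j\<in>J - {k}. a j \<noteq> 0) \<and>
        (\<forall>e'\<in>E. (\<Sum>j\<in>J - {k}. m' e' j * a j) = 0)"
      by (rule insert.IH[OF fin cd]) (rule m'K)
    then obtain a where
      a: "\<forall>j\<in>J - {k}. a j \<in> K" "\<exists>j\<in>J - {k}. a j \<noteq> 0"
         "\<forall>e'\<in>E. (\<Sum>j\<in>J - {k}. m' e' j * a j) = 0" by (elim exE conjE)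
    define s where "s = (\<Sum>j\<in>J - {k}. m e j * a j)"
    define b where "b = a(k := - s / m e k)"
    have sK: "s \<in> K" unfolding s_def by (rule sum_mem) (use a(1) insert.prems(3) in auto)
    have bK: "\<forall>j\<in>J. b j \<in> K"
      unfolding b_def using a(1) sK k insert.prems(3)[of e k] by auto
    have bnz: "\<exists>j\<in>J. b j \<noteq> 0" using a(2) by (auto simp: b_def)
    have split: "(\<Sum>j\<in>J. m e' j * b j) = m e' k * b k + (\<Sum>j\<in>J - {k}. m e' j * a j)" for e'
    proof -
      have "(\<Sum>j\<in>J. m e' j * b j) = m e' k * b k + (\<Sum>j\<in>J - {k}. m e' j * b j)"
        using insert.prems(1) k(1) by (rule sum.remove)
      also have "(\<Sum>j\<in>J - {k}. m e' j * b j) = (\<Sum>j\<in>J - {k}. m e' j * a j)"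
        by (rule sum.cong) (auto simp: b_def)
      finally show ?thesis .
    qed
    have "(\<Sum>j\<in>J. m e' j * b j) = 0" if "e' \<in> E" for e'
    proof -
      have "0 = (\<Sum>j\<in>J - {k}. m e' j * a j - m e' k / m e k * (m e j * a j))"
        using a(3) that by (simp add: m'_def algebra_simps)
      also have "\<dots> = (\<Sum>j\<in>J - {k}. m e' j * a j) - m e' k / m e k * s"
        by (simp add: sum_subtractf sum_distrib_left s_def)
      finally show ?thesis unfolding split by (simp add: b_def)
    qed
    moreover have "(\<Sum>j\<in>J. m e j * b j) = 0"
      unfolding split using k by (simp add: b_def s_def)
    ultimately show ?thesis using bK bnz by blast
  qed
qed

lemma lin_indep_card_le:
  assumes K: "Qbar_subfield K" and "finite I" "finite J"
    and ind: "lin_indep K J y" and sp: "\<And>j. j \<in> J \<Longrightarrow> y j \<in> lin_span K I x"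
  shows "card J \<le> card I"
proof (rule ccontr)
  assume "\<not> ?thesis"
  hence less: "card I < card J" by simp
  interpret Qbar_subfield K by fact
  have "\<forall>j\<in>J. \<exists>a. (\<forall>i\<in>I. a i \<in> K) \<and> y j = (\<Sum>i\<in>I. a i * x i)"
    using sp by (fastforce simp: lin_span_def)
  from bchoice[OF this] obtain m
    where m: "\<forall>j\<in>J. (\<forall>i\<in>I. m j i \<in> K) \<and> y j = (\<Sum>i\<in>I. m j i * x i)" by blast
  obtain a where a: "\<forall>j\<in>J. a j \<in> K" "\<exists>j\<in>J. a j \<noteq> 0" "\<forall>i\<in>I. (\<Sum>j\<in>J. m j i * a j) = 0"
    using homogeneous_system_solvable[OF K assms(2,3) less, of "\<lambda>i j. m j i"] m by blast
  have "(\<Sum>j\<in>J. a j * y j) = (\<Sum>j\<in>J. \<Sum>i\<in>I. m j i * a j * x i)"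
    using m by (intro sum.cong) (auto simp: sum_distrib_left algebra_simps)
  also have "\<dots> = (\<Sum>i\<in>I. \<Sum>j\<in>J. m j i * a j * x i)" by (rule sum.swap)
  also have "\<dots> = (\<Sum>i\<in>I. (\<Sum>j\<in>J. m j i * a j) * x i)" by (simp add: sum_distrib_right)
  also have "\<dots> = 0" using a(3) by simp
  finally show False using ind a unfolding lin_indep_def by blast
qed

lemma combine_eq_sum:
  "length ks = length us \<Longrightarrow> ring.combine Qbar_ring ks us = (\<Sum>i<length us. ks ! i * us ! i)"
proof (induction ks us rule: list_induct2)
  interpret field Qbar_ring by (rule Qbar_ring_field)
  case Nil thus ?case by simp
next
  interpret field Qbar_ring by (rule Qbar_ring_field)
  case (Cons k ks u us)
  thus ?case by (simp add: sum.lessThan_Suc_shift del: sum.lessThan_Suc)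
qed

lemma Span_eq_lin_span:
  assumes K: "subfield K Qbar_ring"
  shows "ring.Span Qbar_ring K us = lin_span K {..<length us} (\<lambda>i. us ! i)"
proof -
  interpret field Qbar_ring by (rule Qbar_ring_field)
  have "Span K us = {combine Ks us | Ks. length Ks = length us \<and> set Ks \<subseteq> K}"
    by (rule Span_eq_combine_set_length_version[OF K]) simp
  also have "\<dots> = lin_span K {..<length us} (\<lambda>i. us ! i)"
  proof (rule Set.set_eqI, rule iffI)
    fix z assume "z \<in> {combine Ks us | Ks. length Ks = length us \<and> set Ks \<subseteq> K}"
    then obtain Ks where Ks: "z = combine Ks us" "length Ks = length us" "set Ks \<subseteq> K" by blast
    have "z = (\<Sum>i\<in>{..<length us}. Ks ! i * us ! i)" using combine_eq_sum Ks by blast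
    moreover have "\<forall>i\<in>{..<length us}. Ks ! i \<in> K"
      using Ks by (metis lessThan_iff nth_mem subsetD)
    ultimately show "z \<in> lin_span K {..<length us} (\<lambda>i. us ! i)"
      unfolding lin_span_def by (intro CollectI exI[of _ "\<lambda>i. Ks ! i"]) auto
  next
    fix z assume "z \<in> lin_span K {..<length us} (\<lambda>i. us ! i)"
    then obtain a where a: "z = (\<Sum>i<length us. a i * us ! i)" "\<forall>i<length us. a i \<in> K"
      unfolding lin_span_def by auto
    have "z = combine (map a [0..<length us]) us"
      using combine_eq_sum[of "map a [0..<length us]" us] a(1) by simp
    thus "z \<in> {combine Ks us | Ks. length Ks = length us \<and> set Ks \<subseteq> K}"
      using a(2) by (intro CollectI exI[of _ "map a [0..<length us]"]) auto
  qed
  finally show ?thesis .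
qed

lemma independent_eq_lin_indep:
  assumes K: "subfield K Qbar_ring"
  shows "ring.independent Qbar_ring K us \<longleftrightarrow> lin_indep K {..<length us} (\<lambda>i. us ! i)"
proof
  interpret field Qbar_ring by (rule Qbar_ring_field)
  assume ind: "independent K us"
  show "lin_indep K {..<length us} (\<lambda>i. us ! i)"
    unfolding lin_indep_def
  proof (intro allI impI, elim conjE)
    fix a assume a: "\<forall>i\<in>{..<length us}. a i \<in> K" "(\<Sum>i<length us. a i * us ! i) = 0"
    have "combine (map a [0..<length us]) us = \<zero>\<^bsub>Qbar_ring\<^esub>"
      using combine_eq_sum[of "map a [0..<length us]" us] a(2) by simp
    from independent_imp_trivial_combine[OF K ind _ this] a(1)
    show "\<forall>i\<in>{..<length us}. a i = 0" by (fastforce simp: image_subset_iff)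
  qed
next
  interpret field Qbar_ring by (rule Qbar_ring_field)
  assume ind: "lin_indep K {..<length us} (\<lambda>i. us ! i)"
  show "independent K us"
  proof (rule ccontr)
    assume "\<not> independent K us"
    then obtain Ks where Ks: "length Ks = length us" "combine Ks us = \<zero>\<^bsub>Qbar_ring\<^esub>" "set Ks \<subseteq> K"
        "set Ks \<noteq> {\<zero>\<^bsub>Qbar_ring\<^esub>}"
      using dependent_imp_non_trivial_combine[OF K, of us] by auto
    have "(\<Sum>i<length us. Ks ! i * us ! i) = 0" using combine_eq_sum[OF Ks(1)] Ks(2) by simp
    moreover have "\<forall>i\<in>{..<length us}. Ks ! i \<in> K"
      using Ks by (metis lessThan_iff nth_mem subsetD)
    ultimately have *: "\<forall>i\<in>{..<length us}. Ks ! i = 0" using ind unfolding lin_indep_def by blast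
    hence "set Ks \<subseteq> {0}" using Ks(1) by (auto simp: in_set_conv_nth)
    with Ks(4) have "Ks = []" by (cases Ks) auto
    with Ks(1) \<open>\<not> independent K us\<close> show False by simp
  qed
qed

lemma lin_span_cong:
  "(\<And>i. i \<in> I \<Longrightarrow> x i = y i) \<Longrightarrow> lin_span K I x = lin_span K I y"
  unfolding lin_span_def by (simp cong: sum.cong)

lemma lin_span_reindex:
  assumes "bij_betw h J I"
  shows "lin_span K I x = lin_span K J (\<lambda>j. x (h j))"
proof (rule Set.set_eqI, rule iffI)
  fix z assume "z \<in> lin_span K I x"
  then obtain a where a: "z = (\<Sum>i\<in>I. a i * x i)" "\<forall>i\<in>I. a i \<in> K" unfolding lin_span_def by auto
  have "z = (\<Sum>j\<in>J. a (h j) * x (h j))" unfolding a(1) by (rule sum.reindex_bij_betw[OF assms, symmetric])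
  thus "z \<in> lin_span K J (\<lambda>j. x (h j))" unfolding lin_span_def using a(2) assms
    by (intro CollectI exI[of _ "a \<circ> h"]) (auto simp: bij_betw_def)
next
  fix z assume "z \<in> lin_span K J (\<lambda>j. x (h j))"
  then obtain a where a: "z = (\<Sum>j\<in>J. a j * x (h j))" "\<forall>j\<in>J. a j \<in> K" unfolding lin_span_def by auto
  define g where "g = the_inv_into J h"
  have g: "g (h j) = j" if "j \<in> J" for j
    unfolding g_def using assms that by (auto simp: bij_betw_def intro: the_inv_into_f_f)
  have "z = (\<Sum>j\<in>J. a (g (h j)) * x (h j))" unfolding a(1) by (rule sum.cong) (auto simp: g)
  also have "\<dots> = (\<Sum>i\<in>I. a (g i) * x i)" by (rule sum.reindex_bij_betw[OF assms])
  finally show "z \<in> lin_span K I x" unfolding lin_span_def using a(2) assms g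
    by (intro CollectI exI[of _ "a \<circ> g"]) (auto simp: bij_betw_def)
qed

lemma lin_indep_reindex:
  assumes "bij_betw h J I" "lin_indep K I x"
  shows "lin_indep K J (\<lambda>j. x (h j))"
  unfolding lin_indep_def
proof (intro allI impI, elim conjE)
  fix a assume a: "\<forall>j\<in>J. a j \<in> K" "(\<Sum>j\<in>J. a j * x (h j)) = 0"
  define g where "g = the_inv_into J h"
  have g: "g (h j) = j" if "j \<in> J" for j
    unfolding g_def using assms that by (auto simp: bij_betw_def intro: the_inv_into_f_f)
  have "0 = (\<Sum>j\<in>J. a (g (h j)) * x (h j))" unfolding a(2)[symmetric] by (rule sum.cong) (auto simp: g)
  also have "\<dots> = (\<Sum>i\<in>I. a (g i) * x i)" by (rule sum.reindex_bij_betw[OF assms(1)])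
  finally have "(\<Sum>i\<in>I. a (g i) * x i) = 0" by simp
  moreover have "\<forall>i\<in>I. a (g i) \<in> K" using a(1) assms(1) g by (auto simp: bij_betw_def)
  ultimately have "\<forall>i\<in>I. a (g i) = 0" using assms(2) unfolding lin_indep_def by fast
  thus "\<forall>j\<in>J. a j = 0" using g assms(1) by (auto simp: bij_betw_def)
qed

lemma lin_span_eq_Span:
  assumes K: "subfield K Qbar_ring" and "finite I"
  obtains us where "length us = card I" "ring.Span Qbar_ring K us = lin_span K I x"
    "lin_indep K I x \<longrightarrow> ring.independent Qbar_ring K us"
proof -
  obtain h where h: "bij_betw h {..<card I} I"
    using ex_bij_betw_nat_finite[OF assms(2)] by (auto simp: atLeast0LessThan)
  define us where "us = map (x \<circ> h) [0..<card I]"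
  have len: "length us = card I" by (simp add: us_def)
  have nth: "us ! i = x (h i)" if "i < card I" for i using that by (simp add: us_def)
  show ?thesis
  proof (rule that[OF len])
    show "ring.Span Qbar_ring K us = lin_span K I x"
      unfolding Span_eq_lin_span[OF K] len lin_span_reindex[OF h]
      by (rule lin_span_cong) (simp add: nth)
    show "lin_indep K I x \<longrightarrow> ring.independent Qbar_ring K us"
    proof
      assume "lin_indep K I x"
      hence "lin_indep K {..<length us} (\<lambda>i. us ! i)"
        using lin_indep_reindex[OF h] unfolding len lin_indep_def by (simp add: nth)
      thus "ring.independent Qbar_ring K us" using independent_eq_lin_indep[OF K] by simp
    qed
  qed
qed

lemma dimension_card_basis:
  assumes K: "subfield K Qbar_ring" and "finite I" "lin_indep K I x"
  shows "ring.dimension Qbar_ring (card I) K (lin_span K I x)"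
proof -
  interpret field Qbar_ring by (rule Qbar_ring_field)
  obtain us where "length us = card I" "Span K us = lin_span K I x" "lin_indep K I x \<longrightarrow> independent K us"
    by (rule lin_span_eq_Span[OF assms(1,2)])
  thus ?thesis using dimension_independent[of K us] assms(3) by simp
qed

lemma finite_dimension_lin_span:
  assumes K: "subfield K Qbar_ring" and "finite I"
  shows "ring.finite_dimension Qbar_ring K (lin_span K I x)"
proof -
  interpret field Qbar_ring by (rule Qbar_ring_field)
  obtain us where "length us = card I" "Span K us = lin_span K I x" "lin_indep K I x \<longrightarrow> independent K us"
    by (rule lin_span_eq_Span[OF assms])
  thus ?thesis using Span_finite_dimension[OF K, of us] by simp
qed

lemma lin_span_mem:
  assumes "Qbar_subfield K" "finite I" "i \<in> I"
  shows "x i \<in> lin_span K I x"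
proof -
  interpret Qbar_subfield K by fact
  have "(\<Sum>j\<in>I. (if j = i then 1 else 0) * x j) = x i"
    using assms(2,3) by (simp add: if_distrib[of "\<lambda>c. c * _"] sum.delta cong: if_cong)
  thus ?thesis unfolding lin_span_def by (intro CollectI exI[of _ "\<lambda>j. if j = i then 1 else 0"]) auto
qed

section \<open>Finite extensions\<close>

lemma finite_extension_subfields:
  assumes "finite_extension K L"
  shows "Qbar_subfield K" "Qbar_subfield L" "K \<subseteq> L"
  using assms by (auto simp: finite_extension_def Qbar_subfield_def)

lemma finite_extension_dimension:
  assumes "finite_extension K L"
  shows "ring.dimension Qbar_ring (ext_degree K L) K L"
proof -
  interpret field Qbar_ring by (rule Qbar_ring_field)
  show ?thesis using assms finite_dimensionE[of K L]
    unfolding finite_extension_def ext_degree_def by (simp add: over_def)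
qed

lemma ext_degree_eqI:
  assumes "subfield K Qbar_ring" "ring.dimension Qbar_ring n K L"
  shows "ext_degree K L = n"
proof -
  interpret field Qbar_ring by (rule Qbar_ring_field)
  show ?thesis using dimI[OF assms] by (simp add: ext_degree_def over_def)
qed

lemma finite_extension_basis:
  assumes "finite_extension K L"
  obtains b :: "nat \<Rightarrow> Qbar" where "lin_indep K {..<ext_degree K L} b"
    "lin_span K {..<ext_degree K L} b = L" "\<forall>i<ext_degree K L. b i \<in> L"
proof -
  interpret field Qbar_ring by (rule Qbar_ring_field)
  have K: "subfield K Qbar_ring" using assms by (simp add: finite_extension_def)
  obtain us where us: "independent K us" "length us = ext_degree K L" "Span K us = L"
    using exists_base[OF K finite_extension_dimension[OF assms]] by blast
  have sp: "lin_span K {..<ext_degree K L} (\<lambda>i. us ! i) = L" using Span_eq_lin_span[OF K, of us] us by simp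
  show ?thesis
  proof (rule that)
    show "lin_indep K {..<ext_degree K L} (\<lambda>i. us ! i)"
      using independent_eq_lin_indep[OF K, of us] us by simp
    show "\<forall>i<ext_degree K L. us ! i \<in> L"
      using lin_span_mem[of K "{..<ext_degree K L}" _ "\<lambda>i. us ! i"] sp K
      by (auto simp: Qbar_subfield_def)
  qed (rule sp)
qed

lemma ext_degree_eq_card_basis:
  assumes "Qbar_subfield K" "finite I" "lin_indep K I x" "lin_span K I x = L"
  shows "ext_degree K L = card I"
  using ext_degree_eqI dimension_card_basis assms unfolding Qbar_subfield_def by blast

lemma finite_extensionI:
  assumes "Qbar_subfield K" "Qbar_subfield L" "K \<subseteq> L" "finite I" "lin_span K I x = L"
  shows "finite_extension K L"
  using assms finite_dimension_lin_span[of K I x] unfolding finite_extension_def Qbar_subfield_def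
  by simp

lemma finite_extension_refl:
  assumes "Qbar_subfield K"
  shows "finite_extension K K"
proof -
  have "lin_span K {()} (\<lambda>_. 1) = K" by (auto simp: lin_span_def)
  thus ?thesis using finite_extensionI[OF assms assms] by blast
qed

lemma finite_extension_trans:
  assumes "finite_extension K L" "finite_extension L M"
  shows "finite_extension K M" "ext_degree K M = ext_degree K L * ext_degree L M"
proof -
  have R: "ring Qbar_ring" by (rule ring_from_type_algebra)
  have K: "subfield K Qbar_ring" and L: "subfield L Qbar_ring"
    using assms by (simp_all add: finite_extension_def)
  have d: "ring.dimension Qbar_ring (ext_degree K L * ext_degree L M) K M"
    by (rule ring.telescopic_base[OF R K L finite_extension_dimension[OF assms(1)]
          finite_extension_dimension[OF assms(2)]])
  show "ext_degree K M = ext_degree K L * ext_degree L M" by (rule ext_degree_eqI[OF K d])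
  show "finite_extension K M"
    using assms ring.finite_dimensionI[OF R d] unfolding finite_extension_def by auto
qed

lemma finite_extension_top:
  assumes "finite_extension K M" "Qbar_subfield L" "K \<subseteq> L" "L \<subseteq> M"
  shows "finite_extension L M"
proof -
  interpret L: Qbar_subfield L by fact
  interpret M: Qbar_subfield M using finite_extension_subfields[OF assms(1)] by simp
  obtain b where "lin_indep K {..<ext_degree K M} b" and
    b: "lin_span K {..<ext_degree K M} b = M" "\<forall>i<ext_degree K M. b i \<in> M"
    by (rule finite_extension_basis[OF assms(1)])
  have "lin_span L {..<ext_degree K M} b = M"
  proof
    show "lin_span L {..<ext_degree K M} b \<subseteq> M"
    proof
      fix z assume "z \<in> lin_span L {..<ext_degree K M} b"
      then obtain a where a: "z = (\<Sum>i<ext_degree K M. a i * b i)" "\<And>i. i < ext_degree K M \<Longrightarrow> a i \<in> L"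
        unfolding lin_span_def by auto
      show "z \<in> M" unfolding a(1)
        by (rule M.sum_mem) (use a(2) b(2) assms(4) in auto)
    qed
    have "lin_span K {..<ext_degree K M} b \<subseteq> lin_span L {..<ext_degree K M} b"
      unfolding lin_span_def using assms(3) by blast
    thus "M \<subseteq> lin_span L {..<ext_degree K M} b" using b(1) by simp
  qed
  thus ?thesis by (intro finite_extensionI[OF _ _ assms(4)])
    (auto simp: L.Qbar_subfield_axioms M.Qbar_subfield_axioms)
qed

lemma number_field_subfield: "number_field K \<Longrightarrow> Qbar_subfield K"
  by (simp add: number_field_def finite_extension_subfields)

lemma number_field_extension:
  "number_field K \<Longrightarrow> finite_extension K L \<Longrightarrow> number_field L"
  unfolding number_field_def by (rule finite_extension_trans)

lemma number_field_finite_extension: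
  assumes "number_field K" "number_field L" "K \<subseteq> L"
  shows "finite_extension K L"
  using finite_extension_top[of \<rat> L K] assms number_field_subfield[OF assms(1)]
  by (simp add: number_field_def Qbar_subfield.Rats_subset)

lemma ext_degree_pos:
  assumes "finite_extension K L"
  shows "ext_degree K L > 0"
proof (rule ccontr)
  assume "\<not> ?thesis"
  hence 0: "ext_degree K L = 0" by simp
  obtain b where "lin_indep K {..<ext_degree K L} b"
    and b: "lin_span K {..<ext_degree K L} b = L" and "\<forall>i<ext_degree K L. b i \<in> L"
    by (rule finite_extension_basis[OF assms])
  have "L = {0}" using b 0 by (simp add: lin_span_def)
  moreover have "1 \<in> L" using finite_extension_subfields(2)[OF assms] by (rule Qbar_subfield.one_mem)
  ultimately show False by simp
qed

section \<open>Absolute values\<close>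

text \<open>
  A factor growing linearly in the exponent disappears after taking roots: if \<open>b < a\<close>, then
  \<open>(c n + d) (b / a)\<^sup>n\<close> tends to 0.
\<close>

lemma power_bound_linear_factor_imp_le:
  fixes a b c d :: real
  assumes "a \<ge> 0" "b \<ge> 0" and le: "\<And>n. a ^ n \<le> (c * real n + d) * b ^ n"
  shows "a \<le> b"
proof (rule ccontr)
  assume "\<not> a \<le> b"
  hence ab: "b < a" by simp
  have "b \<noteq> 0"
    using le[of 1] ab by auto
  hence b: "b > 0" using assms by simp
  define q where "q = b / a"
  have q: "0 < q" "q < 1" using ab b by (auto simp: q_def)
  have "(\<lambda>n. c * (real n * q ^ n) + d * q ^ n) \<longlonglongrightarrow> c * 0 + d * 0"
    using q by (intro tendsto_intros powser_times_n_limit_0 LIMSEQ_power_zero) auto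
  moreover have "1 \<le> c * (real n * q ^ n) + d * q ^ n" for n
  proof -
    have "a ^ n * 1 \<le> a ^ n * (c * (real n * q ^ n) + d * q ^ n)"
      using le[of n] b ab by (simp add: q_def power_divide field_simps)
    thus ?thesis using b ab by simp
  qed
  ultimately have "1 \<le> c * 0 + d * (0::real)"
    by (intro LIMSEQ_le_const) auto
  thus False by simp
qed

lemma power_powr_eq:
  fixes x :: real
  assumes "x \<ge> 0"
  shows "(x ^ k) powr t = (x powr t) ^ k"
  using assms by (induction k) (simp_all add: powr_mult)

locale abs_value = Qbar_subfield L for L +
  fixes f :: "Qbar \<Rightarrow> real"
  assumes nonneg: "x \<in> L \<Longrightarrow> 0 \<le> f x"
    and eq_0_iff: "x \<in> L \<Longrightarrow> f x = 0 \<longleftrightarrow> x = 0"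
    and mult: "x \<in> L \<Longrightarrow> y \<in> L \<Longrightarrow> f (x * y) = f x * f y"
    and triangle: "x \<in> L \<Longrightarrow> y \<in> L \<Longrightarrow> f (x + y) \<le> f x + f y"
begin

lemma pos: "x \<in> L \<Longrightarrow> x \<noteq> 0 \<Longrightarrow> 0 < f x"
  using nonneg[of x] eq_0_iff[of x] by simp

lemma zero [simp]: "f 0 = 0"
  using eq_0_iff by simp

lemma one [simp]: "f 1 = 1"
  using mult[of 1 1] eq_0_iff[of 1] by simp

lemma power: "x \<in> L \<Longrightarrow> f (x ^ n) = f x ^ n"
  by (induction n) (auto simp: mult power_mem)

lemma uminus: "x \<in> L \<Longrightarrow> f (- x) = f x"
proof -
  assume x: "x \<in> L"
  have "f (-1) ^ 2 = 1" using power[of "-1" 2] uminus_mem[of 1] by simp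
  hence "f (-1) = 1" using nonneg[of "-1"] uminus_mem[of 1] by (simp add: power2_eq_1_iff)
  thus ?thesis using mult[of "-1" x] x uminus_mem[of 1] by simp
qed

lemma inverse: "x \<in> L \<Longrightarrow> f (inverse x) = inverse (f x)"
proof (cases "x = 0")
  case False
  assume x: "x \<in> L"
  have "f x * f (inverse x) = 1" using mult[of x "inverse x"] x False inverse_mem by simp
  thus ?thesis using inverse_unique[of "f x" "f (inverse x)"] by simp
qed simp

lemma divide: "x \<in> L \<Longrightarrow> y \<in> L \<Longrightarrow> f (x / y) = f x / f y"
  by (simp add: divide_inverse mult inverse inverse_mem)

lemma diff_triangle: "x \<in> L \<Longrightarrow> y \<in> L \<Longrightarrow> f (x - y) \<le> f x + f y"
  using triangle[of x "- y"] uminus[of y] uminus_mem[of y] by simp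

lemma diff_commute: "x \<in> L \<Longrightarrow> y \<in> L \<Longrightarrow> f (x - y) = f (y - x)"
  using uminus[of "x - y"] diff_mem[of x y] by simp

lemma triangle_rev: "x \<in> L \<Longrightarrow> y \<in> L \<Longrightarrow> f x - f y \<le> f (x - y)"
  using triangle[of "x - y" y] diff_mem[of x y] by simp

lemma sum_triangle: "(\<And>i. i \<in> I \<Longrightarrow> x i \<in> L) \<Longrightarrow> f (\<Sum>i\<in>I. x i) \<le> (\<Sum>i\<in>I. f (x i))"
proof (induction I rule: infinite_finite_induct)
  case (insert i I)
  have "f (x i + sum x I) \<le> f (x i) + f (sum x I)"
    using insert.prems by (intro triangle sum_mem) auto
  thus ?case using insert by fastforce
qed auto

lemma of_nat_le: "f (of_nat n) \<le> real n"
proof (induction n)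
  case (Suc n)
  have "f (of_nat n + 1) \<le> f (of_nat n) + f 1" by (intro triangle) auto
  thus ?case using Suc by (simp add: add.commute)
qed simp

lemma of_int: "f (of_int m) = f (of_nat (nat \<bar>m\<bar>))"
proof (cases "m < 0")
  case True
  hence "(of_int m :: Qbar) = - of_nat (nat \<bar>m\<bar>)"
    using of_int_of_nat[of m, where ?'a = Qbar] by (simp only: if_True abs_of_neg)
  thus ?thesis using uminus[OF of_nat_mem, of "nat \<bar>m\<bar>"] by (simp only:)
next
  case False
  hence "(of_int m :: Qbar) = of_nat (nat \<bar>m\<bar>)" by simp
  thus ?thesis by (simp only:)
qed

lemma of_rat_fract:
  assumes "quotient_of r = (a, b)"
  shows "f (of_rat r) = f (of_nat (nat \<bar>a\<bar>)) / f (of_nat (nat \<bar>b\<bar>))"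
proof -
  have "of_rat r = (of_int a / of_int b :: Qbar)"
    using quotient_of_div[OF assms] by (simp add: of_rat_divide)
  hence "f (of_rat r) = f (of_int a) / f (of_int b)" by (simp add: divide)
  thus ?thesis by (simp only: of_int)
qed

lemma binomial_bound:
  assumes "x \<in> L" "y \<in> L"
  shows "f (x + y) ^ N \<le> (\<Sum>k\<le>N. f (of_nat (N choose k)) * f x ^ k * f y ^ (N - k))"
proof -
  have "f (x + y) ^ N = f (\<Sum>k\<le>N. of_nat (N choose k) * x ^ k * y ^ (N - k))"
    using power[of "x + y" N] assms add_mem by (simp add: binomial_ring)
  also have "\<dots> \<le> (\<Sum>k\<le>N. f (of_nat (N choose k) * x ^ k * y ^ (N - k)))"
    using assms by (intro sum_triangle mult_mem power_mem) auto
  also have "\<dots> = (\<Sum>k\<le>N. f (of_nat (N choose k)) * f x ^ k * f y ^ (N - k))"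
    using assms by (intro sum.cong refl) (simp add: mult mult_mem power_mem power)
  finally show ?thesis .
qed

text \<open>
  Both the ultrametric inequality for absolute values bounded on the integers and the triangle
  inequality for roots of absolute values come from the binomial expansion of a high power: it
  has only linearly many terms, a factor that disappears after taking roots.
\<close>

lemma ultrametric:
  assumes "\<And>n. f (of_nat n) \<le> 1" "x \<in> L" "y \<in> L"
  shows "f (x + y) \<le> max (f x) (f y)"
proof (rule power_bound_linear_factor_imp_le)
  let ?M = "max (f x) (f y)"
  have M: "0 \<le> ?M" using nonneg[OF assms(2)] by simp
  show "0 \<le> f (x + y)" "0 \<le> ?M"
    using nonneg assms add_mem M by auto
  show "f (x + y) ^ N \<le> (1 * real N + 1) * ?M ^ N" for N
  proof -
    have "f (of_nat (N choose k)) * f x ^ k * f y ^ (N - k) \<le> ?M ^ N" if "k \<le> N" for k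
    proof -
      have "f (of_nat (N choose k)) * f x ^ k * f y ^ (N - k) \<le> 1 * ?M ^ k * ?M ^ (N - k)"
        using assms nonneg M by (intro mult_mono power_mono mult_nonneg_nonneg) auto
      also have "\<dots> = ?M ^ N" using that by (simp flip: power_add)
      finally show ?thesis .
    qed
    hence "(\<Sum>k\<le>N. f (of_nat (N choose k)) * f x ^ k * f y ^ (N - k)) \<le> (\<Sum>k\<le>N. ?M ^ N)"
      by (intro sum_mono) auto
    with binomial_bound[OF assms(2,3), of N] show ?thesis by (simp add: algebra_simps)
  qed
qed

lemma abs_value_root:
  assumes t: "t > 0" and le: "\<And>n. f (of_nat n) \<le> real n powr t"
  shows "abs_value L (\<lambda>x. f x powr (1 / t))"
proof
  let ?g = "\<lambda>x. f x powr (1 / t)"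
  have gt: "?g x powr t = f x" if "x \<in> L" for x
    using t nonneg[OF that] by (simp add: powr_powr)
  show "0 \<le> ?g x" for x by simp
  show "?g x = 0 \<longleftrightarrow> x = 0" if "x \<in> L" for x
    using eq_0_iff[OF that] by simp
  show gm: "?g (x * y) = ?g x * ?g y" if "x \<in> L" "y \<in> L" for x y
    using that nonneg by (simp add: mult powr_mult)
  show "?g (x + y) \<le> ?g x + ?g y" if x: "x \<in> L" and y: "y \<in> L" for x y
  proof -
    let ?s = "?g x + ?g y"
    have s0: "?s \<ge> 0" by (intro add_nonneg_nonneg) auto
    have pw: "f z ^ k = (?g z ^ k) powr t" if "z \<in> L" for z k
      using gt[OF that] by (simp add: power_powr_eq del: powr_powr)
    have "f (x + y) \<le> ?s powr t"
    proof (rule power_bound_linear_factor_imp_le)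
      show "0 \<le> f (x + y)" using nonneg x y add_mem by auto
      show "0 \<le> ?s powr t" by simp
      show "f (x + y) ^ N \<le> (1 * real N + 1) * (?s powr t) ^ N" for N
      proof -
        have "f (of_nat (N choose k)) * f x ^ k * f y ^ (N - k) \<le> (?s ^ N) powr t" if "k \<le> N" for k
        proof -
          have "f (of_nat (N choose k)) * f x ^ k * f y ^ (N - k)
              \<le> real (N choose k) powr t * (?g x ^ k) powr t * (?g y ^ (N - k)) powr t"
            unfolding pw[OF x] pw[OF y] by (intro mult_right_mono le) auto
          also have "\<dots> = (real (N choose k) * ?g x ^ k * ?g y ^ (N - k)) powr t"
            by (simp add: powr_mult)
          also have "\<dots> \<le> (?s ^ N) powr t"
          proof (rule powr_mono2)
            have "real (N choose k) * ?g x ^ k * ?g y ^ (N - k)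
                \<le> (\<Sum>j\<le>N. real (N choose j) * ?g x ^ j * ?g y ^ (N - j))"
              using that by (intro member_le_sum) auto
            also have "\<dots> = ?s ^ N" by (simp add: binomial_ring)
            finally show "real (N choose k) * ?g x ^ k * ?g y ^ (N - k) \<le> ?s ^ N" .
          qed (use t in auto)
          finally show ?thesis .
        qed
        hence "(\<Sum>k\<le>N. f (of_nat (N choose k)) * f x ^ k * f y ^ (N - k)) \<le> (\<Sum>k\<le>N. (?s ^ N) powr t)"
          by (intro sum_mono) auto
        moreover have "(?s ^ N) powr t = (?s powr t) ^ N"
          by (rule power_powr_eq[OF s0])
        ultimately show ?thesis
          using binomial_bound[OF x y, of N] by (simp add: algebra_simps)
      qed
    qed
    hence "f (x + y) powr (1 / t) \<le> (?s powr t) powr (1 / t)"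
      using t nonneg x y add_mem by (intro powr_mono2) auto
    also have "\<dots> = ?s" using t s0 by (simp add: powr_powr)
    finally show ?thesis .
  qed
qed

lemma abs_value_subfield:
  assumes "Qbar_subfield K" "K \<subseteq> L"
  shows "abs_value K f"
  using assms nonneg eq_0_iff mult triangle
  by (auto simp: abs_value_def abs_value_axioms_def subset_iff)

end

lemma abs_value_cong:
  assumes "abs_value L f" "\<And>x. x \<in> L \<Longrightarrow> g x = f x"
  shows "abs_value L g"
proof -
  interpret abs_value L f by fact
  show ?thesis
    by unfold_locales
      (simp_all add: assms(2) nonneg eq_0_iff mult triangle add_mem mult_mem)
qed

text \<open>
  If \<open>f\<close> were trivial on \<open>K\<close>, it would be bounded on \<open>L\<close> by the sum of its values on a
  basis; but a bounded absolute value on a field is trivial.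
\<close>

lemma nontrivial_on_subfield:
  assumes "abs_value L f" "finite_extension K L" "\<exists>x\<in>L. x \<noteq> 0 \<and> f x \<noteq> 1"
  shows "\<exists>x\<in>K. x \<noteq> 0 \<and> f x \<noteq> 1"
proof (rule ccontr)
  interpret abs_value L f by fact
  have KL: "K \<subseteq> L" using assms(2) finite_extension_subfields by blast
  assume "\<not> ?thesis"
  hence triv: "f x \<le> 1" if "x \<in> K" for x using that by (cases "x = 0") auto
  obtain b where "lin_indep K {..<ext_degree K L} b" and
    b: "lin_span K {..<ext_degree K L} b = L" "\<forall>i<ext_degree K L. b i \<in> L"
    by (rule finite_extension_basis[OF assms(2)])
  define C where "C = (\<Sum>i<ext_degree K L. f (b i))"
  have bd: "f x \<le> C" if "x \<in> L" for x
  proof -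
    have "x \<in> lin_span K {..<ext_degree K L} b" using that b(1) by simp
    then obtain a where a: "\<forall>i\<in>{..<ext_degree K L}. a i \<in> K"
        "x = (\<Sum>i<ext_degree K L. a i * b i)"
      by (rule lin_spanE)
    have "f x \<le> (\<Sum>i<ext_degree K L. f (a i * b i))"
      unfolding a(2) using a(1) b(2) KL by (intro sum_triangle mult_mem) auto
    also have "\<dots> \<le> (\<Sum>i<ext_degree K L. 1 * f (b i))"
    proof (rule sum_mono)
      fix i assume i: "i \<in> {..<ext_degree K L}"
      have "f (a i * b i) = f (a i) * f (b i)" using bspec[OF a(1) i] b(2) KL i by (intro mult) auto
      also have "\<dots> \<le> 1 * f (b i)" using triv[OF bspec[OF a(1) i]] b(2) i nonneg by (intro mult_right_mono) auto
      finally show "f (a i * b i) \<le> 1 * f (b i)" .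
    qed
    finally show ?thesis by (simp add: C_def)
  qed
  have le1: "f x \<le> 1" if x: "x \<in> L" for x
  proof (rule power_bound_linear_factor_imp_le)
    show "f x ^ n \<le> (0 * real n + C) * 1 ^ n" for n
      using bd[of "x ^ n"] power[OF x] power_mem[OF x] by simp
  qed (use nonneg x in auto)
  obtain x where x: "x \<in> L" "x \<noteq> 0" "f x \<noteq> 1" using assms(3) by blast
  have "inverse (f x) \<le> 1" using le1[OF inverse_mem[OF x(1)]] inverse[OF x(1)] by simp
  hence "f x \<ge> 1" using pos[OF x(1,2)] by (simp add: inverse_le_1_iff)
  with le1[OF x(1)] x(3) show False by simp
qed

section \<open>Ostrowski's theorem\<close>

lemma padic_abs_divide:
  assumes p: "prime p" and "m \<noteq> 0" "n \<noteq> 0"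
  shows "padic_abs p (of_int m / of_int n) =
    real p powi (int (multiplicity (int p) n) - int (multiplicity (int p) m))"
proof -
  obtain a b where ab: "quotient_of (of_int m / of_int n) = (a, b)" by fastforce
  have b: "b > 0" using quotient_of_denom_pos[OF ab] .
  have eq: "of_int m / of_int n = (of_int a / of_int b :: rat)" using quotient_of_div[OF ab] .
  hence "of_int m * of_int b = (of_int a * of_int n :: rat)"
    using assms b by (simp add: field_simps)
  hence mb: "m * b = a * n" by (metis of_int_eq_iff of_int_mult)
  have a: "a \<noteq> 0" using mb assms b by auto
  have pe: "prime_elem (int p)" using p by auto
  have "multiplicity (int p) m + multiplicity (int p) b = multiplicity (int p) a + multiplicity (int p) n"
    using prime_elem_multiplicity_mult_distrib[OF pe, of m b]
      prime_elem_multiplicity_mult_distrib[OF pe, of a n] mb assms a b by simp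
  hence e: "int (multiplicity (int p) b) - int (multiplicity (int p) a)
      = int (multiplicity (int p) n) - int (multiplicity (int p) m)" by linarith
  have "(of_int m / of_int n :: rat) \<noteq> 0" using assms by simp
  thus ?thesis unfolding padic_abs_def ab using e by simp
qed

lemma padic_abs_of_nat_le_1:
  assumes "prime p"
  shows "padic_abs p (of_nat n) \<le> 1"
proof (cases "n = 0")
  case False
  have "padic_abs p (of_nat n) = real p powi (- int (multiplicity (int p) (int n)))"
    using padic_abs_divide[OF assms, of "int n" 1] False by simp
  also have "\<dots> = inverse (real p ^ multiplicity (int p) (int n))"
    by (simp add: power_int_minus)
  also have "\<dots> \<le> 1" using prime_gt_0_nat[OF assms]
    by (intro inverse_le_1_iff[THEN iffD2] disjI2 one_le_power) auto
  finally show ?thesis .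
qed (simp add: padic_abs_def)

lemma padic_abs_self:
  assumes "prime p"
  shows "padic_abs p (of_nat p) = 1 / real p"
proof -
  have "int p \<noteq> 0" using assms by auto
  moreover have "\<not> is_unit (int p)" using assms by auto
  ultimately have "multiplicity (int p) (int p) = 1" by (simp add: multiplicity_self)
  thus ?thesis using padic_abs_divide[OF assms, of "int p" 1] \<open>int p \<noteq> 0\<close>
    by (simp add: power_int_minus divide_inverse)
qed

lemma padic_abs_coprime:
  assumes "prime p" "\<not> p dvd n"
  shows "padic_abs p (of_nat n) = 1"
proof -
  have "n \<noteq> 0" using assms(2) by (rule contrapos_nn) simp
  moreover have "multiplicity (int p) (int n) = 0"
    using assms by (intro not_dvd_imp_multiplicity_0) auto
  ultimately show ?thesis using padic_abs_divide[OF assms(1), of "int n" 1] by simp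
qed

lemma usual_abs_of_nat_le:
  assumes "h \<in> usual_abs_rat"
  shows "h (of_nat n) \<le> real n"
proof (cases "n = 0")
  case False
  have "padic_abs p (of_nat n) \<le> real n" if "prime p" for p
    using padic_abs_of_nat_le_1[OF that, of n] False by linarith
  thus ?thesis using assms by (auto simp: usual_abs_rat_def)
next
  case True
  thus ?thesis using assms by (auto simp: usual_abs_rat_def padic_abs_def)
qed

lemma usual_abs_nonneg: "h \<in> usual_abs_rat \<Longrightarrow> 0 \<le> h r"
  by (auto simp: usual_abs_rat_def padic_abs_def intro: zero_le_power_int)

text \<open>
  The usual absolute value is large at 2, the \<open>p\<close>-adic one is small exactly at the multiples
  of \<open>p\<close>; the value there then fixes the exponent.
\<close>

lemma usual_abs_powr_eq:
  assumes h: "h \<in> usual_abs_rat" "h' \<in> usual_abs_rat" and s: "s > 0" and eq: "\<And>r. h' r = h r powr s"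
  shows "s = 1"
proof (cases "h = (\<lambda>r. real_of_rat \<bar>r\<bar>)")
  case True
  have 2: "h' 2 = 2 powr s" using eq[of 2] True by simp
  have "(2::real) powr s > 1" using s by simp
  hence gt: "h' 2 > 1" by (simp only: 2)
  have "h' = (\<lambda>r. real_of_rat \<bar>r\<bar>)"
  proof (rule ccontr)
    assume "h' \<noteq> (\<lambda>r. real_of_rat \<bar>r\<bar>)"
    then obtain p where "prime p" "h' = padic_abs p" using h(2) by (auto simp: usual_abs_rat_def)
    with padic_abs_of_nat_le_1[of p 2] gt show False by simp
  qed
  hence "h' 2 = 2" by simp
  hence "(2::real) powr 1 = 2 powr s" using 2 by (metis powr_one zero_le_numeral)
  thus ?thesis by (subst (asm) powr_inj) auto
next
  case False
  then obtain p where p: "prime p" "h = padic_abs p" using h by (auto simp: usual_abs_rat_def)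
  have p1: "real p > 1" using prime_gt_1_nat[OF p(1)] by simp
  have hp: "h' (of_nat p) = (1 / real p) powr s" using eq[of "of_nat p"] padic_abs_self[OF p(1)] p(2) by simp
  also have "\<dots> < 1 powr s" using p1 s by (intro powr_less_mono2) auto
  finally have lt: "h' (of_nat p) < 1" by simp
  have "h' \<noteq> (\<lambda>r. real_of_rat \<bar>r\<bar>)" using lt p1 by (auto simp: abs_of_nat)
  then obtain q where q: "prime q" "h' = padic_abs q" using h by (auto simp: usual_abs_rat_def)
  have "q dvd p" using padic_abs_coprime[OF q(1), of p] lt q(2) by auto
  hence "q = p" using p(1) q(1) by (simp add: primes_dvd_imp_eq)
  hence "1 / real p = (1 / real p) powr s"
    using hp q(2) padic_abs_self[OF q(1)] by (simp only:)
  moreover have "(1 / real p) powr 1 = 1 / real p" using p1 by simp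
  ultimately have "(1 / real p) powr 1 = (1 / real p) powr s" by (rule trans[rotated])
  thus ?thesis using p1 by (subst (asm) powr_inj) auto
qed

context abs_value
begin

lemma of_nat_mult_eq: "f (of_nat (m * n)) = f (of_nat m) * f (of_nat n)"
  using mult[of "of_nat m" "of_nat n"] by simp

lemma of_nat_power_eq: "f (of_nat (m ^ n)) = f (of_nat m) ^ n"
  using power[of "of_nat m" n] by simp

text \<open>A number below \<open>b\<^sup>k\<close> has at most \<open>k\<close> digits in base \<open>b\<close>, and each digit has value at most \<open>b\<close>.\<close>

lemma of_nat_digits_bound:
  assumes "b \<ge> 2" "m < b ^ k"
  shows "f (of_nat m) \<le> real k * real b * max 1 (f (of_nat b)) ^ k"
  using assms(2)
proof (induction k arbitrary: m)
  case (Suc k)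
  let ?M = "max 1 (f (of_nat b))"
  have M: "?M \<ge> 1" by simp
  have IH: "f (of_nat (m div b)) \<le> real k * real b * ?M ^ k"
    using Suc.prems assms(1) by (intro Suc.IH) (simp add: less_mult_imp_div_less mult.commute)
  have "f (of_nat m) = f (of_nat b * of_nat (m div b) + of_nat (m mod b))"
    by (metis mult_div_mod_eq of_nat_add of_nat_mult)
  also have "\<dots> \<le> f (of_nat b * of_nat (m div b)) + f (of_nat (m mod b))"
    by (intro triangle mult_mem) auto
  also have "f (of_nat b * of_nat (m div b)) = f (of_nat b) * f (of_nat (m div b))"
    by (simp add: mult)
  also have "\<dots> \<le> ?M * (real k * real b * ?M ^ k)"
    using IH nonneg by (intro mult_mono) auto
  also have "f (of_nat (m mod b)) \<le> real b * 1"
    using of_nat_le[of "m mod b"] mod_less_divisor[of b m] assms(1)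
    by (metis (no_types, lifting) less_le_trans linorder_not_less mult.right_neutral
        nat_le_linear nle_le of_nat_le_iff order_trans pos2)
  also have "real b * 1 \<le> real b * ?M ^ Suc k" using one_le_power[OF M, of "Suc k"]
    by (intro mult_left_mono) (simp_all del: power_Suc)
  finally show ?case by (simp add: algebra_simps)
qed simp

text \<open>
  The number of digits of \<open>a\<^sup>n\<close> in base \<open>b\<close> is about \<open>n log\<^sub>b a\<close>, so the digit bound for \<open>a\<^sup>n\<close> is a
  linear factor times the \<open>n\<close>-th power of the right-hand side.
\<close>

lemma of_nat_log_bound:
  assumes a: "a \<ge> 2" and b: "b \<ge> 2"
  shows "f (of_nat a) \<le> max 1 (f (of_nat b)) powr log b a"
proof -
  let ?M = "max 1 (f (of_nat b))" and ?l = "log (real b) (real a)"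
  have M: "?M \<ge> 1" by simp
  have l: "?l > 0" using a b by simp
  show ?thesis
  proof (rule power_bound_linear_factor_imp_le)
    show "f (of_nat a) ^ n \<le> (?l * b * ?M * real n + b * ?M) * (?M powr ?l) ^ n" for n
    proof -
      \<comment> \<open>enough digits for \<open>a\<^sup>n\<close>\<close>
      define k where "k = nat \<lfloor>real n * ?l\<rfloor> + 1"
      have nl: "0 \<le> real n * ?l" using l by simp
      have k: "real k \<le> real n * ?l + 1" "real n * ?l < real k"
        unfolding k_def using nl by linarith+
      have "real (a ^ n) = real b powr (?l * real n)"
        using a b by (simp add: powr_realpow flip: powr_powr)
      also have "\<dots> < real b powr real k" using k b by (intro powr_less_mono) (auto simp: mult.commute)
      also have "\<dots> = real (b ^ k)" using b by (simp add: powr_realpow)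
      finally have "a ^ n < b ^ k" by linarith
      from of_nat_digits_bound[OF b this]
      have "f (of_nat a) ^ n \<le> real k * real b * ?M ^ k" by (simp only: of_nat_power_eq)
      also have "\<dots> \<le> (real n * ?l + 1) * real b * (?M * (?M powr ?l) ^ n)"
      proof (intro mult_mono mult_right_mono k)
        have "?M ^ k = ?M powr real k" using M by (simp add: powr_realpow)
        also have "\<dots> \<le> ?M powr (real n * ?l + 1)" using k M by (intro powr_mono) auto
        also have "\<dots> = ?M * (?M powr ?l) ^ n" using M
          by (simp add: powr_add powr_powr mult.commute flip: powr_realpow)
        finally show "?M ^ k \<le> ?M * (?M powr ?l) ^ n" .
      qed (use nl M in auto)
      finally show ?thesis by (simp add: algebra_simps)
    qed
  qed (use nonneg in auto)
qed

lemma of_rat_eq_usual_powr: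
  assumes h: "h \<in> usual_abs_rat" and hn: "\<And>n. n > 0 \<Longrightarrow> f (of_nat n) = h (of_nat n) powr t"
    and t: "t > 0"
  shows "f (of_rat r) = h r powr t"
proof (cases "r = 0")
  case True
  thus ?thesis using h by (auto simp: usual_abs_rat_def padic_abs_def)
next
  case False
  obtain a b where ab: "quotient_of r = (a, b)" by fastforce
  have b: "b > 0" using quotient_of_denom_pos[OF ab] .
  have r: "r = of_int a / of_int b" using quotient_of_div[OF ab] .
  have a: "a \<noteq> 0" using r False by auto
  have hr: "h r = h (of_nat (nat \<bar>a\<bar>)) / h (of_nat (nat \<bar>b\<bar>))"
  proof (cases "h = (\<lambda>r. real_of_rat \<bar>r\<bar>)")
    case True
    show ?thesis unfolding True r by (simp add: abs_divide of_rat_divide)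
  next
    case False
    then obtain p where p: "prime p" "h = padic_abs p" using h by (auto simp: usual_abs_rat_def)
    have abs: "multiplicity (int p) \<bar>x\<bar> = multiplicity (int p) x" for x :: int
      by (simp add: abs_if)
    have x: "padic_abs p (of_int \<bar>x\<bar>) = real p powi (- int (multiplicity (int p) x))" if "x \<noteq> 0" for x :: int
      using padic_abs_divide[OF p(1), of "\<bar>x\<bar>" 1] that abs by simp
    have p0: "real p \<noteq> 0" using prime_gt_0_nat[OF p(1)] by simp
    have "padic_abs p r = real p powi (int (multiplicity (int p) b) - int (multiplicity (int p) a))"
      unfolding r by (rule padic_abs_divide[OF p(1)]) (use a b in auto)
    also have "\<dots> = padic_abs p (of_int \<bar>a\<bar>) / padic_abs p (of_int \<bar>b\<bar>)"
      using b p0 unfolding x[OF a] x[OF less_imp_neq[OF b, symmetric]]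
      by (simp add: power_int_diff power_int_minus field_simps)
    finally show ?thesis unfolding p(2) by simp
  qed
  have "f (of_rat r) = h (of_nat (nat \<bar>a\<bar>)) powr t / h (of_nat (nat \<bar>b\<bar>)) powr t"
    unfolding of_rat_fract[OF ab] using hn[of "nat \<bar>a\<bar>"] hn[of "nat \<bar>b\<bar>"] a b by simp
  also have "\<dots> = h r powr t" unfolding hr using usual_abs_nonneg[OF h] by (simp add: powr_divide)
  finally show ?thesis .
qed

text \<open>
  Exchanging \<open>a\<close> and \<open>b\<close> in the logarithmic bound shows that \<open>ln (f n) / ln n\<close> is constant.
\<close>

lemma ostrowski_archimedean:
  assumes "f (of_nat n0) > 1"
  shows "\<exists>t>0. \<forall>r. f (of_rat r) = real_of_rat \<bar>r\<bar> powr t"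
proof -
  have "n0 \<noteq> 0" "n0 \<noteq> 1" using assms by (auto intro: ccontr)
  hence n0: "n0 \<ge> 2" by simp
  have gt1: "f (of_nat b) > 1" if b: "b \<ge> 2" for b
  proof (rule ccontr)
    assume "\<not> f (of_nat b) > 1"
    hence "max 1 (f (of_nat b)) = 1" by simp
    with of_nat_log_bound[OF n0 b] assms show False by simp
  qed
  have le: "ln (f (of_nat a)) / ln a \<le> ln (f (of_nat b)) / ln b" if a: "a \<ge> 2" and b: "b \<ge> 2" for a b
  proof -
    have "f (of_nat a) \<le> f (of_nat b) powr log b a"
      using of_nat_log_bound[OF a b] gt1[OF b] by (simp add: max_def)
    hence "ln (f (of_nat a)) \<le> ln (f (of_nat b) powr log b a)"
      using gt1[OF a] gt1[OF b] by (intro ln_mono) auto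
    also have "\<dots> = log b a * ln (f (of_nat b))" using gt1[OF b] by (simp add: ln_powr)
    finally show ?thesis using a b by (simp add: log_def field_simps)
  qed
  define t where "t = ln (f (of_nat 2)) / ln 2"
  have t: "t > 0" unfolding t_def using gt1[of 2] by simp
  have "f (of_nat n) = real_of_rat \<bar>of_nat n\<bar> powr t" if "n > 0" for n
  proof (cases "n = 1")
    case False
    with that have n: "n \<ge> 2" by simp
    have "ln (f (of_nat n)) / ln n = t" unfolding t_def using le[OF n, of 2] le[of 2 n] n by simp
    hence "ln (f (of_nat n)) = t * ln n" using n by (simp add: field_simps)
    hence "f (of_nat n) = exp (t * ln n)" using gt1[OF n] by (metis exp_ln less_trans zero_less_one)
    also have "\<dots> = real n powr t" using n by (simp add: powr_def)
    finally show ?thesis by (simp add: abs_of_nat)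
  qed simp
  moreover have "(\<lambda>r. real_of_rat \<bar>r\<bar>) \<in> usual_abs_rat" by (simp add: usual_abs_rat_def)
  ultimately show ?thesis using of_rat_eq_usual_powr t by blast
qed

text \<open>
  When the integers are bounded, the smallest positive one of value below 1 is a prime
  \<open>p\<close>; any \<open>n\<close> prime to \<open>p\<close> has value 1, because its remainder modulo \<open>p\<close> has.
\<close>

lemma ostrowski_ultrametric:
  assumes le1: "\<And>n. f (of_nat n) \<le> 1" and n1: "n1 > 0" "f (of_nat n1) < 1"
  shows "\<exists>p t. prime p \<and> t > 0 \<and> (\<forall>r. f (of_rat r) = padic_abs p r powr t)"
proof -
  define p where "p = (LEAST n. n > 0 \<and> f (of_nat n) < 1)"
  have p: "p > 0" "f (of_nat p) < 1"
    using LeastI[of "\<lambda>n. n > 0 \<and> f (of_nat n) < 1" n1] n1 by (auto simp: p_def)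
  have least: "f (of_nat n) = 1" if "0 < n" "n < p" for n
    using not_less_Least[of n "\<lambda>n. n > 0 \<and> f (of_nat n) < 1"] that le1[of n] by (auto simp: p_def)
  have p2: "p > 1" using p by (cases "p = 1") auto
  have prime: "prime p"
    unfolding prime_nat_iff
  proof (intro conjI allI impI)
    fix m assume m: "m dvd p"
    then obtain k where k: "p = m * k" by auto
    show "m = 1 \<or> m = p"
    proof (rule ccontr)
      assume nt: "\<not> (m = 1 \<or> m = p)"
      have m0: "m > 0" "k > 0" using k p by (auto intro: Nat.gr0I)
      have "m < p" using m nt p(1) by (auto dest: dvd_imp_le)
      moreover have "k < p"
        using nt k m0 by (metis dvd_imp_le dvd_triv_right less_le mult_cancel2 nat_mult_1 p(1) less_not_refl)
      ultimately have "f (of_nat p) = 1" using least m0 unfolding k of_nat_mult_eq by simp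
      with p show False by simp
    qed
  qed (fact p2)
  have cop: "f (of_nat n) = 1" if n: "\<not> p dvd n" for n
  proof (rule antisym[OF le1])
    have "0 < n mod p" using n by (simp add: dvd_eq_mod_eq_0)
    hence r: "f (of_nat (n mod p)) = 1" using p(1) by (intro least) auto
    have "f (of_nat (n mod p)) = f (of_nat n + - (of_nat p * of_nat (n div p)))"
      by (metis add_diff_cancel_left' diff_conv_add_uminus mult_div_mod_eq of_nat_add of_nat_mult)
    also have "\<dots> \<le> max (f (of_nat n)) (f (- (of_nat p * of_nat (n div p))))"
      by (intro ultrametric le1 uminus_mem mult_mem) auto
    finally have "1 \<le> max (f (of_nat n)) (f (- (of_nat p * of_nat (n div p))))" using r by simp
    moreover have "f (- (of_nat p * of_nat (n div p))) = f (of_nat p) * f (of_nat (n div p))"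
      by (simp add: uminus mult mult_mem)
    moreover have "f (of_nat p) * f (of_nat (n div p)) \<le> f (of_nat p) * 1"
      using nonneg le1 by (intro mult_left_mono) auto
    ultimately show "1 \<le> f (of_nat n)" using p by linarith
  qed
  have fp: "f (of_nat p) > 0" using p(1) by (intro pos) auto
  define t where "t = - ln (f (of_nat p)) / ln p"
  have t: "t > 0" unfolding t_def using fp p p2 by (simp add: divide_neg_pos)
  have "f (of_nat p) = exp (- t * ln p)" unfolding t_def using fp p2 by simp
  hence fpt: "f (of_nat p) = (1 / real p) powr t" using p2 by (simp add: powr_def ln_div)
  have "f (of_nat n) = padic_abs p (of_nat n) powr t" if n: "n > 0" for n
  proof -
    obtain m where m: "n = p ^ multiplicity p n * m" "\<not> p dvd m"
      using multiplicity_decompose'[of n p] n p2 by auto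
    define e where "e = multiplicity p n"
    have ndvd: "\<not> p ^ Suc e dvd n"
      using power_dvd_iff_le_multiplicity[of n p "Suc e"] n p2 by (simp add: e_def)
    have "multiplicity (int p) (int n) = e"
    proof (rule multiplicity_eqI)
      show "int p ^ e dvd int n" unfolding of_nat_power[symmetric] of_nat_dvd_iff
        by (simp add: e_def multiplicity_dvd)
      show "\<not> int p ^ Suc e dvd int n" unfolding of_nat_power[symmetric] of_nat_dvd_iff
        by (rule ndvd)
    qed
    hence "padic_abs p (of_nat n) = real p powi (- int e)"
      using padic_abs_divide[OF prime, of "int n" 1] n by simp
    also have "\<dots> = (1 / real p) ^ e" by (simp add: power_int_minus divide_inverse power_inverse)
    finally have "padic_abs p (of_nat n) powr t = ((1 / real p) powr t) ^ e"
      by (simp only: power_powr_eq[of "1 / real p"]) (simp add: power_powr_eq)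
    moreover have "f (of_nat n) = f (of_nat p) ^ e"
      unfolding m(1)[folded e_def] of_nat_mult_eq of_nat_power_eq using cop[OF m(2)] by simp
    ultimately show ?thesis using fpt by simp
  qed
  moreover have "padic_abs p \<in> usual_abs_rat" using prime by (simp add: usual_abs_rat_def)
  ultimately show ?thesis using of_rat_eq_usual_powr t prime by blast
qed

theorem ostrowski:
  assumes "\<exists>x\<in>\<rat>. x \<noteq> 0 \<and> f x \<noteq> 1"
  shows "\<exists>h\<in>usual_abs_rat. \<exists>t>0. \<forall>r. f (of_rat r) = h r powr t"
proof (cases "\<exists>n. f (of_nat n) > 1")
  case True
  thus ?thesis using ostrowski_archimedean by (fastforce simp: usual_abs_rat_def)
next
  case False
  hence le1: "f (of_nat n) \<le> 1" for n by (simp add: not_less)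
  obtain r where r: "r \<noteq> 0" "f (of_rat r) \<noteq> 1" using assms by (auto elim!: Rats_cases)
  obtain a b where ab: "quotient_of r = (a, b)" by fastforce
  have "b > 0" using quotient_of_denom_pos[OF ab] .
  moreover have "a \<noteq> 0" using r quotient_of_div[OF ab] by auto
  ultimately have "nat \<bar>a\<bar> > 0" "nat \<bar>b\<bar> > 0" by auto
  moreover have "f (of_nat (nat \<bar>a\<bar>)) \<noteq> 1 \<or> f (of_nat (nat \<bar>b\<bar>)) \<noteq> 1"
    using r(2) unfolding of_rat_fract[OF ab] by auto
  ultimately obtain n where "n > 0" "f (of_nat n) < 1"
    using le1 by (metis less_le)
  from ostrowski_ultrametric[OF le1 this] show ?thesis by (auto simp: usual_abs_rat_def)
qed

end

section \<open>Places as normalized absolute values\<close>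

text \<open>
  Each place contains exactly one of these absolute values, which makes equality of functions
  available in place of equivalence of absolute values.
\<close>

definition normalized_norms :: "Qbar set \<Rightarrow> (Qbar \<Rightarrow> real) set"
  where "normalized_norms L = {f \<in> nontrivial_absolute_values L. (\<lambda>r. f (of_rat r)) \<in> usual_abs_rat}"

lemma nontrivial_absolute_values_iff:
  assumes "Qbar_subfield L"
  shows "f \<in> nontrivial_absolute_values L \<longleftrightarrow>
    f \<in> extensional L \<and> abs_value L f \<and> (\<exists>x\<in>L. x \<noteq> 0 \<and> f x \<noteq> 1)"
  using assms unfolding nontrivial_absolute_values_def abs_value_def abs_value_axioms_def by auto

lemma usual_abs_nontrivial:
  assumes "h \<in> usual_abs_rat"
  shows "\<exists>n>0. h (of_nat n) \<noteq> 1"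
proof (cases "h = (\<lambda>r. real_of_rat \<bar>r\<bar>)")
  case True
  thus ?thesis by (intro exI[of _ 2]) auto
next
  case False
  then obtain p where p: "prime p" "h = padic_abs p" using assms by (auto simp: usual_abs_rat_def)
  thus ?thesis using padic_abs_self[OF p(1)] prime_gt_1_nat[OF p(1)] by (intro exI[of _ p]) auto
qed

lemma normalized_norms_iff:
  assumes "Qbar_subfield L"
  shows "f \<in> normalized_norms L \<longleftrightarrow>
    f \<in> extensional L \<and> abs_value L f \<and> (\<lambda>r. f (of_rat r)) \<in> usual_abs_rat"
proof -
  interpret Qbar_subfield L by fact
  have "\<exists>x\<in>L. x \<noteq> 0 \<and> f x \<noteq> 1" if us: "(\<lambda>r. f (of_rat r)) \<in> usual_abs_rat"
  proof -
    obtain n where "n > 0" "f (of_nat n) \<noteq> 1" using usual_abs_nontrivial[OF us] by auto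
    thus ?thesis by (intro bexI[of _ "of_nat n"]) auto
  qed
  thus ?thesis unfolding normalized_norms_def using nontrivial_absolute_values_iff[OF assms] by auto
qed

lemma nontrivial_absolute_values_nonneg:
  "f \<in> nontrivial_absolute_values K \<Longrightarrow> x \<in> K \<Longrightarrow> 0 \<le> f x"
  by (simp add: nontrivial_absolute_values_def)

lemma absolute_value_equiv_equiv:
  "equiv (nontrivial_absolute_values K) (absolute_value_equiv K)"
proof (rule equivI)
  show "absolute_value_equiv K \<subseteq> nontrivial_absolute_values K \<times> nontrivial_absolute_values K"
    by (auto simp: absolute_value_equiv_def)
  show "refl_on (nontrivial_absolute_values K) (absolute_value_equiv K)"
    by (rule refl_onI)
      (auto simp: absolute_value_equiv_def nontrivial_absolute_values_nonneg intro!: exI[of _ 1])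
  show "sym (absolute_value_equiv K)"
  proof (rule symI)
    fix f g assume "(f, g) \<in> absolute_value_equiv K"
    then obtain s where s: "f \<in> nontrivial_absolute_values K" "g \<in> nontrivial_absolute_values K"
      "s > 0" "\<forall>x\<in>K. g x = f x powr s" by (auto simp: absolute_value_equiv_def)
    hence "\<forall>x\<in>K. f x = g x powr (1 / s)"
      by (auto simp: powr_powr nontrivial_absolute_values_nonneg)
    with s show "(g, f) \<in> absolute_value_equiv K"
      unfolding absolute_value_equiv_def by (auto intro!: exI[of _ "1 / s"])
  qed
  show "trans (absolute_value_equiv K)"
  proof (rule transI)
    fix f g h assume "(f, g) \<in> absolute_value_equiv K" "(g, h) \<in> absolute_value_equiv K"
    then obtain s t where s: "f \<in> nontrivial_absolute_values K" "h \<in> nontrivial_absolute_values K"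
      "s > 0" "t > 0" "\<forall>x\<in>K. g x = f x powr s" "\<forall>x\<in>K. h x = g x powr t"
      by (auto simp: absolute_value_equiv_def)
    hence "\<forall>x\<in>K. h x = f x powr (s * t)" by (auto simp: powr_powr)
    with s show "(f, h) \<in> absolute_value_equiv K"
      unfolding absolute_value_equiv_def by (auto intro!: exI[of _ "s * t"])
  qed
qed

text \<open>
  By Ostrowski's theorem the restriction to \<open>\<rat>\<close> is the \<open>t\<close>-th power of a usual absolute value, and the
  \<open>1/t\<close>-th power still satisfies the triangle inequality.
\<close>

lemma normalized_norm_exists:
  assumes L: "number_field L" and f: "f \<in> nontrivial_absolute_values L"
  shows "\<exists>g\<in>normalized_norms L. (f, g) \<in> absolute_value_equiv L"
proof -
  have sub: "Qbar_subfield L" using L by (rule number_field_subfield)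
  have f': "f \<in> extensional L" "abs_value L f" "\<exists>x\<in>L. x \<noteq> 0 \<and> f x \<noteq> 1"
    using f nontrivial_absolute_values_iff[OF sub] by auto
  interpret abs_value L f by (rule f')
  have "\<exists>x\<in>\<rat>. x \<noteq> 0 \<and> f x \<noteq> 1"
    by (rule nontrivial_on_subfield[OF f'(2) _ f'(3)]) (use L in \<open>simp add: number_field_def\<close>)
  from ostrowski[OF this] obtain h t where h: "h \<in> usual_abs_rat" "t > 0"
    "\<And>r. f (of_rat r) = h r powr t" by blast
  define g where "g = restrict (\<lambda>x. f x powr (1 / t)) L"
  have "f (of_nat n) \<le> real n powr t" for n
    using h(3)[of "of_nat n"] usual_abs_of_nat_le[OF h(1), of n] usual_abs_nonneg[OF h(1)] h(2)
    by (simp add: powr_mono2)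
  hence "abs_value L (\<lambda>x. f x powr (1 / t))" by (rule abs_value_root[OF h(2)])
  hence g: "abs_value L g" by (rule abs_value_cong) (simp add: g_def)
  have "(\<lambda>r. g (of_rat r)) = h"
    using h(2,3) usual_abs_nonneg[OF h(1)] by (auto simp: g_def powr_powr)
  hence gn: "g \<in> normalized_norms L"
    using h(1) g normalized_norms_iff[OF sub] by (auto simp: g_def)
  hence "g \<in> nontrivial_absolute_values L" by (simp add: normalized_norms_def)
  hence "(f, g) \<in> absolute_value_equiv L"
    using f h(2) unfolding absolute_value_equiv_def g_def by (auto intro!: exI[of _ "1 / t"])
  with gn show ?thesis by blast
qed

lemma normalized_norm_unique:
  assumes L: "Qbar_subfield L" and f: "f \<in> normalized_norms L" and g: "g \<in> normalized_norms L"
    and eq: "(f, g) \<in> absolute_value_equiv L"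
  shows "f = g"
proof -
  interpret Qbar_subfield L by (rule L)
  obtain s where s: "s > 0" "\<And>x. x \<in> L \<Longrightarrow> g x = f x powr s"
    using eq by (auto simp: absolute_value_equiv_def)
  have "s = 1"
  proof (rule usual_abs_powr_eq)
    show "(\<lambda>r. f (of_rat r)) \<in> usual_abs_rat" "(\<lambda>r. g (of_rat r)) \<in> usual_abs_rat"
      using f g by (simp_all add: normalized_norms_def)
    show "g (of_rat r) = f (of_rat r) powr s" for r using s(2) by simp
  qed (rule s(1))
  show ?thesis
  proof (rule extensionalityI)
    show "f \<in> extensional L" "g \<in> extensional L"
      using f g by (auto simp: normalized_norms_def nontrivial_absolute_values_def)
    show "f x = g x" if "x \<in> L" for x
      using s(2)[OF that] \<open>s = 1\<close> f that
      by (simp add: normalized_norms_def nontrivial_absolute_values_def)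
  qed
qed

lemma place_mem_nontrivial:
  "v \<in> places K \<Longrightarrow> f \<in> v \<Longrightarrow> f \<in> nontrivial_absolute_values K"
  unfolding places_def using in_quotient_imp_subset[OF absolute_value_equiv_equiv] by blast

lemma place_norm_in:
  assumes L: "number_field L" and v: "v \<in> places L"
  shows "place_norm v \<in> v" "place_norm v \<in> normalized_norms L"
proof -
  have sub: "Qbar_subfield L" using L by (rule number_field_subfield)
  obtain f where f: "f \<in> v" using v in_quotient_imp_non_empty[OF absolute_value_equiv_equiv]
    unfolding places_def by blast
  then obtain g where g: "g \<in> normalized_norms L" "(f, g) \<in> absolute_value_equiv L"
    using normalized_norm_exists[OF L] place_mem_nontrivial[OF v] by blast
  have gv: "g \<in> v" using in_quotient_imp_closed[OF absolute_value_equiv_equiv v[unfolded places_def] f g(2)] .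
  have ex1: "\<exists>!f. f \<in> v \<and> (\<lambda>r. f (of_rat r)) \<in> usual_abs_rat"
  proof (rule ex1I[of _ g])
    show "g \<in> v \<and> (\<lambda>r. g (of_rat r)) \<in> usual_abs_rat" using gv g(1) by (simp add: normalized_norms_def)
    fix k assume k: "k \<in> v \<and> (\<lambda>r. k (of_rat r)) \<in> usual_abs_rat"
    hence kn: "k \<in> normalized_norms L" using place_mem_nontrivial[OF v] by (simp add: normalized_norms_def)
    have "(k, g) \<in> absolute_value_equiv L"
      using in_quotient_imp_in_rel[OF absolute_value_equiv_equiv v[unfolded places_def], of k g] k gv by blast
    thus "k = g" using normalized_norm_unique[OF sub kn g(1)] by blast
  qed
  from theI'[OF this] have *: "place_norm v \<in> v \<and> (\<lambda>r. place_norm v (of_rat r)) \<in> usual_abs_rat"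
    unfolding place_norm_def .
  thus "place_norm v \<in> v" by blast
  show "place_norm v \<in> normalized_norms L" using * place_mem_nontrivial[OF v] by (auto simp: normalized_norms_def)
qed

lemma place_norm_unique:
  assumes L: "number_field L" and v: "v \<in> places L" and f: "f \<in> v" "f \<in> normalized_norms L"
  shows "place_norm v = f"
  using normalized_norm_unique[OF number_field_subfield[OF L]] place_norm_in[OF L v] f
    in_quotient_imp_in_rel[OF absolute_value_equiv_equiv v[unfolded places_def], of "place_norm v" f]
  by blast

definition place_of :: "Qbar set \<Rightarrow> (Qbar \<Rightarrow> real) \<Rightarrow> place"
  where "place_of L f = absolute_value_equiv L `` {f}"

lemma place_of_in:
  assumes "f \<in> normalized_norms L"
  shows "place_of L f \<in> places L" "f \<in> place_of L f"
proof -
  have f: "f \<in> nontrivial_absolute_values L" using assms by (simp add: normalized_norms_def)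
  show "place_of L f \<in> places L" unfolding places_def place_of_def using f by (rule quotientI)
  show "f \<in> place_of L f" unfolding place_of_def
    using equiv_class_self[OF absolute_value_equiv_equiv f] .
qed

lemma place_norm_place_of:
  assumes "number_field L" "f \<in> normalized_norms L"
  shows "place_norm (place_of L f) = f"
  using place_norm_unique[OF assms(1) place_of_in[OF assms(2)] assms(2)] .

lemma place_norm_inj:
  assumes L: "number_field L" and "v \<in> places L" "w \<in> places L" "place_norm v = place_norm w"
  shows "v = w"
  using quotient_disj[OF absolute_value_equiv_equiv, of v L w] assms
    place_norm_in(1)[OF L, of v] place_norm_in(1)[OF L, of w] unfolding places_def by auto

lemma normalized_norms_restrict:
  assumes "Qbar_subfield K" "Qbar_subfield L" "K \<subseteq> L" "f \<in> normalized_norms L"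
  shows "restrict f K \<in> normalized_norms K"
proof -
  interpret K: Qbar_subfield K by fact
  have f: "abs_value L f" "(\<lambda>r. f (of_rat r)) \<in> usual_abs_rat"
    using assms(4) normalized_norms_iff[OF assms(2)] by auto
  have "abs_value K (restrict f K)"
    by (rule abs_value_cong[OF abs_value.abs_value_subfield[OF f(1) assms(1,3)]]) simp
  thus ?thesis using f(2) normalized_norms_iff[OF assms(1)] by simp
qed

text \<open>
  Restriction to \<open>K\<close> respects equivalence, so that it suffices to compare the normalized members.
\<close>

lemma divides_place_iff:
  assumes K: "number_field K" and L: "number_field L" and KL: "K \<subseteq> L"
    and v: "v \<in> places K" and w: "w \<in> places L"
  shows "divides_place K w v \<longleftrightarrow> restrict (place_norm w) K = place_norm v"
proof
  have sub: "Qbar_subfield K" "Qbar_subfield L" using K L number_field_subfield by auto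
  have r: "restrict (place_norm w) K \<in> normalized_norms K"
    using normalized_norms_restrict[OF sub KL] place_norm_in(2)[OF L w] .
  show "restrict (place_norm w) K = place_norm v" if "divides_place K w v"
    using that place_norm_in(1)[OF L w] place_norm_unique[OF K v _ r]
    unfolding divides_place_def by auto
  show "divides_place K w v" if eq: "restrict (place_norm w) K = place_norm v"
    unfolding divides_place_def
  proof safe
    fix f assume f: "f \<in> w"
    have "(place_norm w, f) \<in> absolute_value_equiv L"
      using in_quotient_imp_in_rel[OF absolute_value_equiv_equiv w[unfolded places_def]]
        place_norm_in(1)[OF L w] f by blast
    then obtain s where s: "s > 0" "\<forall>x\<in>L. f x = place_norm w x powr s"
      by (auto simp: absolute_value_equiv_def)
    have fL: "abs_value L f" "\<exists>x\<in>L. x \<noteq> 0 \<and> f x \<noteq> 1"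
      using place_mem_nontrivial[OF w f] nontrivial_absolute_values_iff[OF sub(2)] by auto
    have "\<exists>x\<in>K. x \<noteq> 0 \<and> f x \<noteq> 1"
      using nontrivial_on_subfield[OF fL(1) number_field_finite_extension[OF K L KL] fL(2)] .
    moreover have "abs_value K (restrict f K)"
      by (rule abs_value_cong[OF abs_value.abs_value_subfield[OF fL(1) sub(1) KL]]) simp
    ultimately have "restrict f K \<in> nontrivial_absolute_values K"
      using nontrivial_absolute_values_iff[OF sub(1)] by auto
    moreover have "\<forall>x\<in>K. restrict f K x = place_norm v x powr s"
      using s(2) KL by (auto simp flip: eq)
    moreover have "place_norm v \<in> nontrivial_absolute_values K"
      using place_mem_nontrivial[OF v] place_norm_in(1)[OF K v] by blast
    ultimately have "(place_norm v, restrict f K) \<in> absolute_value_equiv K"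
      using s(1) unfolding absolute_value_equiv_def by blast
    thus "restrict f K \<in> v"
      using in_quotient_imp_closed[OF absolute_value_equiv_equiv v[unfolded places_def]]
        place_norm_in(1)[OF K v] by blast
  qed
qed

definition place_below :: "Qbar set \<Rightarrow> place \<Rightarrow> place"
  where "place_below K w = place_of K (restrict (place_norm w) K)"

lemma place_below:
  assumes K: "number_field K" and L: "number_field L" and KL: "K \<subseteq> L" and w: "w \<in> places L"
  shows "place_below K w \<in> places K"
    and "place_norm (place_below K w) = restrict (place_norm w) K"
    and "v \<in> places K \<Longrightarrow> divides_place K w v \<longleftrightarrow> v = place_below K w"
proof -
  have sub: "Qbar_subfield K" "Qbar_subfield L" using K L number_field_subfield by auto
  have r: "restrict (place_norm w) K \<in> normalized_norms K"
    using normalized_norms_restrict[OF sub KL] place_norm_in(2)[OF L w] .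
  show b: "place_below K w \<in> places K" unfolding place_below_def using place_of_in[OF r] by blast
  show n: "place_norm (place_below K w) = restrict (place_norm w) K"
    unfolding place_below_def by (rule place_norm_place_of[OF K r])
  show "divides_place K w v \<longleftrightarrow> v = place_below K w" if v: "v \<in> places K"
    using divides_place_iff[OF K L KL v w] place_norm_inj[OF K v b] n by auto
qed

section \<open>Weak approximation\<close>

context abs_value
begin

lemma powi_mem: "x \<in> L \<Longrightarrow> x powi k \<in> L"
  by (auto simp: power_int_def)

lemma powi: "x \<in> L \<Longrightarrow> f (x powi k) = f x powi k"
  by (auto simp: power_int_def power inverse power_mem inverse_mem)

text \<open>
  The quotients \<open>z\<^sup>n / (1 + z\<^sup>n)\<close> tend to 0 where \<open>z\<close> is small and to 1 where it is large.
\<close>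

lemma quotient_tendsto_0:
  assumes z: "z \<in> L" "f z < 1"
  shows "(\<lambda>n. f (z ^ n / (1 + z ^ n))) \<longlonglongrightarrow> 0"
proof (rule tendsto_sandwich[where f = "\<lambda>_. 0"])
  have lim: "(\<lambda>n. f z ^ n) \<longlonglongrightarrow> 0" using z nonneg by (intro LIMSEQ_power_zero) auto
  have "(\<lambda>n. f z ^ n / (1 - f z ^ n)) \<longlonglongrightarrow> 0 / (1 - 0)"
    by (intro tendsto_intros lim) auto
  thus "(\<lambda>n. f z ^ n / (1 - f z ^ n)) \<longlonglongrightarrow> 0" by simp
  show "\<forall>\<^sub>F n in sequentially. f (z ^ n / (1 + z ^ n)) \<le> f z ^ n / (1 - f z ^ n)"
    using order_tendstoD(2)[OF lim, of 1, simplified]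
  proof eventually_elim
    case (elim n)
    have "1 - f z ^ n \<le> f (1 + z ^ n)"
      using triangle_rev[of 1 "- (z ^ n)"] z by (simp add: uminus uminus_mem power power_mem)
    hence "f z ^ n / f (1 + z ^ n) \<le> f z ^ n / (1 - f z ^ n)"
      using elim nonneg z by (intro divide_left_mono) auto
    thus ?case using z by (simp add: divide power power_mem add_mem)
  qed
  show "\<forall>\<^sub>F n in sequentially. 0 \<le> f (z ^ n / (1 + z ^ n))"
    using z by (intro always_eventually allI nonneg divide_mem add_mem power_mem) auto
qed auto

lemma quotient_tendsto_1:
  assumes z: "z \<in> L" "f z > 1"
  shows "(\<lambda>n. f (z ^ n / (1 + z ^ n) - 1)) \<longlonglongrightarrow> 0"
proof (rule tendsto_sandwich[where f = "\<lambda>_. 0"])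
  define q where "q = inverse (f z)"
  have q: "0 < q" "q < 1" using z by (auto simp: q_def inverse_less_1_iff)
  have lim: "(\<lambda>n. q ^ n) \<longlonglongrightarrow> 0" using q by (intro LIMSEQ_power_zero) auto
  have "(\<lambda>n. q ^ n / (1 - q ^ n)) \<longlonglongrightarrow> 0 / (1 - 0)"
    by (intro tendsto_intros lim) auto
  thus "(\<lambda>n. q ^ n / (1 - q ^ n)) \<longlonglongrightarrow> 0" by simp
  show "\<forall>\<^sub>F n in sequentially. f (z ^ n / (1 + z ^ n) - 1) \<le> q ^ n / (1 - q ^ n)"
    using eventually_gt_at_top[of 0]
  proof eventually_elim
    case (elim n)
    have gt: "f z ^ n > 1" using z elim by (simp add: one_less_power)
    have ge: "f z ^ n - 1 \<le> f (1 + z ^ n)"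
      using triangle_rev[of "z ^ n" "-1"] z by (simp add: uminus uminus_mem power power_mem add.commute)
    hence "f (1 + z ^ n) \<noteq> 0" using gt by simp
    hence nz: "1 + z ^ n \<noteq> 0" using zero by metis
    have "z ^ n / (1 + z ^ n) - 1 = - inverse (1 + z ^ n)"
      using nz by (simp add: field_simps)
    hence "f (z ^ n / (1 + z ^ n) - 1) = inverse (f (1 + z ^ n))"
      using z by (simp add: uminus inverse inverse_mem add_mem power_mem)
    also have "\<dots> \<le> inverse (f z ^ n - 1)" using ge gt by (intro le_imp_inverse_le) auto
    also have "\<dots> = q ^ n / (1 - q ^ n)" using gt z by (simp add: q_def power_inverse field_simps)
    finally show ?case .
  qed
  show "\<forall>\<^sub>F n in sequentially. 0 \<le> f (z ^ n / (1 + z ^ n) - 1)"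
    using z by (intro always_eventually allI nonneg divide_mem add_mem diff_mem power_mem) auto
qed auto

end

locale norms_above = K: Qbar_subfield K + L: Qbar_subfield L for K L +
  fixes v :: "Qbar \<Rightarrow> real" and S :: "(Qbar \<Rightarrow> real) set"
  assumes KL: "K \<subseteq> L"
    and abs: "f \<in> S \<Longrightarrow> abs_value L f"
    and ext: "f \<in> S \<Longrightarrow> f \<in> extensional L"
    and above: "f \<in> S \<Longrightarrow> a \<in> K \<Longrightarrow> f a = v a"
    and nontrivial: "\<exists>a\<in>K. v a > 1"
begin

text \<open>
  Two different extensions of \<open>v\<close> differ at some \<open>x\<close>; a high power of \<open>x\<close> has values with
  a quotient so large that an element of \<open>K\<close> fits between them.
\<close>

lemma separate_norms:
  assumes f: "f \<in> S" and g: "g \<in> S" and "f \<noteq> g"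
  shows "\<exists>z\<in>L. f z > 1 \<and> g z < 1"
proof -
  interpret f: abs_value L f by (rule abs[OF f])
  interpret g: abs_value L g by (rule abs[OF g])
  obtain y where y: "y \<in> L" "f y \<noteq> g y"
    using extensionalityI[OF ext[OF f] ext[OF g]] \<open>f \<noteq> g\<close> by blast
  have y0: "y \<noteq> 0" using y by auto
  have "\<exists>x\<in>L. x \<noteq> 0 \<and> g x < f x"
  proof (cases "g y < f y")
    case False
    hence "inverse (g y) < inverse (f y)"
      using y y0 f.pos[of y] g.pos[of y] by (intro less_imp_inverse_less) auto
    thus ?thesis using y y0 by (intro bexI[of _ "inverse y"]) (auto simp: f.inverse g.inverse)
  qed (use y y0 in auto)
  then obtain x where x: "x \<in> L" "x \<noteq> 0" "g x < f x" by blast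
  obtain a where a: "a \<in> K" "v a > 1" using nontrivial by blast
  have aL: "a \<in> L" using a KL by auto
  have fa: "f a = v a" "g a = v a" using above[OF f a(1)] above[OF g a(1)] by auto
  define l where "l = ln (v a)"
  have l: "l > 0" using a by (simp add: l_def)
  have gx: "g x > 0" "f x > 0" using x f.pos g.pos by auto
  have "ln (g x) < ln (f x)" using gx x by simp
  then obtain n :: nat where n: "l < real n * (ln (f x) - ln (g x))"
    using reals_Archimedean3[of "ln (f x) - ln (g x)"] by auto
  \<comment> \<open>the power of \<open>a\<close> whose value lies between those of \<open>x\<^sup>n\<close> under \<open>g\<close> and under \<open>f\<close>\<close>
  define k where "k = \<lfloor>real n * ln (g x) / l\<rfloor> + 1"
  have "real n * ln (g x) / l < k" "k \<le> real n * ln (g x) / l + 1" unfolding k_def by linarith+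
  hence k: "real n * ln (g x) < k * l" "k * l \<le> real n * ln (g x) + l"
    using l by (simp_all add: field_simps)
  define z where "z = x ^ n * a powi (- k)"
  have zL: "z \<in> L" unfolding z_def using x aL f.powi_mem by auto
  have val: "h z = exp (real n * ln (h x) - k * l)" if "abs_value L h" "h a = v a" "h x > 0" for h
  proof -
    interpret h: abs_value L h by fact
    have "h z = h x ^ n * v a powi (- k)"
      unfolding z_def using x aL that h.powi_mem[OF aL] by (simp add: h.mult h.power h.powi L.power_mem)
    also have "h x ^ n = exp (real n * ln (h x))" using that by (simp add: exp_of_nat_mult)
    also have "v a powi (- k) = exp (- (k * l))"
      using a by (simp add: l_def powr_real_of_int' exp_minus power_int_minus powr_def flip: powr_real_of_int')
    finally show ?thesis by (simp add: exp_diff exp_minus field_simps)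
  qed
  have "f z > 1" using val[OF abs[OF f] fa(1)] gx n k by (simp add: algebra_simps)
  moreover have "g z < 1" using val[OF abs[OF g] fa(2)] gx k by simp
  ultimately show ?thesis using zL by blast
qed

text \<open>
  To also make \<open>g z\<close> small, \<open>z\<close> is combined with an element \<open>y\<close> separating \<open>f\<close> from \<open>g\<close>: if
  \<open>g z \<le> 1\<close>, a product \<open>z\<^sup>n y\<close> works; otherwise \<open>z\<^sup>n\<close> is replaced by \<open>z\<^sup>n / (1 + z\<^sup>n)\<close>, which is close
  to 1 at both \<open>f\<close> and \<open>g\<close> and still small at the other places.
\<close>

lemma separate_finite:
  assumes "finite T" "f \<in> S" "T \<subseteq> S" "f \<notin> T"
  shows "\<exists>z\<in>L. f z > 1 \<and> (\<forall>g\<in>T. g z < 1)"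
  using assms
proof (induction T rule: finite_induct)
  case empty
  thus ?case using nontrivial above KL by fastforce
next
  case (insert g T)
  interpret f: abs_value L f by (rule abs) (use insert in auto)
  interpret g: abs_value L g by (rule abs) (use insert in auto)
  obtain z where z: "z \<in> L" "f z > 1" "\<forall>h\<in>T. h z < 1" using insert by auto
  obtain y where y: "y \<in> L" "f y > 1" "g y < 1" using separate_norms[of f g] insert by auto
  have T: "\<forall>h\<in>T. abs_value L h" using abs insert.prems by auto
  show ?case
  proof (cases "g z \<le> 1")
    case True
    have "\<forall>\<^sub>F n in sequentially. h (z ^ n * y) < 1" if h: "h \<in> T" for h
    proof -
      interpret h: abs_value L h using T h by blast
      have "(\<lambda>n. h z ^ n * h y) \<longlonglongrightarrow> 0 * h y"
        using z h h.nonneg[OF z(1)] by (intro tendsto_intros LIMSEQ_power_zero) auto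
      hence "\<forall>\<^sub>F n in sequentially. h z ^ n * h y < 1" by (intro order_tendstoD) auto
      thus ?thesis using z y by (simp add: h.mult h.power L.power_mem)
    qed
    hence "\<forall>\<^sub>F n in sequentially. \<forall>h\<in>T. h (z ^ n * y) < 1"
      using insert.hyps by (intro eventually_ball_finite) auto
    then obtain n where n: "\<forall>h\<in>T. h (z ^ n * y) < 1" by (auto simp: eventually_sequentially)
    have "f z ^ n * f y > 1"
      using z y one_le_power[of "f z" n] by (intro less_le_trans[OF y(2)]) auto
    moreover have "g z ^ n * g y < 1"
      using True y g.nonneg[OF z(1)] g.nonneg[OF y(1)] power_le_one[of "g z" n]
      by (intro le_less_trans[OF _ y(3)] mult_left_le_one_le) auto
    ultimately show ?thesis using n z y
      by (intro bexI[of _ "z ^ n * y"]) (auto simp: f.mult f.power g.mult g.power L.power_mem)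
  next
    case False
    let ?u = "\<lambda>n. z ^ n / (1 + z ^ n)"
    have uL: "?u n \<in> L" for n using z by auto
    have lim: "(\<lambda>n. h (y * ?u n)) \<longlonglongrightarrow> h y" if h: "abs_value L h" "h z > 1" for h
    proof -
      interpret h: abs_value L h by fact
      have "(\<lambda>n. h y * h (?u n - 1)) \<longlonglongrightarrow> h y * 0"
        using z h by (intro tendsto_intros h.quotient_tendsto_1) auto
      hence l0: "(\<lambda>n. h y * h (?u n - 1)) \<longlonglongrightarrow> 0" by simp
      show ?thesis
      proof (rule Lim_transform2[OF tendsto_const])
        show "(\<lambda>n. h y - h (y * ?u n)) \<longlonglongrightarrow> 0"
        proof (rule tendsto_0_le[OF l0, of _ 1], intro always_eventually allI)
          fix n
          have yu: "y * ?u n \<in> L" using L.mult_mem[OF y(1) uL] .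
          have "y * ?u n - y = y * (?u n - 1)" by (simp add: algebra_simps)
          hence d: "h (y * ?u n - y) = h y * h (?u n - 1)" using h.mult y uL L.diff_mem by simp
          have "h y - h (y * ?u n) \<le> h (y * ?u n - y)"
            using h.triangle_rev[OF y(1) yu] h.diff_commute[OF y(1) yu] by simp
          moreover have "h (y * ?u n) - h y \<le> h (y * ?u n - y)"
            using h.triangle_rev[OF yu y(1)] .
          ultimately show "norm (h y - h (y * ?u n)) \<le> norm (h y * h (?u n - 1)) * 1"
            unfolding d real_norm_def by linarith
        qed
      qed
    qed
    have "\<forall>\<^sub>F n in sequentially. h (y * ?u n) < 1" if h: "h \<in> T" for h
    proof -
      interpret h: abs_value L h using T h by blast
      have "(\<lambda>n. h y * h (?u n)) \<longlonglongrightarrow> h y * 0"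
        using z h by (intro tendsto_intros h.quotient_tendsto_0) auto
      hence "\<forall>\<^sub>F n in sequentially. h y * h (?u n) < 1" by (intro order_tendstoD) auto
      thus ?thesis using h.mult[OF y(1) uL] by (simp del: times_divide_eq_right)
    qed
    hence "\<forall>\<^sub>F n in sequentially. \<forall>h\<in>T. h (y * ?u n) < 1"
      using insert.hyps by (intro eventually_ball_finite) auto
    moreover have "\<forall>\<^sub>F n in sequentially. f (y * ?u n) > 1"
      using order_tendstoD(1)[OF lim[OF f.abs_value_axioms z(2)] y(2)] .
    moreover have "\<forall>\<^sub>F n in sequentially. g (y * ?u n) < 1"
      using order_tendstoD(2)[OF lim[OF g.abs_value_axioms] y(3)] False by simp
    ultimately have "\<forall>\<^sub>F n in sequentially. (\<forall>h\<in>T. h (y * ?u n) < 1) \<and> f (y * ?u n) > 1 \<and> g (y * ?u n) < 1"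
      by eventually_elim auto
    then obtain n where "(\<forall>h\<in>T. h (y * ?u n) < 1) \<and> f (y * ?u n) > 1 \<and> g (y * ?u n) < 1"
      by (auto simp: eventually_sequentially)
    thus ?thesis using y(1) uL by (intro bexI[of _ "y * ?u n"]) (auto intro!: L.mult_mem[OF y(1) uL] simp del: times_divide_eq_right)
  qed
qed

text \<open>
  The target at \<open>f\<close> is multiplied by \<open>z\<^sup>n / (1 + z\<^sup>n)\<close> for an element \<open>z\<close> that is large at \<open>f\<close> and small
  elsewhere, and the products are added.
\<close>

theorem weak_approximation:
  assumes fin: "finite S" and t: "\<And>f. f \<in> S \<Longrightarrow> t f \<in> L" and e: "e > 0"
  shows "\<exists>z\<in>L. \<forall>f\<in>S. f (z - t f) < e"
proof -
  have "\<forall>f\<in>S. \<exists>z. z \<in> L \<and> f z > 1 \<and> (\<forall>g\<in>S - {f}. g z < 1)"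
    using separate_finite[of "S - {f}" f for f] fin by blast
  from bchoice[OF this] obtain z where z: "\<forall>f\<in>S. z f \<in> L \<and> f (z f) > 1 \<and> (\<forall>g\<in>S - {f}. g (z f) < 1)" by blast
  define u where "u f n = z f ^ n / (1 + z f ^ n)" for f n
  have uL: "u f n \<in> L" if "f \<in> S" for f n using z that unfolding u_def by auto
  define y where "y n = (\<Sum>g\<in>S. t g * u g n)" for n
  have yL: "y n \<in> L" for n unfolding y_def using t uL by (intro L.sum_mem L.mult_mem) auto
  have "\<forall>\<^sub>F n in sequentially. f (y n - t f) < e" if f: "f \<in> S" for f
  proof -
    interpret f: abs_value L f by (rule abs[OF f])
    define s where "s n = (\<Sum>g\<in>S. f (t g) * f (u g n - (if g = f then 1 else 0)))" for n
    have "(\<lambda>n. f (u g n - (if g = f then 1 else 0))) \<longlonglongrightarrow> 0" if g: "g \<in> S" for g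
      using f.quotient_tendsto_0[of "z g"] f.quotient_tendsto_1[of "z g"] z g f
      by (auto simp: u_def)
    hence "s \<longlonglongrightarrow> (\<Sum>g\<in>S. f (t g) * 0)"
      unfolding s_def by (intro tendsto_sum tendsto_mult tendsto_const) auto
    hence "\<forall>\<^sub>F n in sequentially. s n < e" using e by (intro order_tendstoD) auto
    moreover have "f (y n - t f) \<le> s n" for n
    proof -
      have "(\<Sum>g\<in>S. t g * (if g = f then 1 else 0)) = t f"
        using fin f by (simp add: if_distrib[of "\<lambda>c. _ * c"] cong: if_cong)
      hence "y n - t f = (\<Sum>g\<in>S. t g * (u g n - (if g = f then 1 else 0)))"
        unfolding y_def by (simp add: right_diff_distrib sum_subtractf del: mult_1_right)
      also have "f \<dots> \<le> (\<Sum>g\<in>S. f (t g * (u g n - (if g = f then 1 else 0))))"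
        using t uL by (intro f.sum_triangle L.mult_mem L.diff_mem) auto
      also have "\<dots> = s n" unfolding s_def
        using t uL by (intro sum.cong refl f.mult L.diff_mem) auto
      finally show ?thesis .
    qed
    ultimately show ?thesis by (auto elim!: eventually_mono intro: le_less_trans)
  qed
  hence "\<forall>\<^sub>F n in sequentially. \<forall>f\<in>S. f (y n - t f) < e"
    using fin by (intro eventually_ball_finite) auto
  then obtain n where "\<forall>f\<in>S. f (y n - t f) < e" by (auto simp: eventually_sequentially)
  thus ?thesis using yL by blast
qed

end

section \<open>Local bases\<close>

text \<open>
  For an absolute value \<open>g\<close> of \<open>L\<close>, a family in \<open>L\<close> is a basis of the completion of \<open>L\<close>
  over the completion of \<open>K\<close> iff the coefficients of its \<open>K\<close>-linear combinations are bounded by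
  the value of the combination and its \<open>K\<close>-span is dense.  These two conditions speak about
  elements of \<open>L\<close> only, so that local degrees can be studied without completions.
\<close>

definition strongly_indep :: "Qbar set \<Rightarrow> (Qbar \<Rightarrow> real) \<Rightarrow> 'i set \<Rightarrow> ('i \<Rightarrow> Qbar) \<Rightarrow> bool"
  where "strongly_indep K g I x \<longleftrightarrow>
    (\<exists>C>0. \<forall>a. (\<forall>i\<in>I. a i \<in> K) \<longrightarrow> (\<forall>i\<in>I. g (a i) \<le> C * g (\<Sum>i\<in>I. a i * x i)))"

definition local_basis :: "Qbar set \<Rightarrow> Qbar set \<Rightarrow> (Qbar \<Rightarrow> real) \<Rightarrow> 'i set \<Rightarrow> ('i \<Rightarrow> Qbar) \<Rightarrow> bool"
  where "local_basis K L g I x \<longleftrightarrow> finite I \<and> (\<forall>i\<in>I. x i \<in> L) \<and> strongly_indep K g I x \<and>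
    (\<forall>y\<in>L. \<forall>e>0. \<exists>z\<in>lin_span K I x. g (y - z) < e)"

lemma strongly_indepD:
  assumes "strongly_indep K g I x"
  obtains C where "C > 0"
    "\<And>a i. (\<And>i. i \<in> I \<Longrightarrow> a i \<in> K) \<Longrightarrow> i \<in> I \<Longrightarrow> g (a i) \<le> C * g (\<Sum>i\<in>I. a i * x i)"
  using assms unfolding strongly_indep_def by metis

locale abs_value_extension = abs_value L f for L f +
  fixes K :: "Qbar set"
  assumes K: "Qbar_subfield K" and KL: "K \<subseteq> L"
begin

sublocale K: Qbar_subfield K by (rule K)

lemma strongly_indep_imp_lin_indep:
  assumes "strongly_indep K f I x"
  shows "lin_indep K I x"
  unfolding lin_indep_def
proof (intro allI impI ballI, elim conjE)
  fix a i assume a: "\<forall>i\<in>I. a i \<in> K" "(\<Sum>i\<in>I. a i * x i) = 0" and i: "i \<in> I"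
  from assms obtain C where C: "\<forall>a. (\<forall>i\<in>I. a i \<in> K) \<longrightarrow> (\<forall>i\<in>I. f (a i) \<le> C * f (\<Sum>i\<in>I. a i * x i))"
    unfolding strongly_indep_def by blast
  have "f (a i) \<le> C * f 0" using C[rule_format, of a i] a i by simp
  hence "f (a i) = 0" using nonneg[of "a i"] a i KL by auto
  thus "a i = 0" using eq_0_iff[of "a i"] a i KL by auto
qed

text \<open>
  Adding an element \<open>y\<close> at positive distance \<open>\<delta>\<close> from the span: after scaling its coefficient
  \<open>c\<close> to 1 one sees that the value of a combination is at least \<open>\<delta>\<close> times the value of \<open>c\<close>,
  and then the rest of the combination is bounded as well.
\<close>

lemma strongly_indep_insert:
  assumes si: "strongly_indep K f B (\<lambda>b. b)" and B: "finite B" "B \<subseteq> L" and y: "y \<in> L" "y \<notin> B"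
    and d: "\<delta> > 0" "\<And>z. z \<in> lin_span K B (\<lambda>b. b) \<Longrightarrow> \<delta> \<le> f (y - z)"
  shows "strongly_indep K f (insert y B) (\<lambda>b. b)"
proof -
  obtain C where C: "C > 0"
    "\<And>a i. (\<And>i. i \<in> B \<Longrightarrow> a i \<in> K) \<Longrightarrow> i \<in> B \<Longrightarrow> f (a i) \<le> C * f (\<Sum>i\<in>B. a i * i)"
    by (rule strongly_indepD[OF si]) blast
  define D where "D = max (1 / \<delta>) (C * (1 + f y / \<delta>))"
  have D: "D > 0" using d by (simp add: D_def less_max_iff_disj)
  have "f (a i) \<le> D * f (\<Sum>b\<in>insert y B. a b * b)" if a: "\<forall>b\<in>insert y B. a b \<in> K" and i: "i \<in> insert y B" for a i
  proof -
    define s where "s = (\<Sum>b\<in>B. a b * b)"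
    have aL: "a b \<in> L" if "b \<in> insert y B" for b using a that KL by auto
    have sL: "s \<in> L" unfolding s_def using aL B(2) by (intro sum_mem mult_mem) auto
    define t where "t = a y * y + s"
    have tL: "t \<in> L" unfolding t_def using aL y sL by (intro add_mem mult_mem) auto
    have t: "(\<Sum>b\<in>insert y B. a b * b) = t" unfolding t_def s_def using B y by simp
    have ay: "\<delta> * f (a y) \<le> f t"
    proof (cases "a y = 0")
      case True
      thus ?thesis using nonneg[OF tL] by simp
    next
      case False
      have "(\<Sum>b\<in>B. (- (a b / a y)) * b) \<in> lin_span K B (\<lambda>b. b)"
        unfolding lin_span_def using a by (intro CollectI exI[of _ "\<lambda>b. - (a b / a y)"]) (auto intro!: K.uminus_mem K.divide_mem)
      also have "(\<Sum>b\<in>B. (- (a b / a y)) * b) = - (s / a y)"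
        by (simp add: s_def sum_divide_distrib sum_negf)
      finally have "\<delta> \<le> f (y - - (s / a y))" by (rule d)
      also have "y - - (s / a y) = t / a y" using False by (simp add: t_def add_divide_distrib)
      also have "f (t / a y) = f t / f (a y)" using tL aL by (intro divide) auto
      finally show ?thesis using pos[of "a y"] aL False by (simp add: field_simps)
    qed
    hence ay': "f (a y) \<le> f t / \<delta>" using d by (simp add: field_simps)
    show ?thesis
    proof (cases "i = y")
      case True
      have "f (a y) \<le> (1 / \<delta>) * f t" using ay' by simp
      also have "\<dots> \<le> D * f t" using nonneg[OF tL] by (intro mult_right_mono) (auto simp: D_def)
      finally show ?thesis unfolding t True .
    next
      case False
      hence iB: "i \<in> B" using i by simp
      have "s = t - a y * y" by (simp add: t_def)
      hence "f s \<le> f t + f (a y * y)" using diff_triangle[of t "a y * y"] tL aL y by auto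
      also have "\<dots> = f t + f (a y) * f y" using aL y by (simp add: mult)
      also have "\<dots> \<le> f t + f t / \<delta> * f y" using ay' nonneg[OF y(1)] by (intro add_left_mono mult_right_mono)
      also have "\<dots> = (1 + f y / \<delta>) * f t" by (simp add: algebra_simps)
      finally have fs: "f s \<le> (1 + f y / \<delta>) * f t" .
      have "f (a i) \<le> C * f s" unfolding s_def using C(2)[of a i] a iB by auto
      also have "\<dots> \<le> C * ((1 + f y / \<delta>) * f t)" using fs C(1) by simp
      also have "\<dots> \<le> D * f t" unfolding mult.assoc[symmetric] using nonneg[OF tL]
        by (intro mult_right_mono) (auto simp: D_def)
      finally show ?thesis unfolding t .
    qed
  qed
  thus ?thesis unfolding strongly_indep_def using D by blast
qed

text \<open>
  A strongly independent subset of maximal size has dense span, since an element at positive distance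
  from the span could be added; sizes are bounded by the degree.
\<close>

lemma local_basis_exists:
  assumes fe: "finite_extension K L"
  shows "\<exists>B. local_basis K L f B (\<lambda>b. b)"
proof -
  define P where "P n \<longleftrightarrow> (\<exists>B. finite B \<and> B \<subseteq> L \<and> card B = n \<and> strongly_indep K f B (\<lambda>b. b))" for n
  obtain e where e: "lin_indep K {..<ext_degree K L} e" "lin_span K {..<ext_degree K L} e = L"
    "\<forall>i<ext_degree K L. e i \<in> L"
    by (rule finite_extension_basis[OF fe])
  have bound: "n \<le> ext_degree K L" if Pn: "P n" for n
  proof -
    obtain B where B: "finite B" "B \<subseteq> L" "card B = n" "strongly_indep K f B (\<lambda>b. b)"
      using Pn unfolding P_def by blast
    have "card B \<le> card {..<ext_degree K L}"
      by (rule lin_indep_card_le[OF K _ B(1) strongly_indep_imp_lin_indep[OF B(4)]])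
        (use B(2) e(2) in auto)
    thus ?thesis using B(3) by simp
  qed
  have "strongly_indep K f {} (\<lambda>b. b)" unfolding strongly_indep_def by (intro exI[of _ 1]) auto
  hence P0: "P 0" unfolding P_def by (intro exI[of _ "{}"]) auto
  define n where "n = (GREATEST n. P n)"
  have "P n" unfolding n_def using P0 bound by (rule GreatestI_nat)
  then obtain B where B: "finite B" "B \<subseteq> L" "card B = n" "strongly_indep K f B (\<lambda>b. b)"
    unfolding P_def by blast
  have max: "m \<le> n" if "P m" for m unfolding n_def using that bound by (rule Greatest_le_nat)
  have "\<exists>z\<in>lin_span K B (\<lambda>b. b). f (y - z) < e" if y: "y \<in> L" and e: "e > 0" for y e
  proof (rule ccontr)
    assume neg: "\<not> ?thesis"
    hence d: "e \<le> f (y - z)" if "z \<in> lin_span K B (\<lambda>b. b)" for z using that by force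
    have "y \<notin> B"
    proof
      assume "y \<in> B"
      hence "y \<in> lin_span K B (\<lambda>b. b)" using lin_span_mem[OF K B(1), of y "\<lambda>b. b"] by simp
      from d[OF this] e show False by simp
    qed
    have "strongly_indep K f (insert y B) (\<lambda>b. b)"
      by (rule strongly_indep_insert[OF B(4,1,2) y \<open>y \<notin> B\<close> e d])
    hence "P (Suc n)" unfolding P_def using B y \<open>y \<notin> B\<close> by (intro exI[of _ "insert y B"]) auto
    from max[OF this] show False by simp
  qed
  thus ?thesis unfolding local_basis_def using B by (intro exI[of _ B]) auto
qed

end

text \<open>
  A combination of the products \<open>x\<^sub>i y\<^sub>j\<close> is a combination of the \<open>y\<^sub>j\<close> whose coefficients are combinations of
  the \<open>x\<^sub>i\<close>, so that both the coefficient bounds and the approximations compose.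
\<close>

lemma local_basis_tower:
  assumes lx: "local_basis K L g I x" and ly: "local_basis L M g J y"
    and K: "Qbar_subfield K" and L: "Qbar_subfield L" and g: "abs_value M g" and "K \<subseteq> L" "L \<subseteq> M"
  shows "local_basis K M g (I \<times> J) (\<lambda>(i, j). x i * y j)"
proof -
  interpret abs_value M g by fact
  interpret K: Qbar_subfield K by fact
  interpret L: Qbar_subfield L by fact
  have fin: "finite I" "finite J" and xL: "\<forall>i\<in>I. x i \<in> L" and yM: "\<forall>j\<in>J. y j \<in> M"
    using lx ly by (auto simp: local_basis_def)
  have xM: "\<forall>i\<in>I. x i \<in> M" using xL \<open>L \<subseteq> M\<close> by auto
  have regroup: "(\<Sum>p\<in>I \<times> J. a p * (case p of (i, j) \<Rightarrow> x i * y j)) = (\<Sum>j\<in>J. (\<Sum>i\<in>I. a (i, j) * x i) * y j)" for a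
  proof -
    have "(\<Sum>p\<in>I \<times> J. a p * (case p of (i, j) \<Rightarrow> x i * y j)) = (\<Sum>i\<in>I. \<Sum>j\<in>J. a (i, j) * (x i * y j))"
      by (simp add: sum.cartesian_product case_prod_beta)
    also have "\<dots> = (\<Sum>j\<in>J. \<Sum>i\<in>I. a (i, j) * (x i * y j))" by (rule sum.swap)
    finally show ?thesis by (simp add: sum_distrib_right mult.assoc)
  qed
  have "strongly_indep K g I x" "strongly_indep L g J y" using lx ly by (auto simp: local_basis_def)
  then obtain C D where C: "C > 0" "\<forall>a. (\<forall>i\<in>I. a i \<in> K) \<longrightarrow> (\<forall>i\<in>I. g (a i) \<le> C * g (\<Sum>i\<in>I. a i * x i))"
    and D: "D > 0" "\<forall>a. (\<forall>i\<in>J. a i \<in> L) \<longrightarrow> (\<forall>i\<in>J. g (a i) \<le> D * g (\<Sum>i\<in>J. a i * y i))"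
    unfolding strongly_indep_def by blast
  have "g (a p) \<le> (C * D) * g (\<Sum>p\<in>I \<times> J. a p * (case p of (i, j) \<Rightarrow> x i * y j))"
    if a: "\<forall>p\<in>I \<times> J. a p \<in> K" and p: "p \<in> I \<times> J" for a p
  proof -
    obtain i j where ij: "p = (i, j)" "i \<in> I" "j \<in> J" using p by auto
    have "g (a (i, j)) \<le> C * g (\<Sum>i\<in>I. a (i, j) * x i)"
      using C(2)[rule_format, of "\<lambda>i. a (i, j)" i] a ij by auto
    also have "g (\<Sum>i\<in>I. a (i, j) * x i) \<le> D * g (\<Sum>j\<in>J. (\<Sum>i\<in>I. a (i, j) * x i) * y j)"
      using a xL \<open>K \<subseteq> L\<close> ij by (intro D(2)[rule_format, of "\<lambda>j. \<Sum>i\<in>I. a (i, j) * x i"] L.sum_mem L.mult_mem) auto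
    finally show ?thesis using C(1) regroup[of a] ij by (simp add: mult.assoc)
  qed
  hence si: "strongly_indep K g (I \<times> J) (\<lambda>(i, j). x i * y j)"
    unfolding strongly_indep_def using C(1) D(1) by (intro exI[of _ "C * D"]) auto
  have dense: "\<exists>z\<in>lin_span K (I \<times> J) (\<lambda>(i, j). x i * y j). g (t - z) < e" if t: "t \<in> M" and e: "e > 0" for t e
  proof -
    obtain s where s: "s \<in> lin_span L J y" "g (t - s) < e / 2"
      using ly t e unfolding local_basis_def by (meson half_gt_zero)
    obtain l where l: "\<forall>j\<in>J. l j \<in> L" "s = (\<Sum>j\<in>J. l j * y j)" by (rule lin_spanE[OF s(1)])
    define N where "N = (\<Sum>j\<in>J. g (y j)) + 1"
    have N: "N > 0" unfolding N_def using nonneg yM by (intro add_nonneg_pos sum_nonneg) auto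
    have "\<forall>j\<in>J. \<exists>a. (\<forall>i\<in>I. a i \<in> K) \<and> g (l j - (\<Sum>i\<in>I. a i * x i)) < e / (2 * N)"
    proof
      fix j assume j: "j \<in> J"
      have "e / (2 * N) > 0" using e N by simp
      then obtain z where z: "z \<in> lin_span K I x" "g (l j - z) < e / (2 * N)"
        using lx l(1) j unfolding local_basis_def by blast
      obtain a where "\<forall>i\<in>I. a i \<in> K" "z = (\<Sum>i\<in>I. a i * x i)" by (rule lin_spanE[OF z(1)])
      thus "\<exists>a. (\<forall>i\<in>I. a i \<in> K) \<and> g (l j - (\<Sum>i\<in>I. a i * x i)) < e / (2 * N)" using z(2) by blast
    qed
    from bchoice[OF this] obtain a where
      a: "\<forall>j\<in>J. (\<forall>i\<in>I. a j i \<in> K) \<and> g (l j - (\<Sum>i\<in>I. a j i * x i)) < e / (2 * N)" by blast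
    define q where "q j = (\<Sum>i\<in>I. a j i * x i)" for j
    have qM: "q j \<in> M" if "j \<in> J" for j
    proof -
      have "a j i \<in> M" if "i \<in> I" for i using bspec[OF a \<open>j \<in> J\<close>] that \<open>K \<subseteq> L\<close> \<open>L \<subseteq> M\<close> by auto
      thus ?thesis unfolding q_def using xM by (intro sum_mem mult_mem) auto
    qed
    have lM: "l j \<in> M" if "j \<in> J" for j using l(1) that \<open>L \<subseteq> M\<close> by auto
    define z where "z = (\<Sum>j\<in>J. q j * y j)"
    have "z = (\<Sum>p\<in>I \<times> J. a (snd p) (fst p) * (case p of (i, j) \<Rightarrow> x i * y j))"
      unfolding z_def q_def using regroup[of "\<lambda>p. a (snd p) (fst p)"] by simp
    moreover have "\<forall>p\<in>I \<times> J. a (snd p) (fst p) \<in> K" using a by auto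
    ultimately have zs: "z \<in> lin_span K (I \<times> J) (\<lambda>(i, j). x i * y j)"
      unfolding lin_span_def by (intro CollectI exI[of _ "\<lambda>p. a (snd p) (fst p)"]) auto
    have zM: "z \<in> M" "s \<in> M" unfolding z_def l(2) using qM lM yM by (auto intro!: sum_mem mult_mem)
    have "s - z = (\<Sum>j\<in>J. (l j - q j) * y j)" unfolding l(2) z_def by (simp add: sum_subtractf left_diff_distrib)
    also have "g \<dots> \<le> (\<Sum>j\<in>J. g ((l j - q j) * y j))" using qM lM yM by (intro sum_triangle mult_mem diff_mem) auto
    also have "\<dots> = (\<Sum>j\<in>J. g (l j - q j) * g (y j))" using qM lM yM by (intro sum.cong refl mult diff_mem) auto
    also have "\<dots> \<le> (\<Sum>j\<in>J. e / (2 * N) * g (y j))"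
      using a yM nonneg by (intro sum_mono mult_right_mono) (auto simp: q_def less_imp_le)
    also have "\<dots> = e / (2 * N) * (N - 1)" by (simp add: N_def sum_distrib_left)
    also have "\<dots> \<le> e / 2" using e N by (simp add: field_simps)
    finally have "g (s - z) \<le> e / 2" .
    moreover have "g (t - z) \<le> g (t - s) + g (s - z)"
      using triangle[of "t - s" "s - z"] t zM diff_mem by simp
    ultimately show ?thesis using s(2) zs by (intro bexI[of _ z]) auto
  qed
  have "\<forall>p\<in>I \<times> J. (case p of (i, j) \<Rightarrow> x i * y j) \<in> M"
    using xM yM by (auto intro: mult_mem)
  thus ?thesis unfolding local_basis_def using fin si dense by auto
qed

text \<open>
  An isomorphism over \<open>K\<close> that preserves the values carries the two conditions over.
\<close>

lemma local_basis_transport: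
  assumes lb: "local_basis K L g I x" and K: "Qbar_subfield K" and L: "Qbar_subfield L" and KL: "K \<subseteq> L"
    and add: "\<And>s t. s \<in> L \<Longrightarrow> t \<in> L \<Longrightarrow> \<phi> (s + t) = \<phi> s + \<phi> t"
    and mult: "\<And>s t. s \<in> L \<Longrightarrow> t \<in> L \<Longrightarrow> \<phi> (s * t) = \<phi> s * \<phi> t"
    and base: "\<And>a. a \<in> K \<Longrightarrow> \<phi> a = a" and val: "\<And>s. s \<in> L \<Longrightarrow> h (\<phi> s) = g s"
  shows "local_basis K (\<phi> ` L) h I (\<lambda>i. \<phi> (x i))"
proof -
  interpret K: Qbar_subfield K by fact
  interpret L: Qbar_subfield L by fact
  have xL: "x i \<in> L" if "i \<in> I" for i using lb that by (simp add: local_basis_def)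
  have sum: "\<phi> (\<Sum>j\<in>J. t j) = (\<Sum>j\<in>J. \<phi> (t j))" if "\<And>j. j \<in> J \<Longrightarrow> t j \<in> L" for J :: "'a set" and t
    using that
  proof (induction J rule: infinite_finite_induct)
    case (insert j J)
    thus ?case using add[of "t j" "sum t J"] by (auto intro: L.sum_mem)
  qed (use base in auto)
  have comb: "(\<Sum>i\<in>I. a i * x i) \<in> L" "\<phi> (\<Sum>i\<in>I. a i * x i) = (\<Sum>i\<in>I. a i * \<phi> (x i))"
    if a: "\<forall>i\<in>I. a i \<in> K" for a
  proof -
    have aL: "a i \<in> L" "a i * x i \<in> L" if "i \<in> I" for i using a that xL KL by auto
    show "(\<Sum>i\<in>I. a i * x i) \<in> L" using aL by (intro L.sum_mem)
    have "\<phi> (\<Sum>i\<in>I. a i * x i) = (\<Sum>i\<in>I. \<phi> (a i * x i))" by (rule sum) (rule aL(2))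
    also have "\<dots> = (\<Sum>i\<in>I. a i * \<phi> (x i))" using mult aL(1) xL base a by (intro sum.cong) auto
    finally show "\<phi> (\<Sum>i\<in>I. a i * x i) = (\<Sum>i\<in>I. a i * \<phi> (x i))" .
  qed
  have "strongly_indep K h I (\<lambda>i. \<phi> (x i))"
  proof -
    obtain C where C: "C > 0" "\<forall>a. (\<forall>i\<in>I. a i \<in> K) \<longrightarrow> (\<forall>i\<in>I. g (a i) \<le> C * g (\<Sum>i\<in>I. a i * x i))"
      using lb unfolding local_basis_def strongly_indep_def by blast
    have "h (a i) \<le> C * h (\<Sum>i\<in>I. a i * \<phi> (x i))" if a: "\<forall>i\<in>I. a i \<in> K" and i: "i \<in> I" for a i
    proof -
      have aK: "a i \<in> K" "a i \<in> L" using a i KL by auto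
      have "g (a i) \<le> C * g (\<Sum>i\<in>I. a i * x i)" using C(2) a i by blast
      thus ?thesis using val[OF comb(1)[OF a]] val[OF aK(2)] by (simp only: comb(2)[OF a] base[OF aK(1)])
    qed
    thus ?thesis unfolding strongly_indep_def using C(1) by blast
  qed
  moreover have "\<exists>z\<in>lin_span K I (\<lambda>i. \<phi> (x i)). h (\<phi> y - z) < e" if y: "y \<in> L" and e: "e > 0" for y e
  proof -
    obtain z where z: "z \<in> lin_span K I x" "g (y - z) < e"
      using lb y e unfolding local_basis_def by blast
    obtain a where a: "\<forall>i\<in>I. a i \<in> K" "z = (\<Sum>i\<in>I. a i * x i)" by (rule lin_spanE[OF z(1)])
    have zL: "z \<in> L" using comb(1)[OF a(1)] a(2) by simp
    have "\<phi> ((y - z) + z) = \<phi> (y - z) + \<phi> z" using y zL by (intro add) auto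
    hence "\<phi> y - \<phi> z = \<phi> (y - z)" by simp
    hence "h (\<phi> y - \<phi> z) < e" using z(2) val[OF L.diff_mem[OF y zL]] by simp
    moreover have "\<phi> z \<in> lin_span K I (\<lambda>i. \<phi> (x i))"
      unfolding a(2) comb(2)[OF a(1)] lin_span_def using a(1) by blast
    ultimately show ?thesis by blast
  qed
  ultimately show ?thesis using lb by (auto simp: local_basis_def)
qed

context norms_above
begin

text \<open>
  Moving the members of the local bases by weak approximation so that each becomes almost zero
  at all the other places makes their union linearly independent over \<open>K\<close>: at the place of a
  largest coefficient the other contributions to a vanishing combination are too small.
\<close>

lemma sum_local_basis_le:
  fixes I :: "(Qbar \<Rightarrow> real) \<Rightarrow> 'i set"
  assumes fin: "finite S" and lb: "\<And>g. g \<in> S \<Longrightarrow> local_basis K L g (I g) (x g)"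
    and fe: "finite_extension K L"
  shows "(\<Sum>g\<in>S. card (I g)) \<le> ext_degree K L"
proof -
  have finI: "finite (I g)" and xL: "i \<in> I g \<Longrightarrow> x g i \<in> L" if "g \<in> S" for g i
    using lb[OF that] by (auto simp: local_basis_def)
  define P where "P = Sigma S I"
  have finP: "finite P" unfolding P_def using fin finI by auto
  have cardP: "card P = (\<Sum>g\<in>S. card (I g))" unfolding P_def using fin finI by (intro card_SigmaI) auto
  have "\<forall>g\<in>S. \<exists>C>0. \<forall>a. (\<forall>i\<in>I g. a i \<in> K) \<longrightarrow> (\<forall>i\<in>I g. g (a i) \<le> C * g (\<Sum>i\<in>I g. a i * x g i))"
    using lb unfolding local_basis_def strongly_indep_def by blast
  from bchoice[OF this] obtain c where c: "\<forall>g\<in>S. c g > 0 \<and> (\<forall>a. (\<forall>i\<in>I g. a i \<in> K) \<longrightarrow>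
      (\<forall>i\<in>I g. g (a i) \<le> c g * g (\<Sum>i\<in>I g. a i * x g i)))" by blast
  define C where "C = (\<Sum>g\<in>S. c g) + 1"
  have C0: "C > 0" unfolding C_def using c by (intro add_nonneg_pos sum_nonneg) (auto intro: less_imp_le)
  have cC: "c g \<le> C" if "g \<in> S" for g
  proof -
    have "c g \<le> sum c S" by (rule member_le_sum) (use that fin c in \<open>auto intro: less_imp_le\<close>)
    thus ?thesis by (simp add: C_def)
  qed
  \<comment> \<open>small enough for \<open>C * card P * e < 1\<close>\<close>
  define e where "e = 1 / (2 * C * (real (card P) + 1))"
  have e: "e > 0" using C0 by (simp add: e_def)
  have "\<forall>p\<in>P. \<exists>z. z \<in> L \<and> (\<forall>h\<in>S. h (z - (if h = fst p then x (fst p) (snd p) else 0)) < e)"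
  proof
    fix p assume "p \<in> P"
    hence "x (fst p) (snd p) \<in> L" using xL by (auto simp: P_def)
    hence "\<exists>z\<in>L. \<forall>h\<in>S. h (z - (if h = fst p then x (fst p) (snd p) else 0)) < e"
      by (intro weak_approximation[OF fin _ e]) auto
    thus "\<exists>z. z \<in> L \<and> (\<forall>h\<in>S. h (z - (if h = fst p then x (fst p) (snd p) else 0)) < e)" unfolding Bex_def .
  qed
  from bchoice[OF this] obtain z where
    z: "\<forall>p\<in>P. z p \<in> L \<and> (\<forall>h\<in>S. h (z p - (if h = fst p then x (fst p) (snd p) else 0)) < e)" by blast
  have "lin_indep K P z"
    unfolding lin_indep_def
  proof (intro allI impI, elim conjE, rule ccontr)
    fix a assume a: "\<forall>p\<in>P. a p \<in> K" and s0: "(\<Sum>p\<in>P. a p * z p) = 0" and "\<not> (\<forall>p\<in>P. a p = 0)"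
    then obtain p1 where p1: "p1 \<in> P" "a p1 \<noteq> 0" by blast
    have "\<exists>p\<in>P. \<forall>q\<in>P. v (a q) \<le> v (a p)"
    proof -
      have "Max ((\<lambda>p. v (a p)) ` P) \<in> (\<lambda>p. v (a p)) ` P" using finP p1 by (intro Max_in) auto
      then obtain p where "p \<in> P" "v (a p) = Max ((\<lambda>p. v (a p)) ` P)" by force
      thus ?thesis using finP by (intro bexI[of _ p]) auto
    qed
    then obtain p where p: "p \<in> P" "\<And>q. q \<in> P \<Longrightarrow> v (a q) \<le> v (a p)" by blast
    obtain g i where gi: "p = (g, i)" "g \<in> S" "i \<in> I g" using p(1) by (auto simp: P_def)
    interpret g: abs_value L g by (rule abs[OF gi(2)])
    have aL: "a q \<in> L" if "q \<in> P" for q using a KL that by auto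
    have zL: "z q \<in> L" if "q \<in> P" for q using z that by auto
    have ga: "g (a q) = v (a q)" if "q \<in> P" for q using above[OF gi(2)] a that by auto
    define m where "m = v (a p)"
    have "0 < g (a p1)" using g.pos[OF aL[OF p1(1)]] p1(2) by simp
    hence m0: "m > 0" using ga[OF p1(1)] p(2)[OF p1(1)] by (simp add: m_def)
    define y where "y q = (if g = fst q then x (fst q) (snd q) else 0)" for q
    have yL: "y q \<in> L" if "q \<in> P" for q unfolding y_def using xL that by (auto simp: P_def)
    have "(\<Sum>q\<in>P. a q * y q) = (\<Sum>h\<in>S. \<Sum>j\<in>I h. a (h, j) * y (h, j))"
      unfolding P_def using sum.Sigma[of S I "\<lambda>h j. a (h, j) * y (h, j)"] fin finI by (auto simp: case_prod_beta)
    also have "\<dots> = (\<Sum>h\<in>S. if h = g then (\<Sum>j\<in>I h. a (h, j) * x h j) else 0)"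
      by (rule sum.cong) (auto simp: y_def)
    also have "\<dots> = (\<Sum>j\<in>I g. a (g, j) * x g j)" using fin gi by simp
    finally have ysum: "(\<Sum>q\<in>P. a q * y q) = (\<Sum>j\<in>I g. a (g, j) * x g j)" .
    have "(\<Sum>q\<in>P. a q * y q) = (\<Sum>q\<in>P. a q * (y q - z q))"
      using s0 by (simp add: right_diff_distrib sum_subtractf)
    also have "g \<dots> \<le> (\<Sum>q\<in>P. g (a q * (y q - z q)))"
      using aL yL zL by (intro g.sum_triangle L.mult_mem L.diff_mem) auto
    also have "\<dots> \<le> (\<Sum>q\<in>P. m * e)"
    proof (rule sum_mono)
      fix q assume q: "q \<in> P"
      have "g (a q * (y q - z q)) = v (a q) * g (y q - z q)"
        using g.mult[of "a q" "y q - z q"] ga[OF q] aL[OF q] yL[OF q] zL[OF q] by auto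
      also have "g (y q - z q) = g (z q - y q)" using g.diff_commute yL[OF q] zL[OF q] by auto
      also have "v (a q) * g (z q - y q) \<le> m * e"
      proof (rule mult_mono)
        show "v (a q) \<le> m" unfolding m_def by (rule p(2)[OF q])
        show "g (z q - y q) \<le> e" using z[rule_format, OF q] gi(2) unfolding y_def by (auto intro: less_imp_le)
        show "0 \<le> g (z q - y q)" using g.nonneg zL[OF q] yL[OF q] by auto
      qed (use m0 in auto)
      finally show "g (a q * (y q - z q)) \<le> m * e" .
    qed
    also have "\<dots> = real (card P) * (m * e)" by simp
    finally have small: "g (\<Sum>j\<in>I g. a (g, j) * x g j) \<le> real (card P) * (m * e)" unfolding ysum .
    have cg: "\<forall>a. (\<forall>i\<in>I g. a i \<in> K) \<longrightarrow> (\<forall>i\<in>I g. g (a i) \<le> c g * g (\<Sum>i\<in>I g. a i * x g i))"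
      using c gi(2) by blast
    have "g (a (g, i)) \<le> c g * g (\<Sum>j\<in>I g. a (g, j) * x g j)"
      by (rule cg[rule_format, of "\<lambda>i. a (g, i)"]) (use gi a in \<open>auto simp: P_def\<close>)
    hence "m \<le> c g * g (\<Sum>j\<in>I g. a (g, j) * x g j)" using ga[OF p(1)] gi by (simp add: m_def)
    also have "\<dots> \<le> C * (real (card P) * (m * e))"
      using small cC[OF gi(2)] C0 by (intro mult_mono) (auto intro!: g.nonneg L.sum_mem L.mult_mem aL xL simp: P_def gi)
    also have "\<dots> < m"
    proof -
      have Ce: "C * e = 1 / (2 * (real (card P) + 1))" using C0 by (simp add: e_def)
      have "C * (real (card P) * (m * e)) = m * (real (card P) * (C * e))" by (simp only: mult_ac)
      also have "\<dots> < m * 1" unfolding Ce using m0 by (intro mult_strict_left_mono) (auto simp: field_simps)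
      finally show ?thesis by simp
    qed
    finally show False by simp
  qed
  obtain b where b: "lin_span K {..<ext_degree K L} b = L"
    using finite_extension_basis[OF fe] by metis
  have "card P \<le> card {..<ext_degree K L}"
    by (rule lin_indep_card_le[OF K.Qbar_subfield_axioms _ finP \<open>lin_indep K P z\<close>])
      (use z b in auto)
  thus ?thesis using cardP by simp
qed

text \<open>
  If the coefficients of combinations of \<open>b\<^sub>0, \<dots>, b\<^bsub>n-1\<^esub>\<close> are controlled by the values at all
  places together, there cannot be fewer than \<open>n\<close> elements in all local bases: otherwise the local
  approximations of the \<open>b\<^sub>k\<close> satisfy a common linear relation over \<open>K\<close>, and the same
  combination of the \<open>b\<^sub>k\<close> is small at every place.
\<close>

lemma sum_local_basis_ge:
  fixes I :: "(Qbar \<Rightarrow> real) \<Rightarrow> 'i set"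
  assumes fin: "finite S" and lb: "\<And>g. g \<in> S \<Longrightarrow> local_basis K L g (I g) (x g)"
    and b: "\<And>k. k < n \<Longrightarrow> b k \<in> L" and C: "C > 0"
      "\<And>a k. (\<And>k. k < n \<Longrightarrow> a k \<in> K) \<Longrightarrow> k < n \<Longrightarrow> \<exists>g\<in>S. v (a k) \<le> C * g (\<Sum>k<n. a k * b k)"
  shows "n \<le> (\<Sum>g\<in>S. card (I g))"
proof (rule ccontr)
  assume "\<not> ?thesis"
  have finI: "finite (I g)" and xL: "i \<in> I g \<Longrightarrow> x g i \<in> L" if "g \<in> S" for g i
    using lb[OF that] by (auto simp: local_basis_def)
  define P where "P = Sigma S I"
  have finP: "finite P" unfolding P_def using fin finI by auto
  have "card P = (\<Sum>g\<in>S. card (I g))" unfolding P_def using fin finI by (intro card_SigmaI) auto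
  with \<open>\<not> ?thesis\<close> have less: "card P < card {..<n}" by simp
  \<comment> \<open>small enough for \<open>C * n * e < 1\<close>\<close>
  define e where "e = 1 / (2 * C * (real n + 1))"
  have e: "e > 0" using C by (simp add: e_def)
  have "\<forall>q\<in>S \<times> {..<n}. \<exists>m. (\<forall>i\<in>I (fst q). m i \<in> K) \<and>
      fst q (b (snd q) - (\<Sum>i\<in>I (fst q). m i * x (fst q) i)) < e"
  proof
    fix q assume "q \<in> S \<times> {..<n}"
    then obtain g k where q: "q = (g, k)" "g \<in> S" "k < n" by auto
    obtain z where z: "z \<in> lin_span K (I g) (x g)" "g (b k - z) < e"
      using lb[OF q(2)] b[OF q(3)] e unfolding local_basis_def by blast
    obtain m where "\<forall>i\<in>I g. m i \<in> K" "z = (\<Sum>i\<in>I g. m i * x g i)" by (rule lin_spanE[OF z(1)])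
    thus "\<exists>m. (\<forall>i\<in>I (fst q). m i \<in> K) \<and> fst q (b (snd q) - (\<Sum>i\<in>I (fst q). m i * x (fst q) i)) < e"
      using z(2) q(1) by auto
  qed
  from bchoice[OF this] obtain m where m: "\<forall>q\<in>S \<times> {..<n}. (\<forall>i\<in>I (fst q). m q i \<in> K) \<and>
      fst q (b (snd q) - (\<Sum>i\<in>I (fst q). m q i * x (fst q) i)) < e" by blast
  have mK: "m (fst p, k) (snd p) \<in> K" if "p \<in> P" "k \<in> {..<n}" for p k
    using m[rule_format, of "(fst p, k)"] that by (auto simp: P_def)
  obtain a where a: "\<forall>k\<in>{..<n}. a k \<in> K" "\<exists>k\<in>{..<n}. a k \<noteq> 0"
      "\<forall>p\<in>P. (\<Sum>k<n. m (fst p, k) (snd p) * a k) = 0"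
    using homogeneous_system_solvable[OF K.Qbar_subfield_axioms finP finite_lessThan less,
      of "\<lambda>p k. m (fst p, k) (snd p)", OF mK] by blast
  have "\<exists>k<n. \<forall>j<n. v (a j) \<le> v (a k)"
  proof -
    have "Max ((\<lambda>p. v (a p)) ` {..<n}) \<in> (\<lambda>p. v (a p)) ` {..<n}" using a(2) by (intro Max_in) auto
    then obtain p where "p < n" "v (a p) = Max ((\<lambda>p. v (a p)) ` {..<n})" by force
    thus ?thesis by (intro exI[of _ p]) auto
  qed
  then obtain k where k: "k < n" "\<And>j. j < n \<Longrightarrow> v (a j) \<le> v (a k)" by blast
  have aK: "a j \<in> K" if "j < n" for j using a(1) that by auto
  have "\<exists>g\<in>S. v (a k) \<le> C * g (\<Sum>k<n. a k * b k)" by (rule C(2)[OF aK k(1)])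
  then obtain g where g: "g \<in> S" "v (a k) \<le> C * g (\<Sum>k<n. a k * b k)" by blast
  interpret g: abs_value L g by (rule abs[OF g(1)])
  have aL: "a j \<in> L" if "j < n" for j using aK KL that by auto
  define q where "q j = (\<Sum>i\<in>I g. m (g, j) i * x g i)" for j
  have qL: "q j \<in> L" if "j < n" for j unfolding q_def
    using m[rule_format, of "(g, j)"] that g(1) xL[OF g(1)] KL by (intro L.sum_mem L.mult_mem) auto
  have "(\<Sum>j<n. a j * q j) = (\<Sum>j<n. \<Sum>i\<in>I g. m (g, j) i * a j * x g i)"
    unfolding q_def by (intro sum.cong refl) (auto simp: sum_distrib_left algebra_simps)
  also have "\<dots> = (\<Sum>i\<in>I g. \<Sum>j<n. m (g, j) i * a j * x g i)" by (rule sum.swap)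
  also have "\<dots> = (\<Sum>i\<in>I g. (\<Sum>j<n. m (g, j) i * a j) * x g i)" by (simp add: sum_distrib_right)
  also have "\<dots> = 0" using a(3) g(1) by (intro sum.neutral) (auto simp: P_def)
  finally have q0: "(\<Sum>j<n. a j * q j) = 0" .
  define M where "M = v (a k)"
  have M0: "M > 0"
  proof -
    obtain j where j: "j < n" "a j \<noteq> 0" using a(2) by auto
    have "0 < g (a j)" using g.pos[OF aL[OF j(1)]] j by simp
    thus ?thesis using above[OF g(1) aK[OF j(1)]] k(2)[OF j(1)] by (simp add: M_def)
  qed
  have "(\<Sum>j<n. a j * b j) = (\<Sum>j<n. a j * (b j - q j))"
    using q0 by (simp add: right_diff_distrib sum_subtractf)
  also have "g \<dots> \<le> (\<Sum>j<n. g (a j * (b j - q j)))"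
    using aL b qL by (intro g.sum_triangle L.mult_mem L.diff_mem) auto
  also have "\<dots> \<le> (\<Sum>j<n. M * e)"
  proof (rule sum_mono)
    fix j assume "j \<in> {..<n}"
    hence j: "j < n" by simp
    have "g (a j * (b j - q j)) = v (a j) * g (b j - q j)"
      using g.mult[of "a j" "b j - q j"] above[OF g(1) aK[OF j]] aL[OF j] b[OF j] qL[OF j] by auto
    also have "\<dots> \<le> M * e"
    proof (rule mult_mono)
      show "v (a j) \<le> M" unfolding M_def by (rule k(2)[OF j])
      show "g (b j - q j) \<le> e" using m[rule_format, of "(g, j)"] g(1) j unfolding q_def by auto
      show "0 \<le> g (b j - q j)" using g.nonneg b[OF j] qL[OF j] by auto
    qed (use M0 in auto)
    finally show "g (a j * (b j - q j)) \<le> M * e" .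
  qed
  also have "\<dots> = real n * (M * e)" by simp
  finally have "C * g (\<Sum>j<n. a j * b j) \<le> C * (real n * (M * e))" using C(1) by simp
  hence "M \<le> C * (real n * (M * e))" using g(2) unfolding M_def by simp
  also have "\<dots> = M * (real n * (C * e))" by (simp only: mult_ac)
  also have "C * e = 1 / (2 * (real n + 1))" using C(1) by (simp add: e_def)
  also have "M * (real n * (1 / (2 * (real n + 1)))) < M * 1" using M0 by (intro mult_strict_left_mono) (auto simp: field_simps)
  finally show False by simp
qed

end

section \<open>Local degrees and completions\<close>

definition cauchy_seq :: "(Qbar \<Rightarrow> real) \<Rightarrow> (nat \<Rightarrow> Qbar) \<Rightarrow> bool"
  where "cauchy_seq g s \<longleftrightarrow> (\<forall>e>0. \<exists>N. \<forall>m\<ge>N. \<forall>n\<ge>N. g (s m - s n) < e)"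

context abs_value
begin

lemma cauchy_seq_bounded:
  assumes s: "\<And>n. s n \<in> L" "cauchy_seq f s"
  obtains B where "B > 0" "\<forall>n. f (s n) \<le> B"
proof -
  from s(2) have "\<exists>N. \<forall>m\<ge>N. \<forall>n\<ge>N. f (s m - s n) < 1" unfolding cauchy_seq_def by (meson zero_less_one)
  then obtain N where N: "\<And>m n. m \<ge> N \<Longrightarrow> n \<ge> N \<Longrightarrow> f (s m - s n) < 1" by blast
  define B where "B = (\<Sum>n\<le>N. f (s n)) + 1"
  have nn: "0 \<le> f (s n)" for n using nonneg s by blast
  have "B > 0" unfolding B_def using nn by (intro add_nonneg_pos sum_nonneg) auto
  moreover have "f (s n) \<le> B" for n
  proof (cases "n \<le> N")
    case True
    have "f (s n) \<le> (\<Sum>n\<le>N. f (s n))" by (rule member_le_sum) (use True nn in auto)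
    thus ?thesis by (simp add: B_def)
  next
    case False
    have "f (s n) - f (s N) \<le> f (s n - s N)" using triangle_rev s by blast
    moreover have "f (s n - s N) < 1" using N False by simp
    moreover have "f (s N) \<le> (\<Sum>n\<le>N. f (s n))" by (rule member_le_sum) (use nn in auto)
    ultimately show ?thesis by (simp add: B_def)
  qed
  ultimately show ?thesis using that by blast
qed

lemma cauchy_seq_add:
  assumes s: "\<And>n. s n \<in> L" "cauchy_seq f s" and t: "\<And>n. t n \<in> L" "cauchy_seq f t"
  shows "cauchy_seq f (\<lambda>n. s n + t n)"
  unfolding cauchy_seq_def
proof (intro allI impI)
  fix e :: real assume "e > 0"
  hence e: "e / 2 > 0" by simp
  obtain N1 where N1: "\<forall>m\<ge>N1. \<forall>n\<ge>N1. f (s m - s n) < e / 2" using s(2) e unfolding cauchy_seq_def by blast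
  obtain N2 where N2: "\<forall>m\<ge>N2. \<forall>n\<ge>N2. f (t m - t n) < e / 2" using t(2) e unfolding cauchy_seq_def by blast
  have "f (s m + t m - (s n + t n)) < e" if "m \<ge> max N1 N2" "n \<ge> max N1 N2" for m n
  proof -
    have "f (s m + t m - (s n + t n)) = f ((s m - s n) + (t m - t n))" by (simp add: algebra_simps)
    also have "\<dots> \<le> f (s m - s n) + f (t m - t n)" using s t by (intro triangle) auto
    also have "f (s m - s n) < e / 2" using N1 that by auto
    also have "f (t m - t n) < e / 2" using N2 that by auto
    finally show ?thesis by simp
  qed
  thus "\<exists>N. \<forall>m\<ge>N. \<forall>n\<ge>N. f (s m + t m - (s n + t n)) < e" by blast
qed

lemma cauchy_seq_uminus:
  assumes s: "\<And>n. s n \<in> L" "cauchy_seq f s"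
  shows "cauchy_seq f (\<lambda>n. - s n)"
proof -
  have "f (- s m - - s n) = f (s m - s n)" for m n
    using uminus[of "s m - s n"] s by (simp add: diff_mem)
  thus ?thesis using s(2) unfolding cauchy_seq_def by simp
qed

lemma cauchy_seq_mult:
  assumes s: "\<And>n. s n \<in> L" "cauchy_seq f s" and t: "\<And>n. t n \<in> L" "cauchy_seq f t"
  shows "cauchy_seq f (\<lambda>n. s n * t n)"
  unfolding cauchy_seq_def
proof (intro allI impI)
  fix e :: real assume e0: "e > 0"
  obtain A where A: "A > 0" "\<forall>n. f (s n) \<le> A" by (rule cauchy_seq_bounded[OF s])
  obtain B where B: "B > 0" "\<forall>n. f (t n) \<le> B" by (rule cauchy_seq_bounded[OF t])
  have e: "e / (2 * B) > 0" "e / (2 * A) > 0" using e0 A B by auto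
  obtain N1 where N1: "\<forall>m\<ge>N1. \<forall>n\<ge>N1. f (s m - s n) < e / (2 * B)" using s(2) e(1) unfolding cauchy_seq_def by blast
  obtain N2 where N2: "\<forall>m\<ge>N2. \<forall>n\<ge>N2. f (t m - t n) < e / (2 * A)" using t(2) e(2) unfolding cauchy_seq_def by blast
  have "f (s m * t m - s n * t n) < e" if "m \<ge> max N1 N2" "n \<ge> max N1 N2" for m n
  proof -
    have "f (s m * t m - s n * t n) = f ((s m - s n) * t m + s n * (t m - t n))" by (simp add: algebra_simps)
    also have "\<dots> \<le> f ((s m - s n) * t m) + f (s n * (t m - t n))" using s t by (intro triangle) auto
    also have "\<dots> = f (s m - s n) * f (t m) + f (s n) * f (t m - t n)"
      using s t by (simp add: mult diff_mem)
    also have "f (s m - s n) * f (t m) \<le> f (s m - s n) * B"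
      using B s nonneg by (intro mult_left_mono) (auto intro!: nonneg diff_mem)
    also have "f (s n) * f (t m - t n) \<le> A * f (t m - t n)"
      using A t by (intro mult_right_mono) (auto intro!: nonneg diff_mem)
    also have "f (s m - s n) * B < e / 2" using N1 that B by (simp add: field_simps)
    also have "A * f (t m - t n) < e / 2" using N2 that A by (simp add: field_simps)
    finally show ?thesis by simp
  qed
  thus "\<exists>N. \<forall>m\<ge>N. \<forall>n\<ge>N. f (s m * t m - s n * t n) < e" by blast
qed

lemma cauchy_seq_const: "cauchy_seq f (\<lambda>_. x)"
  unfolding cauchy_seq_def by simp

lemma null_imp_cauchy_seq:
  assumes s: "\<And>n. s n \<in> L" and lim: "(\<lambda>n. f (s n)) \<longlonglongrightarrow> 0"
  shows "cauchy_seq f s"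
  unfolding cauchy_seq_def
proof (intro allI impI)
  fix e :: real assume "e > 0"
  hence "\<forall>\<^sub>F n in sequentially. f (s n) < e / 2" using lim by (intro order_tendstoD) auto
  then obtain N where N: "\<And>n. n \<ge> N \<Longrightarrow> f (s n) < e / 2" by (auto simp: eventually_sequentially)
  have "f (s m - s n) < e" if "m \<ge> N" "n \<ge> N" for m n
    using diff_triangle[OF s[of m] s[of n]] N[OF that(1)] N[OF that(2)] by linarith
  thus "\<exists>N. \<forall>m\<ge>N. \<forall>n\<ge>N. f (s m - s n) < e" by blast
qed

lemma null_add:
  assumes "\<And>n. s n \<in> L" "(\<lambda>n. f (s n)) \<longlonglongrightarrow> 0" "\<And>n. t n \<in> L" "(\<lambda>n. f (t n)) \<longlonglongrightarrow> 0"
  shows "(\<lambda>n. f (s n + t n)) \<longlonglongrightarrow> 0"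
proof (rule tendsto_sandwich[where f = "\<lambda>_. 0"])
  show "(\<lambda>n. f (s n) + f (t n)) \<longlonglongrightarrow> 0" using tendsto_add[OF assms(2,4)] by simp
  show "\<forall>\<^sub>F n in sequentially. f (s n + t n) \<le> f (s n) + f (t n)"
    using assms by (intro always_eventually allI triangle) auto
  show "\<forall>\<^sub>F n in sequentially. 0 \<le> f (s n + t n)"
    using assms by (intro always_eventually allI nonneg add_mem) auto
qed auto

lemma null_mult:
  assumes "\<And>n. s n \<in> L" "(\<lambda>n. f (s n)) \<longlonglongrightarrow> 0" and t: "\<And>n. t n \<in> L" "cauchy_seq f t"
  shows "(\<lambda>n. f (s n * t n)) \<longlonglongrightarrow> 0"
proof -
  obtain B where B: "B > 0" "\<forall>n. f (t n) \<le> B" by (rule cauchy_seq_bounded[OF t])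
  show ?thesis
  proof (rule tendsto_sandwich[where f = "\<lambda>_. 0"])
    show "(\<lambda>n. f (s n) * B) \<longlonglongrightarrow> 0" using tendsto_mult[OF assms(2) tendsto_const[of B]] by simp
    show "\<forall>\<^sub>F n in sequentially. f (s n * t n) \<le> f (s n) * B"
      using assms B by (intro always_eventually allI) (simp add: mult mult_left_mono nonneg)
    show "\<forall>\<^sub>F n in sequentially. 0 \<le> f (s n * t n)"
      using assms by (intro always_eventually allI nonneg mult_mem) auto
  qed auto
qed

text \<open>
  A Cauchy sequence that is not null stays away from 0 eventually, so that its
  termwise inverse is a Cauchy sequence again.
\<close>

lemma cauchy_seq_inverse:
  assumes s: "\<And>n. s n \<in> L" "cauchy_seq f s" and nn: "\<not> (\<lambda>n. f (s n)) \<longlonglongrightarrow> 0"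
  shows "cauchy_seq f (\<lambda>n. inverse (s n))" "(\<lambda>n. f (s n * inverse (s n) - 1)) \<longlonglongrightarrow> 0"
proof -
  have "\<exists>d>0. \<forall>N. \<exists>n\<ge>N. d \<le> f (s n)"
  proof (rule ccontr)
    assume neg: "\<not> ?thesis"
    have "(\<lambda>n. f (s n)) \<longlonglongrightarrow> 0"
    proof (rule LIMSEQ_I)
      fix r :: real assume "r > 0"
      with neg obtain N where "\<forall>n\<ge>N. f (s n) < r" by (meson not_less)
      thus "\<exists>N. \<forall>n\<ge>N. norm (f (s n) - 0) < r" using nonneg s by auto
    qed
    with nn show False by blast
  qed
  then obtain d where d: "d > 0" "\<And>N. \<exists>n\<ge>N. d \<le> f (s n)" by blast
  obtain N where N: "\<forall>m\<ge>N. \<forall>n\<ge>N. f (s m - s n) < d / 2"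
    using s(2) d(1) unfolding cauchy_seq_def by (meson half_gt_zero)
  obtain k where k: "k \<ge> N" "d \<le> f (s k)" using d(2) by blast
  have low: "d / 2 \<le> f (s n)" if "n \<ge> N" for n
  proof -
    have "f (s k - s n) < d / 2" using N that k by blast
    moreover have "f (s k) - f (s n) \<le> f (s k - s n)" by (rule triangle_rev[OF s(1) s(1)])
    ultimately show ?thesis using k(2) by linarith
  qed
  hence nz: "s n \<noteq> 0" if "n \<ge> N" for n using that d(1) zero by fastforce
  have iv: "f (inverse (s n)) \<le> 2 / d" if "n \<ge> N" for n
  proof -
    have "inverse (f (s n)) \<le> inverse (d / 2)" using low[OF that] d(1) by (intro le_imp_inverse_le) auto
    thus ?thesis using inverse[OF s(1)] by simp
  qed
  show "cauchy_seq f (\<lambda>n. inverse (s n))"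
    unfolding cauchy_seq_def
  proof (intro allI impI)
    fix e :: real assume "e > 0"
    hence "e * (d / 2) * (d / 2) > 0" using d by simp
    then obtain M where M: "\<forall>m\<ge>M. \<forall>n\<ge>M. f (s m - s n) < e * (d / 2) * (d / 2)"
      using s(2) unfolding cauchy_seq_def by blast
    have "f (inverse (s m) - inverse (s n)) < e" if "m \<ge> max M N" "n \<ge> max M N" for m n
    proof -
      have "inverse (s m) - inverse (s n) = (s n - s m) * (inverse (s m) * inverse (s n))"
        using nz[of m] nz[of n] that by (simp add: field_simps)
      hence "f (inverse (s m) - inverse (s n)) = f (s n - s m) * (f (inverse (s m)) * f (inverse (s n)))"
        using s(1) by (simp add: mult diff_mem mult_mem inverse_mem)
      also have "\<dots> \<le> f (s n - s m) * ((2 / d) * (2 / d))"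
        using iv[of m] iv[of n] that s(1) d(1)
        by (intro mult_left_mono mult_mono) (auto intro!: nonneg inverse_mem diff_mem)
      also have "\<dots> < e * (d / 2) * (d / 2) * ((2 / d) * (2 / d))"
        using M that d(1) by (intro mult_strict_right_mono) auto
      also have "\<dots> = e" using d(1) by (simp add: field_simps)
      finally show ?thesis .
    qed
    thus "\<exists>N. \<forall>m\<ge>N. \<forall>n\<ge>N. f (inverse (s m) - inverse (s n)) < e" by blast
  qed
  have "\<forall>\<^sub>F n in sequentially. f (s n * inverse (s n) - 1) = 0"
    using eventually_ge_at_top[of N] by eventually_elim (simp add: nz)
  thus "(\<lambda>n. f (s n * inverse (s n) - 1)) \<longlonglongrightarrow> 0" by (rule tendsto_eventually)
qed

end

locale place_extension =
  fixes K L :: "Qbar set" and v w :: place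
  assumes nfK: "number_field K" and nfL: "number_field L" and subKL: "K \<subseteq> L"
    and v: "v \<in> places K" and w: "w \<in> places L" and vw: "\<And>x. x \<in> K \<Longrightarrow> place_norm v x = place_norm w x"
begin

lemma abs_place_norm: "abs_value L (place_norm w)"
  using place_norm_in(2)[OF nfL w] normalized_norms_iff[OF number_field_subfield[OF nfL]] by blast

sublocale abs_value_extension L "place_norm w" K
  by (intro abs_value_extension.intro abs_value_extension_axioms.intro abs_place_norm
      number_field_subfield[OF nfK] subKL)

abbreviation g :: "Qbar \<Rightarrow> real" where "g \<equiv> place_norm w"
abbreviation R :: "(nat \<Rightarrow> Qbar) ring" where "R \<equiv> cauchy_ring L w"
abbreviation N :: "(nat \<Rightarrow> Qbar) set" where "N \<equiv> null_ideal L w"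
abbreviation RK :: "(nat \<Rightarrow> Qbar) set" where "RK \<equiv> carrier (cauchy_ring K v)"
abbreviation \<pi> :: "(nat \<Rightarrow> Qbar) \<Rightarrow> (nat \<Rightarrow> Qbar) set" where "\<pi> s \<equiv> N +>\<^bsub>R\<^esub> s"

lemma R_simps [simp]:
  "s \<otimes>\<^bsub>R\<^esub> t = (\<lambda>n. s n * t n)" "s \<oplus>\<^bsub>R\<^esub> t = (\<lambda>n. s n + t n)" "\<one>\<^bsub>R\<^esub> = (\<lambda>_. 1)" "\<zero>\<^bsub>R\<^esub> = (\<lambda>_. 0)"
  by (simp_all add: cauchy_ring_def)

lemma carrier_R: "s \<in> carrier R \<longleftrightarrow> (\<forall>n. s n \<in> L) \<and> cauchy_seq g s"
  by (simp add: cauchy_ring_def cauchy_seq_def)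

lemma carrier_RK: "s \<in> RK \<longleftrightarrow> (\<forall>n. s n \<in> K) \<and> cauchy_seq g s"
  using vw[OF K.diff_mem] by (auto simp: cauchy_ring_def cauchy_seq_def)

lemma RK_subset: "RK \<subseteq> carrier R"
  using subsetD[OF KL] by (simp add: subset_iff carrier_R carrier_RK)

lemma mem_N: "s \<in> N \<longleftrightarrow> (\<forall>n. s n \<in> L) \<and> (\<lambda>n. g (s n)) \<longlonglongrightarrow> 0"
  using null_imp_cauchy_seq[of s] by (auto simp: null_ideal_def carrier_R)

lemma cring_R: "cring R"
proof (rule cringI)
  show "abelian_group R"
  proof (rule abelian_groupI)
    fix s assume s: "s \<in> carrier R"
    show "\<exists>t\<in>carrier R. t \<oplus>\<^bsub>R\<^esub> s = \<zero>\<^bsub>R\<^esub>"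
      using s cauchy_seq_uminus[of s] by (intro bexI[of _ "\<lambda>n. - s n"]) (auto simp: carrier_R)
  qed (auto simp: carrier_R cauchy_seq_const cauchy_seq_add algebra_simps intro!: add_mem)
  show "Group.comm_monoid R"
    by (rule comm_monoidI) (auto simp: carrier_R cauchy_seq_const cauchy_seq_mult algebra_simps intro!: mult_mem)
qed (auto simp: algebra_simps)

lemma R_uminus: "s \<in> carrier R \<Longrightarrow> \<ominus>\<^bsub>R\<^esub> s = (\<lambda>n. - s n)"
proof -
  interpret cring R by (rule cring_R)
  assume s: "s \<in> carrier R"
  show ?thesis
    by (rule minus_equality) (use s cauchy_seq_uminus[of s] in \<open>auto simp: carrier_R\<close>)
qed

lemma ideal_N: "ideal N R"
proof (rule idealI)
  interpret cring R by (rule cring_R)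
  show "ring R" by (rule ring_axioms)
  have NR: "N \<subseteq> carrier R" by (auto simp: null_ideal_def)
  show "subgroup N (add_monoid R)"
  proof (rule add.subgroupI)
    show "N \<subseteq> carrier R" by (rule NR)
    have "(\<lambda>_. 0) \<in> N" by (simp add: mem_N)
    thus "N \<noteq> {}" by blast
    fix s assume s: "s \<in> N"
    have "g (- s n) = g (s n)" for n using s uminus by (simp add: mem_N)
    moreover have "s \<in> carrier R" using s NR by blast
    ultimately show "\<ominus>\<^bsub>R\<^esub> s \<in> N" using s by (simp add: R_uminus mem_N uminus_mem)
    fix t assume t: "t \<in> N"
    show "s \<oplus>\<^bsub>R\<^esub> t \<in> N" using s t null_add[of s t] by (auto simp: mem_N)
  qed
  fix a x assume a: "a \<in> N" and x: "x \<in> carrier R"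
  have "(\<lambda>n. a n * x n) \<in> N" using a x null_mult[of a x] by (auto simp: mem_N carrier_R)
  thus "a \<otimes>\<^bsub>R\<^esub> x \<in> N" "x \<otimes>\<^bsub>R\<^esub> a \<in> N" by (simp_all add: mult.commute)
qed

lemma pi_eq_iff: "s \<in> carrier R \<Longrightarrow> t \<in> carrier R \<Longrightarrow> \<pi> s = \<pi> t \<longleftrightarrow> (\<lambda>n. g (s n - t n)) \<longlonglongrightarrow> 0"
proof -
  interpret cring R by (rule cring_R)
  assume s: "s \<in> carrier R" and t: "t \<in> carrier R"
  have "s \<ominus>\<^bsub>R\<^esub> t = (\<lambda>n. s n - t n)" using t by (simp add: a_minus_def R_uminus)
  moreover have "\<forall>n. s n - t n \<in> L" using s t by (auto simp: carrier_R)
  ultimately show ?thesis using quotient_eq_iff_same_a_r_cos[OF ideal_N s t] by (simp add: mem_N)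
qed

abbreviation Q :: "(nat \<Rightarrow> Qbar) set ring" where "Q \<equiv> completion L w"

lemma hom_pi: "ring_hom_ring R Q \<pi>"
  unfolding completion_def by (rule ideal.rcos_ring_hom_ring[OF ideal_N])

lemma carrier_Q: "carrier Q = \<pi> ` carrier R"
  unfolding completion_def FactRing_def A_RCOSETS_def' by auto

lemma pi_zero_iff: "s \<in> carrier R \<Longrightarrow> \<pi> s = \<zero>\<^bsub>Q\<^esub> \<longleftrightarrow> (\<lambda>n. g (s n)) \<longlonglongrightarrow> 0"
proof -
  interpret ring_hom_ring R Q \<pi> by (rule hom_pi)
  assume s: "s \<in> carrier R"
  show ?thesis using pi_eq_iff[OF s, of "\<zero>\<^bsub>R\<^esub>"] by (simp add: carrier_R cauchy_seq_const flip: hom_zero)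
qed

lemma pi_inverse:
  assumes s: "s \<in> carrier R" "\<pi> s \<noteq> \<zero>\<^bsub>Q\<^esub>"
  shows "(\<lambda>n. inverse (s n)) \<in> carrier R" "\<pi> s \<otimes>\<^bsub>Q\<^esub> \<pi> (\<lambda>n. inverse (s n)) = \<one>\<^bsub>Q\<^esub>"
proof -
  interpret ring_hom_ring R Q \<pi> by (rule hom_pi)
  have sL: "\<And>n. s n \<in> L" "cauchy_seq g s" and nn: "\<not> (\<lambda>n. g (s n)) \<longlonglongrightarrow> 0"
    using s pi_zero_iff[OF s(1)] by (auto simp: carrier_R)
  note inv = cauchy_seq_inverse[OF sL nn]
  show i: "(\<lambda>n. inverse (s n)) \<in> carrier R" using inv(1) sL by (auto simp: carrier_R)
  have "\<pi> (s \<otimes>\<^bsub>R\<^esub> (\<lambda>n. inverse (s n))) = \<pi> \<one>\<^bsub>R\<^esub>"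
    by (subst pi_eq_iff) (use s i inv(2) R.m_closed[OF s(1) i] in \<open>simp_all add: carrier_R cauchy_seq_const\<close>)
  thus "\<pi> s \<otimes>\<^bsub>Q\<^esub> \<pi> (\<lambda>n. inverse (s n)) = \<one>\<^bsub>Q\<^esub>"
    using hom_mult[OF s(1) i] hom_one by simp
qed

lemma field_Q: "field Q"
proof -
  interpret h: ring_hom_ring R Q \<pi> by (rule hom_pi)
  interpret cring Q unfolding completion_def by (rule ideal.quotient_is_cring[OF ideal_N cring_R])
  show ?thesis
  proof (rule cring_fieldI2)
    have "\<pi> \<one>\<^bsub>R\<^esub> \<noteq> \<zero>\<^bsub>Q\<^esub>"
      by (subst pi_zero_iff) (auto simp: carrier_R cauchy_seq_const LIMSEQ_const_iff)
    thus "\<zero>\<^bsub>Q\<^esub> \<noteq> \<one>\<^bsub>Q\<^esub>" using h.hom_one by metis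
    fix a assume a: "a \<in> carrier Q" "a \<noteq> \<zero>\<^bsub>Q\<^esub>"
    then obtain s where s: "s \<in> carrier R" "a = \<pi> s" unfolding carrier_Q by auto
    show "\<exists>b\<in>carrier Q. a \<otimes>\<^bsub>Q\<^esub> b = \<one>\<^bsub>Q\<^esub>"
      using pi_inverse[of s] s a(2) unfolding carrier_Q by auto
  qed
qed

text \<open>
  All Cauchy sequences of a class differ by null sequences, so that the union in the definition of the
  natural map consists of a single class.
\<close>

lemma completion_map_image:
  "completion_map L w ` carrier (completion K v) = \<pi> ` RK"
proof -
  interpret KK: place_extension K K v v
    by unfold_locales (use nfK v in auto)
  have "completion_map L w (KK.\<pi> s) = \<pi> s" if s: "s \<in> RK" for s
  proof -
    interpret kr: ring_hom_ring "cauchy_ring K v" KK.Q KK.\<pi> by (rule KK.hom_pi)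
    have "\<pi> t = \<pi> s" if t: "t \<in> KK.\<pi> s" for t
    proof -
      obtain m where m: "m \<in> null_ideal K v" "t = (\<lambda>n. m n + s n)"
        using t unfolding a_r_coset_def' by (auto simp: cauchy_ring_def)
      have mK: "\<forall>n. m n \<in> K" "(\<lambda>n. place_norm v (m n)) \<longlonglongrightarrow> 0" using m(1) KK.mem_N by auto
      have "(\<lambda>n. g (m n)) \<longlonglongrightarrow> 0" using mK vw by simp
      moreover have "m \<in> RK" using m(1) by (simp add: null_ideal_def)
      hence tR: "t \<in> RK" using s m(2) kr.R.a_closed[of m s] by (simp add: cauchy_ring_def)
      ultimately show ?thesis using pi_eq_iff[of t s] tR s RK_subset m(2) by auto
    qed
    moreover have "s \<in> KK.\<pi> s"
    proof -
      have "(\<lambda>_. 0) \<in> null_ideal K v" by (simp add: KK.mem_N)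
      thus ?thesis unfolding a_r_coset_def' by (auto simp: cauchy_ring_def intro!: bexI[of _ "\<lambda>_. 0"])
    qed
    ultimately show ?thesis unfolding completion_map_def by (intro UN_constant_eq[of s]) blast+
  qed
  thus ?thesis unfolding KK.carrier_Q image_image by (rule image_cong[OF refl])
qed

lemma subfield_image: "subfield (\<pi> ` RK) Q"
proof -
  interpret Q: field Q by (rule field_Q)
  interpret h: ring_hom_ring R Q \<pi> by (rule hom_pi)
  have sub: "subring RK R"
  proof (rule h.R.subringI)
    show "RK \<subseteq> carrier R" by (rule RK_subset)
    show "\<one>\<^bsub>R\<^esub> \<in> RK" by (simp add: carrier_RK cauchy_seq_const)
    fix s assume s: "s \<in> RK"
    have sR: "s \<in> carrier R" using s RK_subset by blast
    show "\<ominus>\<^bsub>R\<^esub> s \<in> RK"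
      unfolding R_uminus[OF sR] using s sR cauchy_seq_uminus[of s]
      by (simp add: carrier_RK carrier_R K.uminus_mem)
    fix t assume t: "t \<in> RK"
    show "s \<otimes>\<^bsub>R\<^esub> t \<in> RK" "s \<oplus>\<^bsub>R\<^esub> t \<in> RK"
      using s t subsetD[OF RK_subset s] subsetD[OF RK_subset t] cauchy_seq_mult[of s t]
        cauchy_seq_add[of s t] by (simp_all add: carrier_RK carrier_R K.mult_mem K.add_mem)
  qed
  show ?thesis
  proof (rule Q.subfieldI')
    show "subring (\<pi> ` RK) Q" by (rule h.img_is_subring[OF sub])
    fix k assume k: "k \<in> \<pi> ` RK - {\<zero>\<^bsub>Q\<^esub>}"
    then obtain s where s: "s \<in> RK" "k = \<pi> s" by auto
    have sR: "s \<in> carrier R" using s RK_subset by auto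
    note inv = pi_inverse[OF sR]
    have "\<pi> (\<lambda>n. inverse (s n)) = inv\<^bsub>Q\<^esub> k"
      using inv k s Q.comm_inv_char[of k "\<pi> (\<lambda>n. inverse (s n))"] carrier_Q sR by auto
    moreover have "(\<lambda>n. inverse (s n)) \<in> RK" using inv(1) s k by (auto simp: carrier_RK carrier_R)
    ultimately show "inv\<^bsub>Q\<^esub> k \<in> \<pi> ` RK" by blast
  qed
qed

lemma sum_mem_R:
  assumes "\<And>i. i \<in> I \<Longrightarrow> k i \<in> RK" "\<And>i. i \<in> I \<Longrightarrow> x i \<in> L"
  shows "(\<lambda>m. \<Sum>i\<in>I. k i m * x i) \<in> carrier R"
  using assms
proof (induction I rule: infinite_finite_induct)
  case (insert i I)
  interpret cring R by (rule cring_R)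
  have "k i \<in> carrier R" "(\<lambda>_. x i) \<in> carrier R"
    using insert.prems subsetD[OF RK_subset, of "k i"] by (simp_all add: carrier_R cauchy_seq_const)
  hence "k i \<otimes>\<^bsub>R\<^esub> (\<lambda>_. x i) \<in> carrier R" by (rule m_closed)
  with insert have "(k i \<otimes>\<^bsub>R\<^esub> (\<lambda>_. x i)) \<oplus>\<^bsub>R\<^esub> (\<lambda>m. \<Sum>i\<in>I. k i m * x i) \<in> carrier R"
    by (intro a_closed) auto
  thus ?case using insert.hyps by simp
qed (simp_all add: carrier_R cauchy_seq_const)

lemma combine_eq:
  assumes "distinct is" "\<And>i. i \<in> set is \<Longrightarrow> k i \<in> RK" "\<And>i. i \<in> set is \<Longrightarrow> x i \<in> L"
  shows "ring.combine Q (map (\<lambda>i. \<pi> (k i)) is) (map (\<lambda>i. \<pi> (\<lambda>_. x i)) is) = \<pi> (\<lambda>m. \<Sum>i\<in>set is. k i m * x i)"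
  using assms
proof (induction "is")
  interpret h: ring_hom_ring R Q \<pi> by (rule hom_pi)
  case Nil
  show ?case using h.hom_zero by simp
next
  interpret h: ring_hom_ring R Q \<pi> by (rule hom_pi)
  case (Cons i "is")
  have c: "k i \<in> carrier R" "(\<lambda>_. x i) \<in> carrier R" "(\<lambda>m. \<Sum>i\<in>set is. k i m * x i) \<in> carrier R"
    using Cons.prems subsetD[OF RK_subset, of "k i"] sum_mem_R[of "set is" k x]
    by (simp_all add: carrier_R cauchy_seq_const)
  show ?case
    using Cons h.hom_mult[OF c(1,2)] h.hom_add[OF h.R.m_closed[OF c(1,2)] c(3)] by simp
qed

text \<open>
  A relation between the constant sequences \<open>x\<^sub>i\<close> over the completion of \<open>K\<close> is a sequence of combinations
  tending to 0, and strong independence makes its coefficients null sequences.  They span: the terms of a Cauchy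
  sequence are approximated better and better by elements of the \<open>K\<close>-span, and by strong independence the
  coefficients of the approximations form Cauchy sequences in \<open>K\<close>.
\<close>

theorem local_degree_eq_card_local_basis:
  assumes lb: "local_basis K L g I x"
  shows "local_degree K v L w = card I"
proof -
  interpret Q: field Q by (rule field_Q)
  interpret h: ring_hom_ring R Q \<pi> by (rule hom_pi)
  have finI: "finite I" and xL: "\<And>i. i \<in> I \<Longrightarrow> x i \<in> L" and si: "strongly_indep K g I x"
    and dense: "\<And>y e. y \<in> L \<Longrightarrow> e > 0 \<Longrightarrow> \<exists>z\<in>lin_span K I x. g (y - z) < e"
    using lb by (auto simp: local_basis_def)
  obtain "is" where is': "set is = I" "distinct is" using finite_distinct_list[OF finI] by blast
  obtain C where C: "C > 0" "\<forall>a. (\<forall>i\<in>I. a i \<in> K) \<longrightarrow> (\<forall>i\<in>I. g (a i) \<le> C * g (\<Sum>i\<in>I. a i * x i))"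
    using si unfolding strongly_indep_def by blast
  define F where "F = \<pi> ` RK"
  have F: "subfield F Q" unfolding F_def by (rule subfield_image)
  define Us where "Us = map (\<lambda>i. \<pi> (\<lambda>_. x i)) is"
  have Us: "set Us \<subseteq> carrier Q"
    using xL is' by (auto simp: Us_def carrier_Q carrier_R cauchy_seq_const)
  have comb: "Q.combine (map (\<lambda>i. \<pi> (k i)) is) Us = \<pi> (\<lambda>m. \<Sum>i\<in>I. k i m * x i)" if "\<And>i. i \<in> I \<Longrightarrow> k i \<in> RK" for k
    unfolding Us_def using combine_eq[OF is'(2), of k x] that xL is' by simp
  have coeffs: "\<exists>k. (\<forall>i\<in>I. k i \<in> RK) \<and> Ks = map (\<lambda>i. \<pi> (k i)) is"
    if Ks: "set Ks \<subseteq> F" "length Ks = length Us" for Ks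
  proof -
    have "\<forall>j\<in>{..<length is}. \<exists>s. s \<in> RK \<and> Ks ! j = \<pi> s"
    proof
      fix j assume "j \<in> {..<length is}"
      hence "Ks ! j \<in> F" using Ks by (auto simp: Us_def)
      thus "\<exists>s. s \<in> RK \<and> Ks ! j = \<pi> s" unfolding F_def by blast
    qed
    from bchoice[OF this] obtain s where s': "\<forall>j\<in>{..<length is}. s j \<in> RK \<and> Ks ! j = \<pi> (s j)" by blast
    hence s: "s j \<in> RK \<and> Ks ! j = \<pi> (s j)" if "j < length is" for j using that by blast
    \<comment> \<open>the coefficients, reindexed from positions in the list to \<open>I\<close>\<close>
    define k where "k i = s (THE j. j < length is \<and> is ! j = i)" for i
    have kj: "k (is ! j) = s j" if "j < length is" for j
    proof -
      have "(THE j'. j' < length is \<and> is ! j' = is ! j) = j"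
        by (rule the_equality) (use that is'(2) in \<open>auto simp: nth_eq_iff_index_eq\<close>)
      thus ?thesis by (simp add: k_def)
    qed
    have "\<forall>i\<in>I. k i \<in> RK" using kj s unfolding is'(1)[symmetric] by (auto simp: in_set_conv_nth)
    moreover have "Ks = map (\<lambda>i. \<pi> (k i)) is"
      using Ks(2) kj s by (intro nth_equalityI) (auto simp: Us_def)
    ultimately show ?thesis by blast
  qed
  have indep: "Q.independent F Us"
  proof (rule Q.trivial_combine_imp_independent[OF F Us])
    fix Ks assume Ks: "set Ks \<subseteq> F" "Q.combine Ks Us = \<zero>\<^bsub>Q\<^esub>"
    obtain Ks' where Ks': "set (take (length Us) Ks) \<subseteq> set Ks'"
      "set Ks' \<subseteq> set (take (length Us) Ks) \<union> {\<zero>\<^bsub>Q\<^esub>}" "length Ks' = length Us" "Q.combine Ks' Us = \<zero>\<^bsub>Q\<^esub>"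
      using Q.combine_normalize[OF _ Us Ks(2)] Ks(1) subfieldE(3)[OF F] by blast
    have "set Ks' \<subseteq> F"
      using Ks'(2) Ks(1) set_take_subset[of "length Us" Ks] subringE(2)[OF subfieldE(1)[OF F]] by blast
    then obtain k where k: "\<forall>i\<in>I. k i \<in> RK" "Ks' = map (\<lambda>i. \<pi> (k i)) is" using coeffs Ks'(3) by blast
    have kR: "k i \<in> RK" if "i \<in> I" for i using k that by blast
    have kK: "k i m \<in> K" if "i \<in> I" for i m using kR[OF that] by (simp add: carrier_RK)
    have "\<pi> (\<lambda>m. \<Sum>i\<in>I. k i m * x i) = \<zero>\<^bsub>Q\<^esub>" using comb[of k, OF kR] Ks'(4) k(2) by simp
    hence lim: "(\<lambda>m. g (\<Sum>i\<in>I. k i m * x i)) \<longlonglongrightarrow> 0"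
      by (subst (asm) pi_zero_iff) (use kR xL in \<open>auto intro: sum_mem_R\<close>)
    have "\<pi> (k i) = \<zero>\<^bsub>Q\<^esub>" if i: "i \<in> I" for i
    proof -
      have "(\<lambda>m. g (k i m)) \<longlonglongrightarrow> 0"
      proof (rule tendsto_sandwich[where f = "\<lambda>_. 0"])
        show "(\<lambda>m. C * g (\<Sum>i\<in>I. k i m * x i)) \<longlonglongrightarrow> 0"
          using tendsto_mult[OF tendsto_const[of C] lim] by simp
        have "g (k i m) \<le> C * g (\<Sum>i\<in>I. k i m * x i)" for m
          using C(2)[rule_format, of "\<lambda>i. k i m" i] kK i by blast
        thus "\<forall>\<^sub>F m in sequentially. g (k i m) \<le> C * g (\<Sum>i\<in>I. k i m * x i)" by simp
        show "\<forall>\<^sub>F m in sequentially. 0 \<le> g (k i m)"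
          using kK[OF i] KL by (intro always_eventually allI nonneg) auto
      qed auto
      thus ?thesis using pi_zero_iff[of "k i"] kR[OF i] RK_subset by auto
    qed
    hence "set Ks' \<subseteq> {\<zero>\<^bsub>Q\<^esub>}" using k(2) is'(1) by auto
    with Ks'(1) show "set (take (length Us) Ks) \<subseteq> {\<zero>\<^bsub>Q\<^esub>}" by blast
  qed
  have span: "Q.Span F Us = carrier Q"
  proof
    show "Q.Span F Us \<subseteq> carrier Q" using Q.Span_in_carrier[OF subfieldE(3)[OF F] Us] .
    show "carrier Q \<subseteq> Q.Span F Us"
    proof
      fix q assume "q \<in> carrier Q"
      then obtain s where s: "s \<in> carrier R" "q = \<pi> s" unfolding carrier_Q by auto
      have sL: "s m \<in> L" for m using s(1) by (simp add: carrier_R)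
      have "\<forall>m. \<exists>a. (\<forall>i\<in>I. a i \<in> K) \<and> g (s m - (\<Sum>i\<in>I. a i * x i)) < 1 / real (Suc m)"
      proof
        fix m
        have "1 / real (Suc m) > 0" by simp
        then obtain z where z: "z \<in> lin_span K I x" "g (s m - z) < 1 / real (Suc m)" using dense[OF sL] by blast
        obtain a where "\<forall>i\<in>I. a i \<in> K" "z = (\<Sum>i\<in>I. a i * x i)" by (rule lin_spanE[OF z(1)])
        thus "\<exists>a. (\<forall>i\<in>I. a i \<in> K) \<and> g (s m - (\<Sum>i\<in>I. a i * x i)) < 1 / real (Suc m)" using z(2) by blast
      qed
      from choice[OF this] obtain a where
        a: "\<forall>m. (\<forall>i\<in>I. a m i \<in> K) \<and> g (s m - (\<Sum>i\<in>I. a m i * x i)) < 1 / real (Suc m)" by blast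
      define z where "z m = (\<Sum>i\<in>I. a m i * x i)" for m
      have zL: "z m \<in> L" for m unfolding z_def using a xL KL by (intro sum_mem mult_mem) auto
      have lim: "(\<lambda>m. g (s m - z m)) \<longlonglongrightarrow> 0"
      proof (rule tendsto_sandwich[where f = "\<lambda>_. 0"])
        show "(\<lambda>m. 1 / real (Suc m)) \<longlonglongrightarrow> 0" using LIMSEQ_inverse_real_of_nat by (simp add: inverse_eq_divide)
        show "\<forall>\<^sub>F m in sequentially. g (s m - z m) \<le> 1 / real (Suc m)"
          using a unfolding z_def by (intro always_eventually allI less_imp_le) auto
        show "\<forall>\<^sub>F m in sequentially. 0 \<le> g (s m - z m)"
          using sL zL by (intro always_eventually allI nonneg diff_mem) auto
      qed auto
      have cz: "cauchy_seq g z"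
      proof -
        have "cauchy_seq g (\<lambda>m. s m - z m)" by (rule null_imp_cauchy_seq[OF _ lim]) (use sL zL in auto)
        hence "cauchy_seq g (\<lambda>m. s m + - (s m - z m))"
          using s(1) sL zL by (intro cauchy_seq_add cauchy_seq_uminus) (auto simp: carrier_R)
        thus ?thesis by simp
      qed
      have aK: "a m i \<in> K" if "i \<in> I" for m i using a that by blast
      have aR: "(\<lambda>m. a m i) \<in> RK" if i: "i \<in> I" for i
        unfolding carrier_RK cauchy_seq_def
      proof (intro conjI allI impI)
        show "a m i \<in> K" for m by (rule aK[OF i])
        fix e :: real assume "e > 0"
        hence "e / C > 0" using C(1) by simp
        then obtain M where M: "\<forall>m\<ge>M. \<forall>n\<ge>M. g (z m - z n) < e / C" using cz unfolding cauchy_seq_def by blast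
        have "g (a m i - a n i) < e" if "m \<ge> M" "n \<ge> M" for m n
        proof -
          have "g (a m i - a n i) \<le> C * g (\<Sum>i\<in>I. (a m i - a n i) * x i)"
            using C(2)[rule_format, of "\<lambda>i. a m i - a n i" i] aK i by blast
          also have "(\<Sum>i\<in>I. (a m i - a n i) * x i) = z m - z n"
            by (simp add: z_def left_diff_distrib sum_subtractf)
          also have "C * g (z m - z n) < C * (e / C)" using M that C(1) by (intro mult_strict_left_mono) auto
          finally show ?thesis using C(1) by simp
        qed
        thus "\<exists>N. \<forall>m\<ge>N. \<forall>n\<ge>N. g (a m i - a n i) < e" by blast
      qed
      have zR: "z \<in> carrier R" using zL cz by (simp add: carrier_R)
      have "q = \<pi> z" unfolding s(2) using pi_eq_iff[OF s(1) zR] lim by simp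
      also have "\<dots> = Q.combine (map (\<lambda>i. \<pi> (\<lambda>m. a m i)) is) Us"
        using comb[of "\<lambda>i m. a m i", OF aR] unfolding z_def[abs_def] by simp
      finally show "q \<in> Q.Span F Us"
        unfolding Q.Span_eq_combine_set_length_version[OF F Us]
        using aR is'(1) by (intro CollectI exI[of _ "map (\<lambda>i. \<pi> (\<lambda>m. a m i)) is"]) (auto simp: Us_def F_def)
    qed
  qed
  have "Q.dimension (length Us) F (carrier Q)" using Q.dimensionI[OF F indep span] .
  hence "Q.dim F (carrier Q) = length Us" using Q.dimI[OF F] by (simp add: over_def)
  also have "length Us = card I" using distinct_card[OF is'(2)] is'(1) by (simp add: Us_def)
  finally show ?thesis
    unfolding local_degree_def completion_map_image F_def .
qed

end

section \<open>Simple extensions and conjugates\<close>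

definition poly_over :: "Qbar set \<Rightarrow> Qbar poly set"
  where "poly_over K = {p. \<forall>i. poly.coeff p i \<in> K}"

definition simple_ext :: "Qbar set \<Rightarrow> Qbar \<Rightarrow> Qbar set"
  where "simple_ext K \<alpha> = (\<lambda>p. poly p \<alpha>) ` poly_over K"

context Qbar_subfield
begin

lemma poly_over_coeff [intro]: "p \<in> poly_over K \<Longrightarrow> poly.coeff p i \<in> K"
  by (simp add: poly_over_def)

lemma poly_over_0 [simp]: "0 \<in> poly_over K"
  and poly_over_1 [simp]: "1 \<in> poly_over K"
  by (auto simp: poly_over_def coeff_1)

lemma poly_over_add: "p \<in> poly_over K \<Longrightarrow> q \<in> poly_over K \<Longrightarrow> p + q \<in> poly_over K"
  and poly_over_diff: "p \<in> poly_over K \<Longrightarrow> q \<in> poly_over K \<Longrightarrow> p - q \<in> poly_over K"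
  and poly_over_uminus: "p \<in> poly_over K \<Longrightarrow> - p \<in> poly_over K"
  and poly_over_smult: "c \<in> K \<Longrightarrow> p \<in> poly_over K \<Longrightarrow> smult c p \<in> poly_over K"
  by (auto simp: poly_over_def)

lemma poly_over_mult: "p \<in> poly_over K \<Longrightarrow> q \<in> poly_over K \<Longrightarrow> p * q \<in> poly_over K"
  unfolding poly_over_def by (auto simp: coeff_mult intro!: sum_mem)

lemma poly_over_pCons: "pCons a p \<in> poly_over K \<longleftrightarrow> a \<in> K \<and> p \<in> poly_over K"
proof
  assume *: "pCons a p \<in> poly_over K"
  have "poly.coeff (pCons a p) (Suc i) \<in> K" for i using * by (simp only: poly_over_def) blast
  moreover have "poly.coeff (pCons a p) 0 \<in> K" using * by (simp only: poly_over_def) blast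
  ultimately show "a \<in> K \<and> p \<in> poly_over K" by (simp add: poly_over_def)
next
  assume "a \<in> K \<and> p \<in> poly_over K"
  thus "pCons a p \<in> poly_over K" by (auto simp: poly_over_def coeff_pCons split: nat.splits)
qed

lemma poly_over_prod: "(\<And>i. i \<in> I \<Longrightarrow> p i \<in> poly_over K) \<Longrightarrow> prod p I \<in> poly_over K"
  by (induction I rule: infinite_finite_induct) (auto intro: poly_over_mult)

lemma poly_over_pderiv: "p \<in> poly_over K \<Longrightarrow> pderiv p \<in> poly_over K"
  by (auto simp: poly_over_def coeff_pderiv intro!: mult_mem simp del: of_nat_Suc)

lemma poly_over_pcompose: "p \<in> poly_over K \<Longrightarrow> q \<in> poly_over K \<Longrightarrow> pcompose p q \<in> poly_over K"
  by (induction p) (auto simp: poly_over_pCons pcompose_pCons intro!: poly_over_add poly_over_mult)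

lemma poly_mem: "p \<in> poly_over K \<Longrightarrow> x \<in> K \<Longrightarrow> poly p x \<in> K"
  by (induction p) (auto simp: poly_over_pCons intro!: add_mem mult_mem)

lemma poly_over_division:
  assumes f: "f \<in> poly_over K" "Polynomial.lead_coeff f = 1" "Polynomial.degree f > 0" and p: "p \<in> poly_over K"
  shows "\<exists>q r. q \<in> poly_over K \<and> r \<in> poly_over K \<and> p = q * f + r \<and> Polynomial.degree r < Polynomial.degree f"
  using p
proof (induction p)
  case 0
  show ?case using f(3) by (intro exI[of _ 0]) auto
next
  case (pCons a p)
  let ?n = "Polynomial.degree f"
  have ap: "a \<in> K" "p \<in> poly_over K" using pCons.prems by (auto simp: poly_over_pCons)
  from pCons.IH[OF ap(2)] obtain q r where qr: "q \<in> poly_over K" "r \<in> poly_over K" "p = q * f + r"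
    "Polynomial.degree r < ?n" by blast
  define c where "c = poly.coeff (pCons a r) ?n"
  have c: "c \<in> K" unfolding c_def using qr(2) ap by (auto simp: coeff_pCons split: nat.splits)
  define r' where "r' = pCons a r - smult c f"
  have "Polynomial.degree (pCons a r) \<le> ?n" using qr(4) degree_pCons_le[of a r] by linarith
  hence le: "Polynomial.degree r' \<le> ?n" unfolding r'_def by (intro degree_diff_le) auto
  have "poly.coeff r' ?n = 0" unfolding r'_def using f(2) by (simp add: c_def)
  have "Polynomial.degree r' < ?n"
  proof (rule ccontr)
    assume "\<not> ?thesis"
    hence "Polynomial.degree r' = ?n" using le by simp
    with \<open>poly.coeff r' ?n = 0\<close> have "r' = 0" using leading_coeff_0_iff[of r'] by simp
    with \<open>Polynomial.degree r' = ?n\<close> f(3) show False by simp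
  qed
  moreover have "pCons a p = (pCons c q) * f + r'"
    unfolding qr(3) r'_def by simp
  moreover have "pCons c q \<in> poly_over K" using qr(1) c by (simp add: poly_over_pCons)
  moreover have "r' \<in> poly_over K" unfolding r'_def using qr(2) ap c f(1)
    by (intro poly_over_diff poly_over_smult) (auto simp: poly_over_pCons)
  ultimately show ?case by blast
qed

lemma algebraic: "\<exists>p\<in>poly_over K. p \<noteq> 0 \<and> poly p \<alpha> = 0"
proof -
  obtain p :: "rat poly" where p: "p \<noteq> 0" "poly (map_poly to_ac p) \<alpha> = 0"
    using alg_closure_algebraic by blast
  have "(to_ac r :: Qbar) \<in> K" for r
  proof -
    obtain a b where "r = of_int a / of_int b" by (metis Fract_of_int_quotient Rat_cases)
    hence "(to_ac r :: Qbar) = of_int a / of_int b" by simp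
    thus ?thesis by (simp add: divide_mem)
  qed
  hence "map_poly to_ac p \<in> poly_over K" by (simp add: poly_over_def coeff_map_poly)
  moreover have "map_poly to_ac p \<noteq> (0 :: Qbar poly)" using p(1) by (simp add: map_poly_eq_0_iff)
  ultimately show ?thesis using p(2) by blast
qed

end

locale minpoly = Qbar_subfield K for K +
  fixes \<alpha> :: Qbar and f :: "Qbar poly"
  assumes f_over: "f \<in> poly_over K" and f_monic: "Polynomial.lead_coeff f = 1" and f_root: "poly f \<alpha> = 0"
    and f_min: "p \<in> poly_over K \<Longrightarrow> poly p \<alpha> = 0 \<Longrightarrow> p \<noteq> 0 \<Longrightarrow> Polynomial.degree f \<le> Polynomial.degree p"

lemma (in Qbar_subfield) minpoly_exists: "\<exists>f. minpoly K \<alpha> f"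
proof -
  define P where "P n \<longleftrightarrow> (\<exists>p\<in>poly_over K. p \<noteq> 0 \<and> poly p \<alpha> = 0 \<and> Polynomial.degree p = n)" for n
  have "\<exists>n. P n" unfolding P_def using algebraic[of \<alpha>] by blast
  hence "P (LEAST n. P n)" by (rule LeastI_ex)
  then obtain p where p: "p \<in> poly_over K" "p \<noteq> 0" "poly p \<alpha> = 0" "Polynomial.degree p = (LEAST n. P n)"
    unfolding P_def by blast
  have lc: "Polynomial.lead_coeff p \<noteq> 0" using p(2) by simp
  define c where "c = inverse (Polynomial.lead_coeff p)"
  have c: "c \<in> K" "c \<noteq> 0" unfolding c_def using p(1) lc by auto
  have "minpoly K \<alpha> (smult c p)"
  proof
    show "smult c p \<in> poly_over K" using c p by (intro poly_over_smult) auto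
    show "Polynomial.lead_coeff (smult c p) = 1" using lc by (simp add: c_def)
    show "poly (smult c p) \<alpha> = 0" using p by simp
    fix q assume "q \<in> poly_over K" "poly q \<alpha> = 0" "q \<noteq> 0"
    hence "P (Polynomial.degree q)" unfolding P_def by blast
    hence "(LEAST n. P n) \<le> Polynomial.degree q" by (rule Least_le)
    thus "Polynomial.degree (smult c p) \<le> Polynomial.degree q" using p(4) c by simp
  qed
  thus ?thesis by blast
qed

context minpoly
begin

abbreviation d :: nat where "d \<equiv> Polynomial.degree f"

lemma f_nz: "f \<noteq> 0"
  using f_monic by auto

lemma d_pos: "d > 0"
proof (rule ccontr)
  assume "\<not> d > 0"
  hence "d = 0" by simp
  then obtain c where "f = [:c:]" by (rule degree_eq_zeroE)
  with f_monic f_root show False by simp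
qed

lemma dvd_of_root:
  assumes "p \<in> poly_over K" "poly p \<alpha> = 0"
  shows "\<exists>q\<in>poly_over K. p = q * f"
proof -
  obtain q r where qr: "q \<in> poly_over K" "r \<in> poly_over K" "p = q * f + r" "Polynomial.degree r < d"
    using poly_over_division[OF f_over f_monic d_pos assms(1)] by blast
  have "poly r \<alpha> = 0" using assms(2) f_root unfolding qr(3) by simp
  hence "r = 0" using f_min[OF qr(2)] qr(4) by fastforce
  thus ?thesis using qr by auto
qed

text \<open>
  If \<open>f\<close> were a proper multiple of the minimal polynomial \<open>h\<close> of its root \<open>\<beta>\<close>, one of the two factors would vanish at \<open>\<alpha>\<close>,
  although both have smaller degree than \<open>f\<close>.
\<close>

lemma minpoly_unique:
  assumes "minpoly K \<beta> h" "poly f \<beta> = 0"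
  shows "h = f"
proof -
  interpret h: minpoly K \<beta> h by fact
  obtain q where q: "q \<in> poly_over K" "f = q * h" using h.dvd_of_root[OF f_over assms(2)] by blast
  have qnz: "q \<noteq> 0" "h \<noteq> 0" using q f_nz by auto
  have deg: "d = Polynomial.degree q + h.d" unfolding q(2) using qnz by (rule degree_mult_eq)
  have "poly q \<alpha> \<noteq> 0" using f_min[OF q(1) _ qnz(1)] deg h.d_pos by auto
  hence "poly h \<alpha> = 0" using f_root unfolding q(2) by auto
  hence "d \<le> h.d" using f_min[OF h.f_over] qnz by blast
  hence "Polynomial.degree q = 0" using deg by simp
  then obtain c where c: "q = [:c:]" by (rule degree_eq_zeroE)
  have "Polynomial.lead_coeff f = Polynomial.lead_coeff q * Polynomial.lead_coeff h"
    unfolding q(2) by (rule lead_coeff_mult)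
  hence "c = 1" using f_monic h.f_monic c by simp
  thus ?thesis using q c by simp
qed

lemma minpoly_conjugate:
  assumes "poly f \<beta> = 0"
  shows "minpoly K \<beta> f"
  using minpoly_exists[of \<beta>] minpoly_unique[OF _ assms] by auto

lemma conjugate_root_iff:
  assumes "poly f \<beta> = 0" "p \<in> poly_over K"
  shows "poly p \<beta> = 0 \<longleftrightarrow> poly p \<alpha> = 0"
proof -
  interpret b: minpoly K \<beta> f by (rule minpoly_conjugate[OF assms(1)])
  show ?thesis using dvd_of_root[OF assms(2)] b.dvd_of_root[OF assms(2)] f_root assms(1) by auto
qed

definition conjugates :: "Qbar set" where "conjugates = {\<beta>. poly f \<beta> = 0}"

lemma finite_conjugates: "finite conjugates"
  unfolding conjugates_def by (rule poly_roots_finite[OF f_nz])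

text \<open>
  A double root of \<open>f\<close> would be a root of the derivative, hence \<open>\<alpha>\<close> would be one too; but the derivative has
  smaller degree and, in characteristic 0, is not zero.
\<close>

lemma f_eq_prod: "f = (\<Prod>\<beta>\<in>conjugates. [:- \<beta>, 1:])" and card_conjugates: "card conjugates = d"
proof -
  obtain A where A: "size A = d" "f = (\<Prod>x\<in>#A. [:- x, 1:])"
    using alg_closed_imp_factorization[OF f_nz] f_monic by auto
  have simple: "count A \<beta> \<le> 1" for \<beta>
  proof (rule ccontr)
    assume "\<not> count A \<beta> \<le> 1"
    hence "{#\<beta>, \<beta>#} \<subseteq># A"
      by (simp add: subseteq_mset_def)
    then obtain B where "A = {#\<beta>, \<beta>#} + B" by (metis subset_mset.add_diff_inverse)
    define l g where "l = [:- \<beta>, 1:]" and "g = (\<Prod>x\<in>#B. [:- x, 1:])"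
    have f2: "f = l * (l * g)" using A(2) \<open>A = {#\<beta>, \<beta>#} + B\<close> by (simp add: l_def g_def)
    have "poly l \<beta> = 0" by (simp add: l_def)
    hence "poly f \<beta> = 0" "poly (pderiv f) \<beta> = 0" unfolding f2 by (simp_all add: pderiv_mult)
    hence "poly (pderiv f) \<alpha> = 0" using conjugate_root_iff[OF _ poly_over_pderiv[OF f_over]] by blast
    moreover have "pderiv f \<noteq> 0" using d_pos by (simp add: pderiv_eq_0_iff)
    ultimately have "d \<le> Polynomial.degree (pderiv f)" using f_min poly_over_pderiv[OF f_over] by blast
    thus False using d_pos by (simp add: degree_pderiv)
  qed
  hence Aset: "A = mset_set (set_mset A)"
    by (intro multiset_eqI) (metis count_eq_zero_iff count_mset_set(1) count_mset_set(3) finite_set_mset le_antisym less_one not_le)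
  have "f = (\<Prod>\<beta>\<in>set_mset A. [:- \<beta>, 1:])" using A(2) Aset by (metis prod_unfold_prod_mset)
  moreover have "poly (\<Prod>x\<in>#A. [:- x, 1:]) z = 0 \<longleftrightarrow> z \<in># A" for z
    by (auto simp: poly_prod_mset)
  hence "conjugates = set_mset A" unfolding conjugates_def using A(2) by auto
  ultimately show "f = (\<Prod>\<beta>\<in>conjugates. [:- \<beta>, 1:])" by simp
  show "card conjugates = d" using A(1) Aset \<open>conjugates = set_mset A\<close> by (metis size_mset_set)
qed

lemma simple_ext_reduced:
  assumes "y \<in> simple_ext K \<alpha>"
  obtains p where "p \<in> poly_over K" "Polynomial.degree p < d" "y = poly p \<alpha>"
proof -
  obtain p where p: "p \<in> poly_over K" "y = poly p \<alpha>" using assms by (auto simp: simple_ext_def)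
  obtain q r where qr: "q \<in> poly_over K" "r \<in> poly_over K" "p = q * f + r" "Polynomial.degree r < d"
    using poly_over_division[OF f_over f_monic d_pos p(1)] by blast
  have "y = poly r \<alpha>" unfolding p(2) qr(3) using f_root by simp
  thus ?thesis using that qr by blast
qed

lemma simple_ext_poly: "p \<in> poly_over K \<Longrightarrow> poly p \<alpha> \<in> simple_ext K \<alpha>"
  by (simp add: simple_ext_def)

lemma simple_ext_base: "K \<subseteq> simple_ext K \<alpha>"
proof
  fix x assume "x \<in> K"
  thus "x \<in> simple_ext K \<alpha>" using simple_ext_poly[of "[:x:]"] by (simp add: poly_over_pCons)
qed

lemma simple_ext_generator: "\<alpha> \<in> simple_ext K \<alpha>"
  using simple_ext_poly[of "[:0, 1:]"] by (simp add: poly_over_pCons)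

text \<open>
  The constant term of the minimal polynomial of \<open>y \<noteq> 0\<close> is not 0, so that the minimal polynomial
  expresses the inverse of \<open>y\<close> as a polynomial in \<open>y\<close>.
\<close>

lemma simple_ext_subfield: "Qbar_subfield (simple_ext K \<alpha>)"
proof -
  have inv: "inverse y \<in> simple_ext K \<alpha>" if y: "y \<in> simple_ext K \<alpha>" for y
  proof (cases "y = 0")
    case True
    thus ?thesis using y by simp
  next
    case False
    obtain p where p: "p \<in> poly_over K" "y = poly p \<alpha>" using y by (auto simp: simple_ext_def)
    obtain h where "minpoly K y h" using minpoly_exists by blast
    then interpret h: minpoly K y h .
    obtain c h' where h: "h = pCons c h'" by (cases h)
    have ch: "c \<in> K" "h' \<in> poly_over K" using h.f_over unfolding h by (auto simp: poly_over_pCons)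
    have root: "c + y * poly h' y = 0" using h.f_root unfolding h by simp
    have "c \<noteq> 0"
    proof
      assume "c = 0"
      hence "poly h' y = 0" using root False by simp
      moreover have "h' \<noteq> 0" using h.f_nz h \<open>c = 0\<close> by auto
      ultimately have "h.d \<le> Polynomial.degree h'" using h.f_min ch by blast
      thus False unfolding h using \<open>h' \<noteq> 0\<close> by simp
    qed
    have "y * poly h' y = - c" using root by (simp add: add_eq_0_iff)
    hence "- inverse c * (y * poly h' y) = 1" using \<open>c \<noteq> 0\<close> by simp
    hence "y * (- inverse c * poly h' y) = 1" by (simp only: mult_ac)
    hence "inverse y = - inverse c * poly h' y" by (rule inverse_unique)
    also have "\<dots> = poly (smult (- inverse c) (pcompose h' p)) \<alpha>" by (simp add: poly_pcompose p(2))
    also have "\<dots> \<in> simple_ext K \<alpha>"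
      using ch p by (intro simple_ext_poly poly_over_smult poly_over_pcompose) auto
    finally show ?thesis .
  qed
  have "x + y \<in> simple_ext K \<alpha> \<and> x * y \<in> simple_ext K \<alpha>" if xy: "x \<in> simple_ext K \<alpha>" "y \<in> simple_ext K \<alpha>" for x y
  proof -
    obtain p where "p \<in> poly_over K" "x = poly p \<alpha>" using xy(1) by (auto simp: simple_ext_def)
    moreover obtain q where "q \<in> poly_over K" "y = poly q \<alpha>" using xy(2) by (auto simp: simple_ext_def)
    ultimately have pq: "p \<in> poly_over K" "x = poly p \<alpha>" "q \<in> poly_over K" "y = poly q \<alpha>" by auto
    show ?thesis using simple_ext_poly[of "p + q"] simple_ext_poly[of "p * q"] pq
      by (simp add: poly_over_add poly_over_mult)
  qed
  moreover have "- x \<in> simple_ext K \<alpha>" if x: "x \<in> simple_ext K \<alpha>" for x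
  proof -
    obtain p where p: "p \<in> poly_over K" "x = poly p \<alpha>" using x by (auto simp: simple_ext_def)
    show ?thesis using simple_ext_poly[of "- p"] p by (simp add: poly_over_uminus)
  qed
  moreover have "0 \<in> simple_ext K \<alpha>" "1 \<in> simple_ext K \<alpha>" using simple_ext_base by auto
  ultimately show ?thesis unfolding Qbar_subfield_def subfield_Qbar_iff using inv by blast
qed

lemma poly_eq_sum:
  fixes p :: "Qbar poly"
  shows "Polynomial.degree p < d \<Longrightarrow> poly p x = (\<Sum>k<d. poly.coeff p k * x ^ k)"
proof -
  assume "Polynomial.degree p < d"
  hence "(\<Sum>k\<le>Polynomial.degree p. poly.coeff p k * x ^ k) = (\<Sum>k<d. poly.coeff p k * x ^ k)"
    by (intro sum.mono_neutral_left) (auto simp: coeff_eq_0)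
  thus ?thesis by (simp add: Polynomial.poly_altdef)
qed

lemma powers_basis: "lin_indep K {..<d} (\<lambda>k. \<alpha> ^ k)" "lin_span K {..<d} (\<lambda>k. \<alpha> ^ k) = simple_ext K \<alpha>"
proof -
  show "lin_span K {..<d} (\<lambda>k. \<alpha> ^ k) = simple_ext K \<alpha>"
  proof
    interpret L: Qbar_subfield "simple_ext K \<alpha>" by (rule simple_ext_subfield)
    show "lin_span K {..<d} (\<lambda>k. \<alpha> ^ k) \<subseteq> simple_ext K \<alpha>"
      using simple_ext_base simple_ext_generator by (auto simp: lin_span_def intro!: L.sum_mem L.mult_mem L.power_mem)
    show "simple_ext K \<alpha> \<subseteq> lin_span K {..<d} (\<lambda>k. \<alpha> ^ k)"
    proof
      fix y assume "y \<in> simple_ext K \<alpha>"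
      then obtain p where p: "p \<in> poly_over K" "Polynomial.degree p < d" "y = poly p \<alpha>" by (rule simple_ext_reduced)
      show "y \<in> lin_span K {..<d} (\<lambda>k. \<alpha> ^ k)"
        unfolding lin_span_def p(3) poly_eq_sum[OF p(2)] using p(1)
        by (intro CollectI exI[of _ "poly.coeff p"]) auto
    qed
  qed
  show "lin_indep K {..<d} (\<lambda>k. \<alpha> ^ k)"
    unfolding lin_indep_def
  proof (intro allI impI, elim conjE)
    fix a assume a: "\<forall>k\<in>{..<d}. a k \<in> K" "(\<Sum>k<d. a k * \<alpha> ^ k) = 0"
    define p where "p = (\<Sum>k<d. Polynomial.monom (a k) k)"
    have cf: "poly.coeff p i = (if i < d then a i else 0)" for i
      unfolding p_def by (simp add: coeff_sum)
    have "p \<in> poly_over K" unfolding poly_over_def using a(1) by (simp add: cf)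
    moreover have "poly p \<alpha> = 0" unfolding p_def using a(2) by (simp add: poly_sum poly_monom)
    moreover have "p = 0 \<or> Polynomial.degree p < d"
    proof -
      have "Polynomial.degree p \<le> d - 1" by (rule degree_le) (auto simp: cf)
      thus ?thesis using d_pos by linarith
    qed
    ultimately have "p = 0" using f_min[of p] by (meson not_le)
    thus "\<forall>k\<in>{..<d}. a k = 0" using cf by (metis coeff_0 lessThan_iff)
  qed
qed

lemma simple_ext_finite: "finite_extension K (simple_ext K \<alpha>)"
  by (rule finite_extensionI[OF Qbar_subfield_axioms simple_ext_subfield simple_ext_base _ powers_basis(2)]) simp

lemma simple_ext_degree: "ext_degree K (simple_ext K \<alpha>) = d"
  using ext_degree_eq_card_basis[OF Qbar_subfield_axioms _ powers_basis] by simp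

lemma simple_ext_subset:
  assumes "Qbar_subfield M" "K \<subseteq> M" "\<alpha> \<in> M"
  shows "simple_ext K \<alpha> \<subseteq> M"
proof -
  interpret M: Qbar_subfield M by fact
  have "poly_over K \<subseteq> poly_over M" using assms(2) by (auto simp: poly_over_def)
  thus ?thesis using M.poly_mem assms(3) by (auto simp: simple_ext_def)
qed

text \<open>
  The isomorphism \<open>K(\<alpha>) \<rightarrow> K(\<beta>)\<close> over \<open>K\<close> with \<open>\<alpha> \<mapsto> \<beta>\<close>: any polynomial representing \<open>y\<close> may be evaluated
  at \<open>\<beta>\<close>.
\<close>

definition conj_map :: "Qbar \<Rightarrow> Qbar \<Rightarrow> Qbar"
  where "conj_map \<beta> y = poly (SOME p. p \<in> poly_over K \<and> poly p \<alpha> = y) \<beta>"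

lemma conj_map_poly:
  assumes "\<beta> \<in> conjugates" "p \<in> poly_over K"
  shows "conj_map \<beta> (poly p \<alpha>) = poly p \<beta>"
proof -
  define q where "q = (SOME q. q \<in> poly_over K \<and> poly q \<alpha> = poly p \<alpha>)"
  have q: "q \<in> poly_over K" "poly q \<alpha> = poly p \<alpha>"
    using someI[of "\<lambda>q. q \<in> poly_over K \<and> poly q \<alpha> = poly p \<alpha>" p] assms(2) by (auto simp: q_def)
  have "poly (q - p) \<beta> = 0"
    using conjugate_root_iff[of \<beta> "q - p"] assms q by (auto simp: conjugates_def poly_over_diff)
  thus ?thesis by (simp add: conj_map_def flip: q_def)
qed

lemma conj_map_hom:
  assumes b: "\<beta> \<in> conjugates" and x: "x \<in> simple_ext K \<alpha>" and y: "y \<in> simple_ext K \<alpha>"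
  shows "conj_map \<beta> (x + y) = conj_map \<beta> x + conj_map \<beta> y"
    and "conj_map \<beta> (x * y) = conj_map \<beta> x * conj_map \<beta> y"
    and "conj_map \<beta> x = 0 \<longleftrightarrow> x = 0"
    and "conj_map \<beta> x \<in> simple_ext K \<beta>"
proof -
  obtain p where p: "p \<in> poly_over K" "x = poly p \<alpha>" using x by (auto simp: simple_ext_def)
  obtain q where q: "q \<in> poly_over K" "y = poly q \<alpha>" using y by (auto simp: simple_ext_def)
  show "conj_map \<beta> (x + y) = conj_map \<beta> x + conj_map \<beta> y"
    using conj_map_poly[OF b, of "p + q"] conj_map_poly[OF b p(1)] conj_map_poly[OF b q(1)] p q
    by (simp add: poly_over_add)
  show "conj_map \<beta> (x * y) = conj_map \<beta> x * conj_map \<beta> y"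
    using conj_map_poly[OF b, of "p * q"] conj_map_poly[OF b p(1)] conj_map_poly[OF b q(1)] p q
    by (simp add: poly_over_mult)
  show "conj_map \<beta> x = 0 \<longleftrightarrow> x = 0"
    using conj_map_poly[OF b p(1)] conjugate_root_iff[OF _ p(1), of \<beta>] b p(2) by (simp add: conjugates_def)
  show "conj_map \<beta> x \<in> simple_ext K \<beta>"
    using conj_map_poly[OF b p(1)] p by (auto simp: simple_ext_def)
qed

lemma conj_map_base: "\<beta> \<in> conjugates \<Longrightarrow> x \<in> K \<Longrightarrow> conj_map \<beta> x = x"
  using conj_map_poly[of \<beta> "[:x:]"] by (simp add: poly_over_pCons)

lemma conj_map_generator: "\<beta> \<in> conjugates \<Longrightarrow> conj_map \<beta> \<alpha> = \<beta>"
  using conj_map_poly[of \<beta> "[:0, 1:]"] by (simp add: poly_over_pCons)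

lemma conj_map_surj:
  assumes b: "\<beta> \<in> conjugates" and "y \<in> simple_ext K \<beta>"
  shows "\<exists>x\<in>simple_ext K \<alpha>. conj_map \<beta> x = y"
proof -
  obtain p where p: "p \<in> poly_over K" "y = poly p \<beta>" using assms(2) by (auto simp: simple_ext_def)
  thus ?thesis using conj_map_poly[OF b p(1)] by (intro bexI[of _ "poly p \<alpha>"]) (auto simp: simple_ext_def)
qed

end

section \<open>Extension of absolute values\<close>

text \<open>
  The extension is found among the submultiplicative norms of \<open>L\<close> that extend \<open>v\<close>: a minimal one is
  multiplicative.  Norms are 0 outside of \<open>L\<close>, so that they are determined by
  their values on \<open>L\<close>.
\<close>

locale submult_norms = L: Qbar_subfield L + F: abs_value F v for L F v +
  assumes FL: "F \<subseteq> L"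
begin

definition norms :: "(Qbar \<Rightarrow> real) set"
  where "norms = {p. (\<forall>x. x \<notin> L \<longrightarrow> p x = 0) \<and> (\<forall>x\<in>L. 0 \<le> p x) \<and> (\<forall>a\<in>F. p a = v a) \<and>
    (\<forall>x\<in>L. \<forall>y\<in>L. p (x + y) \<le> p x + p y) \<and> (\<forall>x\<in>L. \<forall>y\<in>L. p (x * y) \<le> p x * p y)}"

lemma normsD:
  assumes "p \<in> norms"
  shows "x \<notin> L \<Longrightarrow> p x = 0" "0 \<le> p x" "a \<in> F \<Longrightarrow> p a = v a"
    "x \<in> L \<Longrightarrow> y \<in> L \<Longrightarrow> p (x + y) \<le> p x + p y" "x \<in> L \<Longrightarrow> y \<in> L \<Longrightarrow> p (x * y) \<le> p x * p y"
proof -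
  show "0 \<le> p x" using assms unfolding norms_def by (cases "x \<in> L") auto
qed (use assms in \<open>auto simp: norms_def\<close>)

lemma norms_one: "p \<in> norms \<Longrightarrow> p 1 = 1"
  using normsD(3)[of p 1] by simp

lemma norms_power_le: "p \<in> norms \<Longrightarrow> x \<in> L \<Longrightarrow> p (x ^ n) \<le> p x ^ n"
proof (induction n)
  case (Suc n)
  have "p (x * x ^ n) \<le> p x * p (x ^ n)" using Suc.prems by (intro normsD) auto
  also have "\<dots> \<le> p x * p x ^ n" using Suc normsD(2) by (intro mult_left_mono) auto
  finally show ?case by simp
qed (simp add: norms_one)

lemma norms_scale:
  assumes p: "p \<in> norms" and a: "a \<in> F" and x: "x \<in> L"
  shows "p (a * x) = v a * p x"
proof (cases "a = 0")
  case True
  thus ?thesis using normsD(3)[OF p, of 0] by simp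
next
  case False
  have aL: "a \<in> L" "inverse a \<in> L" using a FL by auto
  have "p (a * x) \<le> v a * p x" using normsD(5)[OF p aL(1) x] normsD(3)[OF p a] by simp
  moreover have "p x \<le> inverse (v a) * p (a * x)"
    using normsD(5)[OF p aL(2) L.mult_mem[OF aL(1) x]] normsD(3)[OF p F.inverse_mem[OF a]] False
    by (simp add: F.inverse[OF a] mult.assoc[symmetric])
  ultimately show ?thesis using F.pos[OF a False] by (simp add: field_simps)
qed

text \<open>Of any two norms in the chain one is smaller, and with it inequalities that involve two values pass to the infimum.\<close>

lemma chain_lower_bound:
  assumes C: "C \<subseteq> norms" "C \<noteq> {}" and chain: "\<And>p q. p \<in> C \<Longrightarrow> q \<in> C \<Longrightarrow> p \<le> q \<or> q \<le> p"
  shows "(\<lambda>x. INF p\<in>C. p x) \<in> norms"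
proof -
  define u where "u x = (INF p\<in>C. p x)" for x
  have bdd: "bdd_below ((\<lambda>p. p x) ` C)" for x
    by (rule bdd_belowI[of _ 0]) (use C(1) normsD(2) in auto)
  have le: "u x \<le> p x" if "p \<in> C" for p x unfolding u_def using bdd that by (intro cINF_lower) auto
  have ge: "c \<le> u x" if "\<And>p. p \<in> C \<Longrightarrow> c \<le> p x" for c x unfolding u_def using C(2) that by (intro cINF_greatest) auto
  have const: "u x = c" if "\<And>p. p \<in> C \<Longrightarrow> p x = c" for x c
  proof -
    have "(\<lambda>p. p x) ` C = {c}" using C(2) that by auto
    thus ?thesis by (simp add: u_def)
  qed
  have n: "0 \<le> u x" for x using C(1) normsD(2) by (intro ge) auto
  have "u (x + y) \<le> u x + u y" if xy: "x \<in> L" "y \<in> L" for x y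
  proof -
    have *: "u (x + y) \<le> p x + q y" if pq: "p \<in> C" "q \<in> C" for p q
    proof -
      obtain r where r: "r \<in> C" "r \<le> p" "r \<le> q" using chain[OF pq] pq by blast
      have "u (x + y) \<le> r (x + y)" using le r by blast
      also have "\<dots> \<le> r x + r y" using C(1) r xy normsD(4) by blast
      also have "\<dots> \<le> p x + q y" using r by (intro add_mono) (auto simp: le_fun_def)
      finally show ?thesis .
    qed
    have "u (x + y) - q y \<le> u x" if "q \<in> C" for q
      by (rule ge) (use *[OF _ that] in \<open>simp add: algebra_simps\<close>)
    hence "u (x + y) - u x \<le> u y" by (intro ge) (simp add: algebra_simps)
    thus ?thesis by simp
  qed
  moreover have "u (x * y) \<le> u x * u y" if xy: "x \<in> L" "y \<in> L" for x y
  proof -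
    have *: "u (x * y) \<le> p x * q y" if pq: "p \<in> C" "q \<in> C" for p q
    proof -
      obtain r where r: "r \<in> C" "r \<le> p" "r \<le> q" using chain[OF pq] pq by blast
      have "u (x * y) \<le> r (x * y)" using le r by blast
      also have "\<dots> \<le> r x * r y" using C(1) r xy normsD(5) by blast
      also have "\<dots> \<le> p x * q y" using r C(1) normsD(2) pq
        by (intro mult_mono) (auto simp: le_fun_def)
      finally show ?thesis .
    qed
    have **: "u (x * y) \<le> u x * q y" if q: "q \<in> C" for q
    proof (cases "q y = 0")
      case True
      obtain p where "p \<in> C" using C(2) by blast
      thus ?thesis using *[OF _ q] True by fastforce
    next
      case False
      hence pos: "q y > 0" using normsD(2)[of q y] q C(1) by (auto simp: less_le)
      have "u (x * y) / q y \<le> u x" by (rule ge) (use *[OF _ q] pos in \<open>simp add: field_simps\<close>)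
      thus ?thesis using pos by (simp add: field_simps)
    qed
    show ?thesis
    proof (cases "u x = 0")
      case True
      obtain q where "q \<in> C" using C(2) by blast
      thus ?thesis using ** True by fastforce
    next
      case False
      hence pos: "u x > 0" using n[of x] by simp
      have "u (x * y) / u x \<le> u y" by (rule ge) (use ** pos in \<open>simp add: field_simps\<close>)
      thus ?thesis using pos by (simp add: field_simps)
    qed
  qed
  moreover have "\<forall>x. x \<notin> L \<longrightarrow> u x = 0" using C(1) normsD(1) by (intro allI impI const) auto
  moreover have "\<forall>a\<in>F. u a = v a" using C(1) normsD(3) by (intro ballI const) auto
  ultimately have "u \<in> norms" using n by (simp add: norms_def)
  thus ?thesis by (simp add: u_def[abs_def])
qed

lemma minimal_norm_exists:
  assumes "norms \<noteq> {}"
  shows "\<exists>m\<in>norms. \<forall>p\<in>norms. p \<le> m \<longrightarrow> p = m"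
proof -
  have po: "partial_order_on norms (relation_of (\<lambda>p q. q \<le> p) norms)"
    by (rule partial_order_on_relation_ofI) auto
  have "\<exists>u\<in>norms. \<forall>p\<in>C. u \<le> p" if C: "C \<in> Chains (relation_of (\<lambda>p q. q \<le> p) norms)" for C
  proof (cases "C = {}")
    case True
    thus ?thesis using assms by auto
  next
    case False
    have sub: "C \<subseteq> norms" using C by (auto simp: Chains_def relation_of_def)
    have chain: "p \<le> q \<or> q \<le> p" if "p \<in> C" "q \<in> C" for p q
      using C that by (auto simp: Chains_def relation_of_def)
    have "(INF p\<in>C. p x) \<le> p x" if "p \<in> C" for p x
      by (rule cINF_lower[OF _ that], rule bdd_belowI[of _ 0]) (use sub normsD(2) in auto)
    thus ?thesis using chain_lower_bound[OF sub False chain]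
      by (intro bexI[of _ "\<lambda>x. INF p\<in>C. p x"]) (auto simp: le_fun_def)
  qed
  from predicate_Zorn[OF po this] show ?thesis by auto
qed

text \<open>
  The infimum of this set is the spectral radius \<open>lim p(x\<^sup>n)\<^bsup>1/n\<^esup>\<close>.  Growth bounds are easier to add and multiply
  than limits.  The spectral radius is a norm below \<open>p\<close>, so that it coincides with a minimal \<open>p\<close>.
\<close>

definition growth :: "(Qbar \<Rightarrow> real) \<Rightarrow> Qbar \<Rightarrow> real set"
  where "growth p x = {a. a > 0 \<and> (\<exists>C>0. \<forall>n. p (x ^ n) \<le> C * a ^ n)}"

lemma growth_upper: "p \<in> norms \<Longrightarrow> x \<in> L \<Longrightarrow> a > 0 \<Longrightarrow> p x \<le> a \<Longrightarrow> a \<in> growth p x"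
proof -
  assume p: "p \<in> norms" and x: "x \<in> L" and a: "a > 0" "p x \<le> a"
  have "p (x ^ n) \<le> 1 * a ^ n" for n
    using norms_power_le[OF p x, of n] power_mono[OF a(2) normsD(2)[OF p], of n] by simp
  thus ?thesis unfolding growth_def using a by (intro CollectI conjI exI[of _ 1]) auto
qed

lemma growth_add:
  assumes p: "p \<in> norms" and x: "x \<in> L" and y: "y \<in> L" and a: "a \<in> growth p x" and b: "b \<in> growth p y"
  shows "a + b \<in> growth p (x + y)"
proof -
  obtain A where A: "A > 0" "\<And>n. p (x ^ n) \<le> A * a ^ n" using a by (auto simp: growth_def)
  obtain B where B: "B > 0" "\<And>n. p (y ^ n) \<le> B * b ^ n" using b by (auto simp: growth_def)
  have ab: "a > 0" "b > 0" using a b by (auto simp: growth_def)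
  have psum: "p (\<Sum>i\<in>I. z i) \<le> (\<Sum>i\<in>I. p (z i))" if "finite I" "\<And>i. i \<in> I \<Longrightarrow> z i \<in> L" for I :: "nat set" and z
    using that
  proof (induction I rule: finite_induct)
    case empty
    thus ?case using normsD(3)[OF p, of 0] by simp
  next
    case (insert i I)
    have "p (z i + sum z I) \<le> p (z i) + p (sum z I)" using insert by (intro normsD(4)[OF p] L.sum_mem) auto
    thus ?case using insert by fastforce
  qed
  have nat: "p (of_nat m) \<le> real m" for m
    using normsD(3)[OF p F.of_nat_mem] F.of_nat_le by simp
  have "p ((x + y) ^ n) \<le> (A * B) * (a + b) ^ n" for n
  proof -
    have "p ((x + y) ^ n) = p (\<Sum>k\<le>n. of_nat (n choose k) * x ^ k * y ^ (n - k))" by (simp add: binomial_ring)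
    also have "\<dots> \<le> (\<Sum>k\<le>n. p (of_nat (n choose k) * x ^ k * y ^ (n - k)))"
      by (intro psum L.mult_mem L.power_mem x y) auto
    also have "\<dots> \<le> (\<Sum>k\<le>n. (A * B) * (of_nat (n choose k) * a ^ k * b ^ (n - k)))"
    proof (rule sum_mono)
      fix k assume "k \<in> {..n}"
      have xk: "x ^ k \<in> L" "y ^ (n - k) \<in> L" "of_nat (n choose k) * x ^ k \<in> L" using x y by auto
      have "p (of_nat (n choose k) * x ^ k * y ^ (n - k)) \<le> p (of_nat (n choose k) * x ^ k) * p (y ^ (n - k))"
        by (rule normsD(5)[OF p xk(3,2)])
      also have "\<dots> \<le> (real (n choose k) * (A * a ^ k)) * (B * b ^ (n - k))"
      proof (rule mult_mono)
        have "p (of_nat (n choose k) * x ^ k) \<le> p (of_nat (n choose k)) * p (x ^ k)"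
          by (rule normsD(5)[OF p _ xk(1)]) auto
        also have "\<dots> \<le> real (n choose k) * (A * a ^ k)"
          using nat A normsD(2)[OF p] by (intro mult_mono) auto
        finally show "p (of_nat (n choose k) * x ^ k) \<le> real (n choose k) * (A * a ^ k)" .
      qed (use A B ab normsD(2)[OF p] in auto)
      finally show "p (of_nat (n choose k) * x ^ k * y ^ (n - k))
          \<le> (A * B) * (of_nat (n choose k) * a ^ k * b ^ (n - k))" by (simp add: mult_ac)
    qed
    also have "\<dots> = (A * B) * (a + b) ^ n" by (simp only: binomial_ring sum_distrib_left)
    finally show ?thesis .
  qed
  moreover have "A * B > 0" using A B by simp
  ultimately show ?thesis using ab unfolding growth_def by (intro CollectI conjI exI[of _ "A * B"]) auto
qed

lemma growth_mult:
  assumes p: "p \<in> norms" and x: "x \<in> L" and y: "y \<in> L" and a: "a \<in> growth p x" and b: "b \<in> growth p y"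
  shows "a * b \<in> growth p (x * y)"
proof -
  obtain A where A: "A > 0" "\<And>n. p (x ^ n) \<le> A * a ^ n" using a by (auto simp: growth_def)
  obtain B where B: "B > 0" "\<And>n. p (y ^ n) \<le> B * b ^ n" using b by (auto simp: growth_def)
  have ab: "a > 0" "b > 0" using a b by (auto simp: growth_def)
  have "p ((x * y) ^ n) \<le> (A * B) * (a * b) ^ n" for n
  proof -
    have "p ((x * y) ^ n) \<le> p (x ^ n) * p (y ^ n)"
      unfolding power_mult_distrib using x y by (intro normsD(5)[OF p]) auto
    also have "\<dots> \<le> (A * a ^ n) * (B * b ^ n)" using A B ab normsD(2)[OF p] by (intro mult_mono) auto
    finally show ?thesis by (simp add: power_mult_distrib mult_ac)
  qed
  moreover have "A * B > 0" using A B by simp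
  ultimately show ?thesis using ab unfolding growth_def by (intro CollectI conjI exI[of _ "A * B"]) auto
qed

lemma growth_norm:
  assumes p: "p \<in> norms"
  defines "s \<equiv> (\<lambda>x. if x \<in> L then Inf (growth p x) else 0)"
  shows "s \<in> norms" "s \<le> p"
proof -
  have ne: "growth p x \<noteq> {}" if "x \<in> L" for x
    using growth_upper[OF p that, of "p x + 1"] normsD(2)[OF p, of x] by fastforce
  have bdd: "bdd_below (growth p x)" for x by (rule bdd_belowI[of _ 0]) (auto simp: growth_def)
  have le: "s x \<le> a" if "a \<in> growth p x" "x \<in> L" for x a
    using cInf_lower[OF that(1) bdd] that(2) by (simp add: s_def)
  have ge: "c \<le> s x" if "\<And>a. a \<in> growth p x \<Longrightarrow> c \<le> a" "x \<in> L" for x c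
    using cInf_greatest[OF ne[OF that(2)], of c] that by (simp add: s_def)
  have n: "0 \<le> s x" if "x \<in> L" for x using that by (intro ge) (auto simp: growth_def)
  have sp: "s x \<le> p x" if x: "x \<in> L" for x
  proof (rule field_le_epsilon)
    fix e :: real assume "e > 0"
    thus "s x \<le> p x + e" using normsD(2)[OF p, of x] by (intro le growth_upper p x) auto
  qed
  thus "s \<le> p" using normsD(1)[OF p] by (auto simp: le_fun_def s_def)
  have "s (x + y) \<le> s x + s y" if xy: "x \<in> L" "y \<in> L" for x y
  proof -
    have *: "s (x + y) \<le> a + b" if "a \<in> growth p x" "b \<in> growth p y" for a b
      using growth_add[OF p xy that] xy by (intro le) auto
    have "s (x + y) - b \<le> s x" if "b \<in> growth p y" for b
      using *[OF _ that] xy by (intro ge) (simp_all add: algebra_simps)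
    hence "s (x + y) - s x \<le> s y" using xy by (intro ge) (simp_all add: algebra_simps)
    thus ?thesis by simp
  qed
  moreover have "s (x * y) \<le> s x * s y" if xy: "x \<in> L" "y \<in> L" for x y
  proof -
    have *: "s (x * y) \<le> a * b" if "a \<in> growth p x" "b \<in> growth p y" for a b
      using growth_mult[OF p xy that] xy by (intro le) auto
    have **: "s (x * y) \<le> s x * b" if b: "b \<in> growth p y" for b
    proof -
      have b0: "b > 0" using b by (simp add: growth_def)
      have "s (x * y) / b \<le> s x" using *[OF _ b] b0 xy by (intro ge) (simp_all add: field_simps)
      thus ?thesis using b0 by (simp add: field_simps)
    qed
    show ?thesis
    proof (cases "s x = 0")
      case True
      obtain b where "b \<in> growth p y" using ne xy by blast
      thus ?thesis using ** True by fastforce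
    next
      case False
      hence pos: "s x > 0" using n[OF xy(1)] by simp
      have "s (x * y) / s x \<le> s y" using ** pos xy by (intro ge) (simp_all add: field_simps)
      thus ?thesis using pos by (simp add: field_simps)
    qed
  qed
  moreover have "s a = v a" if a: "a \<in> F" for a
  proof (rule antisym)
    have aL: "a \<in> L" using a FL by auto
    show "s a \<le> v a" using sp[OF aL] normsD(3)[OF p a] by simp
    show "v a \<le> s a"
    proof (rule ge[OF _ aL])
      fix b assume b: "b \<in> growth p a"
      then obtain C where C: "b > 0" "\<And>n. p (a ^ n) \<le> C * b ^ n" by (auto simp: growth_def)
      show "v a \<le> b"
      proof (rule power_bound_linear_factor_imp_le)
        show "v a ^ n \<le> (0 * real n + C) * b ^ n" for n
          using C(2)[of n] normsD(3)[OF p F.power_mem[OF a]] F.power[OF a] by simp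
      qed (use F.nonneg[OF a] C in auto)
    qed
  qed
  ultimately show "s \<in> norms" using n by (auto simp: norms_def s_def)
qed

context
  fixes p :: "Qbar \<Rightarrow> real"
  assumes p: "p \<in> norms" and minimal: "\<And>q. q \<in> norms \<Longrightarrow> q \<le> p \<Longrightarrow> q = p"
begin

lemma minimal_pos: "y \<in> L \<Longrightarrow> y \<noteq> 0 \<Longrightarrow> p y > 0"
proof -
  assume y: "y \<in> L" "y \<noteq> 0"
  have "p 1 \<le> p y * p (inverse y)" using normsD(5)[OF p y(1) L.inverse_mem[OF y(1)]] y(2) by simp
  hence "p y \<noteq> 0" using norms_one[OF p] by auto
  thus ?thesis using normsD(2)[OF p, of y] by simp
qed

text \<open>
  If \<open>p (y\<^sup>n) < (p y)\<^sup>n\<close> for some \<open>n\<close>, the powers of \<open>y\<close> grow more slowly than those of \<open>p y\<close>,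
  and the growth rate would be a smaller norm.
\<close>

lemma minimal_power: "y \<in> L \<Longrightarrow> p (y ^ n) = p y ^ n"
proof (rule ccontr)
  assume y: "y \<in> L" and neq: "p (y ^ n) \<noteq> p y ^ n"
  hence less: "p (y ^ n) < p y ^ n" using norms_power_le[OF p y, of n] by simp
  have n: "n > 0" using neq norms_one[OF p] by (intro Nat.gr0I) auto
  have y0: "y \<noteq> 0"
  proof
    assume "y = 0"
    thus False using neq n normsD(3)[OF p, of 0] by (simp add: power_0_left)
  qed
  have py: "p y > 0" by (rule minimal_pos[OF y y0])
  have pyn: "p (y ^ n) > 0" using y y0 by (intro minimal_pos) auto
  \<comment> \<open>the smaller growth rate; \<open>C\<close> accounts for the exponents that are not multiples of \<open>n\<close>\<close>
  define c where "c = root n (p (y ^ n))"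
  have c: "c > 0" "c ^ n = p (y ^ n)" unfolding c_def using n pyn by auto
  have cy: "c < p y" using less c n py by (metis less_eq_real_def linorder_not_le power_mono)
  define C where "C = (\<Sum>r<n. p (y ^ r) / c ^ r) + 1"
  have C: "C > 0" unfolding C_def using normsD(2)[OF p] c by (intro add_nonneg_pos sum_nonneg) auto
  have "p (y ^ m) \<le> C * c ^ m" for m
  proof -
    define k r where "k = m div n" and "r = m mod n"
    have m: "m = n * k + r" "r < n" using n by (simp_all add: k_def r_def)
    have "p (y ^ m) = p ((y ^ n) ^ k * y ^ r)" by (simp add: m(1) power_add power_mult)
    also have "\<dots> \<le> p ((y ^ n) ^ k) * p (y ^ r)" using y by (intro normsD(5)[OF p]) auto
    also have "\<dots> \<le> p (y ^ n) ^ k * p (y ^ r)"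
      using y normsD(2)[OF p] by (intro mult_right_mono norms_power_le[OF p]) auto
    also have "p (y ^ n) ^ k = c ^ (n * k)" by (simp add: power_mult c(2))
    also have "p (y ^ r) \<le> C * c ^ r"
    proof -
      have "p (y ^ r) / c ^ r \<le> (\<Sum>r<n. p (y ^ r) / c ^ r)"
        by (rule member_le_sum) (use m(2) normsD(2)[OF p] c in auto)
      hence "p (y ^ r) / c ^ r \<le> C" by (simp add: C_def)
      thus ?thesis using c by (simp add: field_simps)
    qed
    finally show ?thesis using c by (simp add: m(1) power_add mult_ac)
  qed
  hence "c \<in> growth p y" unfolding growth_def using c C by auto
  hence "Inf (growth p y) \<le> c" by (rule cInf_lower) (auto simp: growth_def intro!: bdd_belowI[of _ 0])
  moreover have "(\<lambda>x. if x \<in> L then Inf (growth p x) else 0) = p" using minimal growth_norm[OF p] by blast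
  from fun_cong[OF this, of y] have "Inf (growth p y) = p y" using y by simp
  ultimately show False using cy by simp
qed

text \<open>
  Multiplying by powers of \<open>y\<close> and renormalizing decreases the norm; a minimal norm is
  unchanged and hence multiplicative.
\<close>

lemma minimal_mult: "x \<in> L \<Longrightarrow> y \<in> L \<Longrightarrow> p (x * y) = p x * p y"
proof (cases "y = 0")
  case True
  thus ?thesis using normsD(3)[OF p, of 0] by simp
next
  case False
  assume x: "x \<in> L" and y: "y \<in> L"
  have py: "p y > 0" by (rule minimal_pos[OF y False])
  define Y where "Y z n = p (z * y ^ n) / p y ^ n" for z n
  define q where "q z = (if z \<in> L then (INF n. Y z n) else 0)" for z
  have X0: "0 \<le> Y z n" for z n unfolding Y_def using normsD(2)[OF p] py by simp
  have bdd: "bdd_below (range (Y z))" for z by (rule bdd_belowI[of _ 0]) (use X0 in auto)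
  have dec: "decseq (Y z)" if z: "z \<in> L" for z
  proof (rule decseq_SucI)
    fix n
    have "p ((z * y ^ n) * y) \<le> p (z * y ^ n) * p y" using z y by (intro normsD(5)[OF p]) auto
    hence "p (z * y ^ Suc n) \<le> p (z * y ^ n) * p y" by (simp add: mult_ac)
    thus "Y z (Suc n) \<le> Y z n" unfolding Y_def using py by (simp add: field_simps)
  qed
  have lim: "Y z \<longlonglongrightarrow> q z" if z: "z \<in> L" for z
    using LIMSEQ_decseq_INF[OF bdd dec[OF z]] z by (simp add: q_def)
  have qp: "q z \<le> p z" if z: "z \<in> L" for z
  proof -
    have "(INF n. Y z n) \<le> Y z 0" by (rule cINF_lower[OF bdd]) simp
    thus ?thesis using z by (simp add: q_def Y_def)
  qed
  have "q \<in> norms"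
  proof -
    have "0 \<le> q z" if "z \<in> L" for z using lim[OF that] X0 by (intro LIMSEQ_le_const) auto
    moreover have "q (s + t) \<le> q s + q t" if st: "s \<in> L" "t \<in> L" for s t
    proof (rule LIMSEQ_le[OF lim tendsto_add[OF lim[OF st(1)] lim[OF st(2)]]])
      show "s + t \<in> L" using st by auto
      have "Y (s + t) n \<le> Y s n + Y t n" for n
      proof -
        have "p (s * y ^ n + t * y ^ n) \<le> p (s * y ^ n) + p (t * y ^ n)" using st y by (intro normsD(4)[OF p]) auto
        thus ?thesis unfolding Y_def using py by (simp add: divide_right_mono distrib_right flip: add_divide_distrib)
      qed
      thus "\<exists>N. \<forall>n\<ge>N. Y (s + t) n \<le> Y s n + Y t n" by blast
    qed
    moreover have "q (s * t) \<le> q s * q t" if st: "s \<in> L" "t \<in> L" for s t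
    proof (rule LIMSEQ_le[OF _ tendsto_mult[OF lim[OF st(1)] lim[OF st(2)]]])
      have "(Y (s * t) \<circ> (\<lambda>n. 2 * n)) \<longlonglongrightarrow> q (s * t)"
        by (rule LIMSEQ_subseq_LIMSEQ[OF lim]) (use st in \<open>auto simp: strict_mono_def\<close>)
      thus "(\<lambda>n. Y (s * t) (2 * n)) \<longlonglongrightarrow> q (s * t)" by (simp add: o_def)
      have "Y (s * t) (2 * n) \<le> Y s n * Y t n" for n
      proof -
        have "p ((s * y ^ n) * (t * y ^ n)) \<le> p (s * y ^ n) * p (t * y ^ n)" using st y by (intro normsD(5)[OF p]) auto
        moreover have "(s * y ^ n) * (t * y ^ n) = s * t * y ^ (2 * n)"
          unfolding mult_2 power_add by (simp only: mult_ac)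
        moreover have "p y ^ (2 * n) = p y ^ n * p y ^ n" unfolding mult_2 power_add ..
        ultimately show ?thesis unfolding Y_def using py by (simp add: divide_right_mono)
      qed
      thus "\<exists>N. \<forall>n\<ge>N. Y (s * t) (2 * n) \<le> Y s n * Y t n" by blast
    qed
    moreover have "q a = v a" if a: "a \<in> F" for a
    proof -
      have "Y a n = v a" for n
        unfolding Y_def using norms_scale[OF p a L.power_mem[OF y, of n]] minimal_power[OF y] py by simp
      hence "Y a = (\<lambda>_. v a)" by (rule ext)
      thus ?thesis using lim[of a] a FL LIMSEQ_unique[OF _ tendsto_const] by force
    qed
    ultimately show ?thesis by (auto simp: norms_def q_def)
  qed
  moreover have "q \<le> p" using qp normsD(1)[OF p] by (auto simp: le_fun_def q_def)
  ultimately have qeq: "q = p" using minimal by blast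
  have "(\<lambda>n. Y x (Suc n) * p y) \<longlonglongrightarrow> q x * p y"
    by (intro tendsto_intros LIMSEQ_Suc lim x)
  moreover have "Y x (Suc n) * p y = Y (x * y) n" for n
    unfolding Y_def using py by (simp add: mult_ac)
  ultimately have "Y (x * y) \<longlonglongrightarrow> q x * p y" by simp
  moreover have "Y (x * y) \<longlonglongrightarrow> q (x * y)" using x y by (intro lim) auto
  ultimately have "q (x * y) = q x * p y" using LIMSEQ_unique by blast
  thus ?thesis by (simp add: qeq)
qed

lemma minimal_abs_value: "abs_value L p"
proof
  fix x y assume xy: "x \<in> L" "y \<in> L"
  show "p (x * y) = p x * p y" by (rule minimal_mult[OF xy])
  show "p (x + y) \<le> p x + p y" by (rule normsD(4)[OF p xy])
next
  fix x assume x: "x \<in> L"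
  show "0 \<le> p x" by (rule normsD(2)[OF p])
  show "p x = 0 \<longleftrightarrow> x = 0"
    by (cases "x = 0") (use minimal_pos[OF x] normsD(3)[OF p, of 0] in auto)
qed

end

lemma extension_exists_of_norm:
  assumes "norms \<noteq> {}"
  shows "\<exists>g. abs_value L g \<and> (\<forall>a\<in>F. g a = v a)"
proof -
  obtain m where m: "m \<in> norms" "\<forall>p\<in>norms. p \<le> m \<longrightarrow> p = m" using minimal_norm_exists[OF assms] by blast
  have "abs_value L m" by (rule minimal_abs_value[OF m(1)]) (use m(2) in blast)
  thus ?thesis using normsD(3)[OF m(1)] by blast
qed

end

text \<open>
  On \<open>F(\<alpha>)\<close> a first norm is induced by the weighted coefficient sum
  \<open>N(p) = \<Sum> v(p\<^sub>i) r\<^sup>i\<close> of polynomials.  For large \<open>r\<close> reduction modulo the minimal polynomial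
  does not increase \<open>N\<close>, so that constants keep their value.
\<close>

locale abs_value_minpoly = abs_value F v + minpoly F \<alpha> f for F v \<alpha> f
begin

text \<open>
  With this \<open>r\<close>, the lower coefficients of \<open>f\<close> together weigh at most \<open>r\<^sup>d\<close>, the weight of the leading one.
\<close>

definition r :: real where "r = 1 + (\<Sum>k<d. v (poly.coeff f k))"

definition N :: "Qbar poly \<Rightarrow> real" where "N p = poly (map_poly v p) r"

lemma v_coeff_nonneg: "p \<in> poly_over F \<Longrightarrow> 0 \<le> v (poly.coeff p k)"
  by (rule nonneg) (rule poly_over_coeff)

lemma r_ge_1: "r \<ge> 1"
  unfolding r_def using f_over v_coeff_nonneg by (auto intro: sum_nonneg)

lemma N_pCons: "N (pCons a p) = v a + r * N p"
  unfolding N_def by (simp add: map_poly_pCons)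

lemma N_0 [simp]: "N 0 = 0"
  by (simp add: N_def)

lemma N_nonneg: "p \<in> poly_over F \<Longrightarrow> 0 \<le> N p"
  using r_ge_1 by (induction p) (auto simp: N_pCons poly_over_pCons nonneg)

lemma N_eq_sum:
  assumes "Polynomial.degree p \<le> n"
  shows "N p = (\<Sum>k\<le>n. v (poly.coeff p k) * r ^ k)"
proof -
  have "N p = (\<Sum>k\<le>Polynomial.degree (map_poly v p). v (poly.coeff p k) * r ^ k)"
    unfolding N_def by (simp add: Polynomial.poly_altdef coeff_map_poly)
  also have "\<dots> = (\<Sum>k\<le>n. v (poly.coeff p k) * r ^ k)"
  proof (rule sum.mono_neutral_left)
    show "{..Polynomial.degree (map_poly v p)} \<subseteq> {..n}"
    proof -
      have "Polynomial.degree (map_poly v p) \<le> n"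
        using assms by (intro degree_le) (auto simp: coeff_map_poly coeff_eq_0)
      thus ?thesis by auto
    qed
    show "\<forall>i\<in>{..n} - {..Polynomial.degree (map_poly v p)}. v (poly.coeff p i) * r ^ i = 0"
      using coeff_eq_0[of "map_poly v p"] by (auto simp: coeff_map_poly)
  qed simp
  finally show ?thesis .
qed

lemma N_add: "p \<in> poly_over F \<Longrightarrow> q \<in> poly_over F \<Longrightarrow> N (p + q) \<le> N p + N q"
proof -
  assume pq: "p \<in> poly_over F" "q \<in> poly_over F"
  let ?n = "max (Polynomial.degree p) (Polynomial.degree q)"
  have "N (p + q) = (\<Sum>k\<le>?n. v (poly.coeff p k + poly.coeff q k) * r ^ k)"
    using N_eq_sum[OF degree_add_le_max[of p q]] by simp
  also have "\<dots> \<le> (\<Sum>k\<le>?n. (v (poly.coeff p k) + v (poly.coeff q k)) * r ^ k)"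
    using pq r_ge_1 by (intro sum_mono mult_right_mono triangle poly_over_coeff) auto
  also have "\<dots> = N p + N q"
    using N_eq_sum[of p ?n] N_eq_sum[of q ?n] by (simp add: distrib_right sum.distrib)
  finally show ?thesis .
qed

lemma N_smult: "a \<in> F \<Longrightarrow> p \<in> poly_over F \<Longrightarrow> N (smult a p) = v a * N p"
  by (induction p) (auto simp: N_pCons poly_over_pCons mult algebra_simps)

lemma N_mult: "p \<in> poly_over F \<Longrightarrow> q \<in> poly_over F \<Longrightarrow> N (p * q) \<le> N p * N q"
proof (induction p)
  case (pCons a p)
  have ap: "a \<in> F" "p \<in> poly_over F" using pCons.prems by (auto simp: poly_over_pCons)
  have "N (pCons a p * q) = N (smult a q + pCons 0 (p * q))" by simp
  also have "\<dots> \<le> N (smult a q) + N (pCons 0 (p * q))"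
    using ap pCons.prems by (intro N_add poly_over_smult) (auto simp: poly_over_pCons poly_over_mult)
  also have "\<dots> = v a * N q + r * N (p * q)" using ap pCons.prems by (simp add: N_smult N_pCons)
  also have "\<dots> \<le> v a * N q + r * (N p * N q)"
    using pCons.IH ap pCons.prems r_ge_1 by (intro add_left_mono mult_left_mono) auto
  finally show ?case by (simp add: N_pCons algebra_simps)
qed simp

lemma reduce_mod_minpoly:
  assumes "p \<in> poly_over F"
  shows "\<exists>s\<in>poly_over F. Polynomial.degree s < d \<and> poly s \<alpha> = poly p \<alpha> \<and> N s \<le> N p"
  using assms
proof (induction p)
  case 0
  show ?case using d_pos by (intro bexI[of _ 0]) auto
next
  case (pCons a p)
  have ap: "a \<in> F" "p \<in> poly_over F" using pCons.prems by (auto simp: poly_over_pCons)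
  obtain s where s: "s \<in> poly_over F" "Polynomial.degree s < d" "poly s \<alpha> = poly p \<alpha>" "N s \<le> N p"
    using pCons.IH[OF ap(2)] by blast
  define t where "t = pCons a s"
  have t: "t \<in> poly_over F" "poly t \<alpha> = poly (pCons a p) \<alpha>"
    using s ap by (simp_all add: t_def poly_over_pCons)
  have Nt: "N t \<le> N (pCons a p)" using s r_ge_1 by (simp add: t_def N_pCons mult_left_mono)
  have tdeg: "Polynomial.degree t \<le> d" using s(2) degree_pCons_le[of a s] by (simp add: t_def)
  define c where "c = poly.coeff t d"
  have c: "c \<in> F" unfolding c_def using t(1) by auto
  define u where "u = t - smult c f"
  have uF: "u \<in> poly_over F" unfolding u_def using t(1) c f_over by (intro poly_over_diff poly_over_smult)
  have ud: "Polynomial.degree u \<le> d" unfolding u_def using tdeg by (intro degree_diff_le) auto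
  have u0: "poly.coeff u d = 0" unfolding u_def using f_monic by (simp add: c_def)
  have deg: "Polynomial.degree u < d"
  proof (rule ccontr)
    assume "\<not> ?thesis"
    hence "Polynomial.degree u = d" using ud by simp
    with u0 have "u = 0" using leading_coeff_0_iff[of u] by simp
    with \<open>Polynomial.degree u = d\<close> d_pos show False by simp
  qed
  have root: "poly u \<alpha> = poly (pCons a p) \<alpha>" unfolding u_def using t(2) f_root by simp
  have up: "{..d} = insert d {..<d}" by auto
  have "(\<Sum>k<d. v (poly.coeff f k) * r ^ k) \<le> (\<Sum>k<d. v (poly.coeff f k) * r ^ (d - 1))"
    using r_ge_1 v_coeff_nonneg[OF f_over] by (intro sum_mono mult_left_mono power_increasing) auto
  also have "\<dots> = (r - 1) * r ^ (d - 1)" by (simp add: r_def sum_distrib_right)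
  also have "\<dots> \<le> r * r ^ (d - 1)" using r_ge_1 by (intro mult_right_mono) auto
  also have "\<dots> = r ^ d" using d_pos by (simp flip: power_Suc)
  finally have fl: "(\<Sum>k<d. v (poly.coeff f k) * r ^ k) \<le> r ^ d" .
  have "N u = (\<Sum>k<d. v (poly.coeff u k) * r ^ k)"
    unfolding N_eq_sum[OF ud] up using u0 by simp
  also have "\<dots> \<le> (\<Sum>k<d. (v (poly.coeff t k) + v c * v (poly.coeff f k)) * r ^ k)"
  proof (intro sum_mono mult_right_mono)
    fix k
    have "v (poly.coeff u k) \<le> v (poly.coeff t k) + v (c * poly.coeff f k)"
      unfolding u_def using diff_triangle[of "poly.coeff t k" "c * poly.coeff f k"] t(1) c f_over by auto
    thus "v (poly.coeff u k) \<le> v (poly.coeff t k) + v c * v (poly.coeff f k)"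
      using mult[OF c poly_over_coeff[OF f_over]] by simp
  qed (use r_ge_1 in auto)
  also have "\<dots> = (\<Sum>k<d. v (poly.coeff t k) * r ^ k) + v c * (\<Sum>k<d. v (poly.coeff f k) * r ^ k)"
    by (simp add: distrib_right sum.distrib sum_distrib_left mult.assoc)
  also have "\<dots> \<le> (\<Sum>k<d. v (poly.coeff t k) * r ^ k) + v c * r ^ d"
    using fl nonneg[OF c] by (intro add_left_mono mult_left_mono)
  also have "\<dots> = N t" unfolding N_eq_sum[OF tdeg] up by (simp add: c_def)
  finally have "N u \<le> N (pCons a p)" using Nt by simp
  thus ?case using uF deg root by blast
qed

lemma N_ge_const:
  assumes p: "p \<in> poly_over F" "poly p \<alpha> = a" and a: "a \<in> F"
  shows "v a \<le> N p"
proof -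
  obtain s where s: "s \<in> poly_over F" "Polynomial.degree s < d" "poly s \<alpha> = a" "N s \<le> N p"
    using reduce_mod_minpoly[OF p(1)] p(2) by auto
  have "s - [:a:] = 0"
  proof (rule ccontr)
    assume "s - [:a:] \<noteq> 0"
    moreover have "s - [:a:] \<in> poly_over F" using s(1) a by (intro poly_over_diff) (auto simp: poly_over_pCons)
    ultimately have "d \<le> Polynomial.degree (s - [:a:])" using f_min s(3) by simp
    also have "\<dots> < d" using s(2) d_pos by (intro degree_diff_less) auto
    finally show False by simp
  qed
  hence "N s = v a" by (simp add: N_pCons)
  thus ?thesis using s(4) by simp
qed

theorem extension_exists: "\<exists>g. abs_value (simple_ext F \<alpha>) g \<and> (\<forall>a\<in>F. g a = v a)"
proof -
  interpret L: Qbar_subfield "simple_ext F \<alpha>" by (rule simple_ext_subfield)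
  interpret S: submult_norms "simple_ext F \<alpha>" F v
    by unfold_locales (rule simple_ext_base)
  define P where "P y = {p \<in> poly_over F. poly p \<alpha> = y}" for y
  define s where "s y = (if y \<in> simple_ext F \<alpha> then (INF p\<in>P y. N p) else 0)" for y
  have ne: "P y \<noteq> {}" if "y \<in> simple_ext F \<alpha>" for y using that by (auto simp: P_def simple_ext_def)
  have bdd: "bdd_below (N ` P y)" for y by (rule bdd_belowI[of _ 0]) (auto simp: P_def N_nonneg)
  have le: "s y \<le> N p" if "p \<in> P y" for y p
  proof -
    have "y \<in> simple_ext F \<alpha>" using that by (auto simp: P_def simple_ext_def)
    thus ?thesis using cINF_lower[OF bdd that] by (simp add: s_def)
  qed
  have ge: "c \<le> s y" if "\<And>p. p \<in> P y \<Longrightarrow> c \<le> N p" "y \<in> simple_ext F \<alpha>" for y c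
    using cINF_greatest[OF ne[OF that(2)], of c N] that by (simp add: s_def)
  have n: "0 \<le> s y" if "y \<in> simple_ext F \<alpha>" for y using that by (intro ge) (auto simp: P_def N_nonneg)
  have near: "\<exists>p\<in>P y. N p < s y + e" if y: "y \<in> simple_ext F \<alpha>" and e: "e > 0" for y e
  proof (rule ccontr)
    assume "\<not> ?thesis"
    hence "s y + e \<le> s y" using y by (intro ge) (auto simp: not_less)
    with e show False by simp
  qed
  have "s (x + y) \<le> s x + s y" if xy: "x \<in> simple_ext F \<alpha>" "y \<in> simple_ext F \<alpha>" for x y
  proof (rule field_le_epsilon)
    fix e :: real assume "e > 0"
    hence "e / 2 > 0" by simp
    obtain p where p: "p \<in> P x" "N p < s x + e / 2" using near[OF xy(1) \<open>e / 2 > 0\<close>] by blast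
    obtain q where q: "q \<in> P y" "N q < s y + e / 2" using near[OF xy(2) \<open>e / 2 > 0\<close>] by blast
    have "s (x + y) \<le> N (p + q)" using p q by (intro le) (auto simp: P_def poly_over_add)
    also have "\<dots> \<le> N p + N q" using p q by (intro N_add) (auto simp: P_def)
    finally show "s (x + y) \<le> s x + s y + e" using p q by simp
  qed
  moreover have "s (x * y) \<le> s x * s y" if xy: "x \<in> simple_ext F \<alpha>" "y \<in> simple_ext F \<alpha>" for x y
  proof -
    have bound: "s (x * y) \<le> (s x + e) * (s y + e)" if e: "e > 0" for e
    proof -
      obtain p where p: "p \<in> P x" "N p < s x + e" using near[OF xy(1) e] by blast
      obtain q where q: "q \<in> P y" "N q < s y + e" using near[OF xy(2) e] by blast
      have "s (x * y) \<le> N (p * q)" using p q by (intro le) (auto simp: P_def poly_over_mult)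
      also have "\<dots> \<le> N p * N q" using p q by (intro N_mult) (auto simp: P_def)
      also have "\<dots> \<le> (s x + e) * (s y + e)"
        using p q n xy e N_nonneg by (intro mult_mono) (auto simp: P_def intro!: add_nonneg_nonneg)
      finally show ?thesis .
    qed
    have "(\<lambda>n. (s x + inverse (real (Suc n))) * (s y + inverse (real (Suc n)))) \<longlonglongrightarrow> (s x + 0) * (s y + 0)"
      by (intro tendsto_intros LIMSEQ_inverse_real_of_nat)
    hence "s (x * y) \<le> (s x + 0) * (s y + 0)" using bound by (intro LIMSEQ_le_const) auto
    thus ?thesis by simp
  qed
  moreover have "s a = v a" if a: "a \<in> F" for a
  proof (rule antisym)
    have "[:a:] \<in> P a" using a by (simp add: P_def poly_over_pCons)
    from le[OF this] show "s a \<le> v a" by (simp add: N_pCons)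
    show "v a \<le> s a" using a simple_ext_base N_ge_const by (intro ge) (auto simp: P_def)
  qed
  ultimately have "s \<in> S.norms" using n unfolding S.norms_def by (auto simp: s_def)
  thus ?thesis using S.extension_exists_of_norm by blast
qed

end

lemma abs_value_extension_finite:
  assumes "finite A" "abs_value F v"
  shows "\<exists>F' g. abs_value F' g \<and> F \<subseteq> F' \<and> A \<subseteq> F' \<and> (\<forall>a\<in>F. g a = v a)"
  using assms
proof (induction A rule: finite_induct)
  case empty
  thus ?case by blast
next
  case (insert \<alpha> A)
  obtain F' g where g: "abs_value F' g" "F \<subseteq> F'" "A \<subseteq> F'" "\<forall>a\<in>F. g a = v a" using insert by blast
  interpret g: abs_value F' g by (rule g(1))
  obtain f where "minpoly F' \<alpha> f" using g.minpoly_exists by blast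
  then interpret m: minpoly F' \<alpha> f .
  interpret abs_value_minpoly F' g \<alpha> f ..
  obtain h where h: "abs_value (simple_ext F' \<alpha>) h" "\<forall>a\<in>F'. h a = g a" using extension_exists by blast
  have "F' \<subseteq> simple_ext F' \<alpha>" "\<alpha> \<in> simple_ext F' \<alpha>" using m.simple_ext_base m.simple_ext_generator by auto
  thus ?case using h g by (intro exI[of _ "simple_ext F' \<alpha>"] exI[of _ h]) auto
qed

section \<open>The sum of the local degrees\<close>

abbreviation places_above :: "Qbar set \<Rightarrow> Qbar set \<Rightarrow> place \<Rightarrow> place set"
  where "places_above K L v \<equiv> {w \<in> places L. divides_place K w v}"

definition local_degree_at :: "Qbar set \<Rightarrow> Qbar set \<Rightarrow> place \<Rightarrow> nat"
  where "local_degree_at K L w = local_degree K (place_below K w) L w"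

lemma place_extension_below:
  assumes "number_field K" "number_field L" "K \<subseteq> L" "w \<in> places L"
  shows "place_extension K L (place_below K w) w"
  using assms place_below[OF assms] by (intro place_extension.intro) auto

lemma local_degree_at_eq:
  assumes "number_field K" "number_field L" "K \<subseteq> L" "w \<in> places L"
    and "local_basis K L (place_norm w) I x"
  shows "local_degree_at K L w = card I"
  unfolding local_degree_at_def
  by (rule place_extension.local_degree_eq_card_local_basis[OF place_extension_below[OF assms(1-4)] assms(5)])

lemma place_norm_abs_value: "number_field L \<Longrightarrow> w \<in> places L \<Longrightarrow> abs_value L (place_norm w)"
  using place_norm_in(2) normalized_norms_iff number_field_subfield by blast

lemma place_local_basis_exists:
  assumes "number_field K" "number_field L" "K \<subseteq> L" "w \<in> places L"
  shows "\<exists>B. local_basis K L (place_norm w) B (\<lambda>b. b)"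
proof -
  interpret place_extension K L "place_below K w" w by (rule place_extension_below[OF assms])
  show ?thesis by (rule local_basis_exists[OF number_field_finite_extension[OF assms(1-3)]])
qed

lemma local_degree_at_pos:
  assumes "number_field K" "number_field L" "K \<subseteq> L" "w \<in> places L"
  shows "local_degree_at K L w > 0"
proof -
  interpret abs_value L "place_norm w" using place_norm_abs_value assms by blast
  obtain B where B: "local_basis K L (place_norm w) B (\<lambda>b. b)" using place_local_basis_exists[OF assms] by blast
  have "B \<noteq> {}"
  proof
    assume "B = {}"
    hence "\<forall>y\<in>L. \<forall>e>0. \<exists>z\<in>lin_span K {} (\<lambda>b. b). place_norm w (y - z) < e"
      using B by (simp add: local_basis_def)
    hence "\<exists>z\<in>lin_span K {} (\<lambda>b. b). place_norm w (1 - z) < 1" by (meson one_mem zero_less_one)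
    thus False by (simp add: lin_span_def)
  qed
  moreover have "finite B" using B by (simp add: local_basis_def)
  ultimately show ?thesis using local_degree_at_eq[OF assms B] by (simp add: card_gt_0_iff)
qed

lemma place_below_trans:
  assumes "number_field K" "number_field L" "number_field M" "K \<subseteq> L" "L \<subseteq> M" "u \<in> places M"
  shows "place_below K (place_below L u) = place_below K u"
proof -
  have KM: "K \<subseteq> M" using assms by auto
  note L = place_below[OF assms(2,3,5,6)]
  note K = place_below[OF assms(1,3) KM assms(6)]
  note KL = place_below[OF assms(1,2,4) L(1)]
  show ?thesis
  proof (rule place_norm_inj[OF assms(1) KL(1) K(1)])
    show "place_norm (place_below K (place_below L u)) = place_norm (place_below K u)"
      using assms(4) by (simp add: KL(2) K(2) L(2) restrict_restrict inf_absorb2)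
  qed
qed

lemma local_degree_at_tower:
  assumes "number_field K" "number_field L" "number_field M" "K \<subseteq> L" "L \<subseteq> M" "u \<in> places M"
  shows "local_degree_at K M u = local_degree_at K L (place_below L u) * local_degree_at L M u"
proof -
  have KM: "K \<subseteq> M" using assms by auto
  have w: "place_below L u \<in> places L" "place_norm (place_below L u) = restrict (place_norm u) L"
    using place_below[OF assms(2,3,5,6)] by auto
  interpret L: Qbar_subfield L by (rule number_field_subfield[OF assms(2)])
  obtain B where B: "local_basis K L (place_norm (place_below L u)) B (\<lambda>b. b)"
    using place_local_basis_exists[OF assms(1,2,4) w(1)] by blast
  obtain D where D: "local_basis L M (place_norm u) D (\<lambda>b. b)"
    using place_local_basis_exists[OF assms(2,3,5,6)] by blast
  have "local_basis K ((\<lambda>y. y) ` L) (place_norm u) B (\<lambda>b. b)"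
    by (rule local_basis_transport[OF B number_field_subfield[OF assms(1)] L.Qbar_subfield_axioms assms(4)])
      (simp_all add: w(2))
  hence "local_basis K L (place_norm u) B (\<lambda>b. b)" by simp
  hence "local_basis K M (place_norm u) (B \<times> D) (\<lambda>(i, j). i * j)"
    using local_basis_tower[OF _ D number_field_subfield[OF assms(1)] number_field_subfield[OF assms(2)]
        place_norm_abs_value[OF assms(3,6)] assms(4,5)] by blast
  hence "local_degree_at K M u = card (B \<times> D)" by (rule local_degree_at_eq[OF assms(1,3) KM assms(6)])
  thus ?thesis using local_degree_at_eq[OF assms(1,2,4) w(1) B] local_degree_at_eq[OF assms(2,3,5,6) D]
    by (simp add: card_cartesian_product)
qed

lemma norms_above_places:
  assumes "number_field K" "number_field L" "K \<subseteq> L" "v \<in> places K" "W \<subseteq> places_above K L v"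
  shows "norms_above K L (place_norm v) (place_norm ` W)"
proof -
  have sub: "Qbar_subfield K" "Qbar_subfield L" using assms number_field_subfield by auto
  have vn: "abs_value K (place_norm v)" "\<exists>x\<in>K. x \<noteq> 0 \<and> place_norm v x \<noteq> 1"
    using place_mem_nontrivial[OF assms(4) place_norm_in(1)[OF assms(1,4)]]
      nontrivial_absolute_values_iff[OF sub(1)] by auto
  interpret v: abs_value K "place_norm v" by (rule vn)
  obtain x where x: "x \<in> K" "x \<noteq> 0" "place_norm v x \<noteq> 1" using vn(2) by blast
  have "\<exists>a\<in>K. place_norm v a > 1"
  proof (cases "place_norm v x > 1")
    case False
    hence "place_norm v x < 1" using x(3) by simp
    hence "place_norm v (inverse x) > 1"
      using v.pos[OF x(1,2)] by (simp add: v.inverse[OF x(1)] one_less_inverse)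
    thus ?thesis using x by blast
  qed (use x in auto)
  moreover have "place_norm w a = place_norm v a" if w: "w \<in> W" and a: "a \<in> K" for w a
  proof -
    have "restrict (place_norm w) K = place_norm v"
      using divides_place_iff[OF assms(1-4)] w assms(5) by auto
    thus ?thesis using a by (metis restrict_apply')
  qed
  moreover have "place_norm w \<in> extensional L" if "w \<in> W" for w
    using place_norm_in(2)[OF assms(2)] normalized_norms_iff[OF sub(2)] that assms(5) by blast
  moreover have "abs_value L (place_norm w)" if "w \<in> W" for w
    using place_norm_abs_value[OF assms(2)] that assms(5) by blast
  ultimately show ?thesis
    using sub assms(3) by (intro norms_above.intro norms_above_axioms.intro) auto
qed

lemma place_norm_local_bases:
  assumes "number_field K" "number_field L" "K \<subseteq> L" "W \<subseteq> places L"
  obtains I :: "(Qbar \<Rightarrow> real) \<Rightarrow> Qbar set" where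
    "\<forall>g\<in>place_norm ` W. local_basis K L g (I g) (\<lambda>b. b)"
    "(\<Sum>g\<in>place_norm ` W. card (I g)) = (\<Sum>w\<in>W. local_degree_at K L w)"
proof -
  have "\<forall>g\<in>place_norm ` W. \<exists>B. local_basis K L g B (\<lambda>b. b)"
    using place_local_basis_exists[OF assms(1-3)] assms(4) by blast
  from bchoice[OF this] obtain I where I: "\<forall>g\<in>place_norm ` W. local_basis K L g (I g) (\<lambda>b. b)" by blast
  have inj: "inj_on place_norm W"
    using place_norm_inj[OF assms(2)] assms(4) by (auto simp: inj_on_def subset_iff)
  have "(\<Sum>g\<in>place_norm ` W. card (I g)) = (\<Sum>w\<in>W. card (I (place_norm w)))"
    by (simp add: sum.reindex[OF inj])
  also have "\<dots> = (\<Sum>w\<in>W. local_degree_at K L w)"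
  proof (rule sum.cong[OF refl])
    fix w assume w: "w \<in> W"
    have "local_basis K L (place_norm w) (I (place_norm w)) (\<lambda>b. b)" using I w by blast
    thus "card (I (place_norm w)) = local_degree_at K L w"
      by (rule local_degree_at_eq[OF assms(1-3) subsetD[OF assms(4) w], symmetric])
  qed
  finally show ?thesis using that I by blast
qed

lemma sum_local_degrees_le:
  assumes "number_field K" "number_field L" "K \<subseteq> L" "v \<in> places K" "W \<subseteq> places_above K L v" "finite W"
  shows "(\<Sum>w\<in>W. local_degree_at K L w) \<le> ext_degree K L"
proof -
  interpret norms_above K L "place_norm v" "place_norm ` W" by (rule norms_above_places[OF assms(1-5)])
  have WL: "W \<subseteq> places L" using assms(5) by auto
  obtain I where I: "\<forall>g\<in>place_norm ` W. local_basis K L g (I g) (\<lambda>b. b)"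
    "(\<Sum>g\<in>place_norm ` W. card (I g)) = (\<Sum>w\<in>W. local_degree_at K L w)"
    by (rule place_norm_local_bases[OF assms(1-3) WL])
  have "(\<Sum>g\<in>place_norm ` W. card (I g)) \<le> ext_degree K L"
    by (rule sum_local_basis_le[where x = "\<lambda>_ b. b"])
      (use I assms(6) number_field_finite_extension[OF assms(1-3)] in auto)
  thus ?thesis using I(2) by simp
qed

text \<open>
  Every place contributes a local degree of at least 1 to a sum bounded by the degree.
\<close>

theorem finite_places_above:
  assumes "number_field K" "number_field L" "K \<subseteq> L" "v \<in> places K"
  shows "finite (places_above K L v)"
proof (rule ccontr)
  assume "infinite (places_above K L v)"
  then obtain W where W: "finite W" "card W = Suc (ext_degree K L)" "W \<subseteq> places_above K L v"
    using infinite_arbitrarily_large by blast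
  have "(\<Sum>w\<in>W. 1) \<le> (\<Sum>w\<in>W. local_degree_at K L w)"
    using local_degree_at_pos[OF assms(1-3)] W(3) by (intro sum_mono) (auto simp: Suc_le_eq)
  also have "\<dots> \<le> ext_degree K L" by (rule sum_local_degrees_le[OF assms W(3,1)])
  finally show False using W(2) by simp
qed

text \<open>
  By Lagrange interpolation, a polynomial of degree below \<open>n\<close> with small values at \<open>n\<close> points has
  small coefficients.
\<close>

lemma (in abs_value) lagrange_bound:
  assumes R: "finite R" "R \<subseteq> L" "R \<noteq> {}"
  shows "\<exists>C>0. \<forall>p\<in>poly_over L. Polynomial.degree p < card R \<longrightarrow>
    (\<forall>k<card R. \<exists>\<beta>\<in>R. f (poly.coeff p k) \<le> C * f (poly p \<beta>))"
proof -
  define l where "l \<beta> = (\<Prod>\<gamma>\<in>R - {\<beta>}. smult (inverse (\<beta> - \<gamma>)) [:- \<gamma>, 1:])" for \<beta>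
  have l_over: "l \<beta> \<in> poly_over L" if "\<beta> \<in> R" for \<beta>
    unfolding l_def using R that
    by (intro poly_over_prod poly_over_smult) (auto simp: poly_over_pCons subset_iff)
  have l_deg: "Polynomial.degree (l \<beta>) < card R" if b: "\<beta> \<in> R" for \<beta>
  proof -
    have "Polynomial.degree (l \<beta>) \<le> (\<Sum>\<gamma>\<in>R - {\<beta>}. Polynomial.degree (smult (inverse (\<beta> - \<gamma>)) [:- \<gamma>, 1:]))"
      unfolding l_def using degree_prod_sum_le[of "R - {\<beta>}" "\<lambda>\<gamma>. smult (inverse (\<beta> - \<gamma>)) [:- \<gamma>, 1:]"] R(1)
      by (simp only: finite_Diff o_def)
    also have "\<dots> \<le> (\<Sum>\<gamma>\<in>R - {\<beta>}. 1)" by (intro sum_mono) (auto intro: order.trans[OF degree_smult_le])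
    also have "\<dots> < card R" using b R(1) card_gt_0_iff[of R] by auto
    finally show ?thesis .
  qed
  have l_val: "poly (l \<beta>) \<delta> = (if \<delta> = \<beta> then 1 else 0)" if "\<beta> \<in> R" "\<delta> \<in> R" for \<beta> \<delta>
  proof (cases "\<delta> = \<beta>")
    case True
    have "poly (l \<beta>) \<beta> = (\<Prod>\<gamma>\<in>R - {\<beta>}. inverse (\<beta> - \<gamma>) * (\<beta> - \<gamma>))"
      unfolding l_def poly_prod by (intro prod.cong) (auto simp: algebra_simps)
    also have "\<dots> = 1" by (intro prod.neutral ballI left_inverse) auto
    finally show ?thesis using True by simp
  next
    case False
    thus ?thesis unfolding l_def poly_prod using that R(1) by (auto intro!: prod_zero bexI[of _ \<delta>])
  qed
  define M where "M = (\<Sum>\<beta>\<in>R. \<Sum>k<card R. f (poly.coeff (l \<beta>) k)) + 1"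
  have fl0: "0 \<le> f (poly.coeff (l \<beta>) k)" if "\<beta> \<in> R" for \<beta> k using l_over[OF that] by (intro nonneg) auto
  have M: "f (poly.coeff (l \<beta>) k) \<le> M" if "\<beta> \<in> R" "k < card R" for \<beta> k
  proof -
    have "f (poly.coeff (l \<beta>) k) \<le> (\<Sum>k<card R. f (poly.coeff (l \<beta>) k))"
      by (rule member_le_sum) (use that fl0 in auto)
    also have "\<dots> \<le> (\<Sum>\<beta>\<in>R. \<Sum>k<card R. f (poly.coeff (l \<beta>) k))"
      by (rule member_le_sum) (use that fl0 R(1) in \<open>auto intro: sum_nonneg\<close>)
    finally show ?thesis by (simp add: M_def)
  qed
  have M0: "M > 0" unfolding M_def using fl0 by (intro add_nonneg_pos sum_nonneg) auto
  have cR: "card R > 0" using R by (simp add: card_gt_0_iff)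
  have "\<exists>\<beta>\<in>R. f (poly.coeff p k) \<le> (real (card R) * M) * f (poly p \<beta>)"
    if p: "p \<in> poly_over L" "Polynomial.degree p < card R" and k: "k < card R" for p k
  proof (rule ccontr)
    assume "\<not> ?thesis"
    hence neg: "(real (card R) * M) * f (poly p \<beta>) < f (poly.coeff p k)" if "\<beta> \<in> R" for \<beta>
      using that by (auto simp: not_le)
    define q where "q = p - (\<Sum>\<beta>\<in>R. smult (poly p \<beta>) (l \<beta>))"
    have qz: "poly q \<delta> = 0" if d: "\<delta> \<in> R" for \<delta>
    proof -
      have "(\<Sum>\<beta>\<in>R. poly p \<beta> * poly (l \<beta>) \<delta>) = (\<Sum>\<beta>\<in>R. if \<delta> = \<beta> then poly p \<beta> else 0)"
        using d by (intro sum.cong) (auto simp: l_val)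
      also have "\<dots> = poly p \<delta>" using R(1) d by simp
      finally show ?thesis by (simp add: q_def poly_sum)
    qed
    have "q = 0"
    proof (rule ccontr)
      assume q0: "q \<noteq> 0"
      have "Polynomial.degree q < card R"
        unfolding q_def using p(2) l_deg cR
        by (intro degree_diff_less degree_sum_less) (auto intro: le_less_trans[OF degree_smult_le])
      moreover have "card R \<le> card {x. poly q x = 0}"
        using qz poly_roots_finite[OF q0] by (intro card_mono) auto
      moreover have "card {x. poly q x = 0} \<le> Polynomial.degree q" by (rule card_poly_roots_bound[OF q0])
      ultimately show False by simp
    qed
    hence "p = (\<Sum>\<beta>\<in>R. smult (poly p \<beta>) (l \<beta>))" by (simp add: q_def)
    from arg_cong[OF this, of "\<lambda>p. poly.coeff p k"]
    have "poly.coeff p k = (\<Sum>\<beta>\<in>R. poly p \<beta> * poly.coeff (l \<beta>) k)"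
      unfolding coeff_sum coeff_smult .
    also have "f \<dots> \<le> (\<Sum>\<beta>\<in>R. f (poly p \<beta> * poly.coeff (l \<beta>) k))"
      using R p l_over by (intro sum_triangle mult_mem poly_mem) auto
    also have "\<dots> \<le> (\<Sum>\<beta>\<in>R. f (poly p \<beta>) * M)"
    proof (rule sum_mono)
      fix \<beta> assume b: "\<beta> \<in> R"
      have pL: "poly p \<beta> \<in> L" "poly.coeff (l \<beta>) k \<in> L" using p b R l_over by (auto intro: poly_mem)
      show "f (poly p \<beta> * poly.coeff (l \<beta>) k) \<le> f (poly p \<beta>) * M"
        unfolding mult[OF pL] using M[OF b k] nonneg[OF pL(1)] by (intro mult_left_mono)
    qed
    also have "\<dots> < (\<Sum>\<beta>\<in>R. f (poly.coeff p k) / real (card R))"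
      using R(1,3) neg cR by (intro sum_strict_mono) (auto simp: field_simps)
    also have "\<dots> = f (poly.coeff p k)" using cR by simp
    finally show False by simp
  qed
  moreover have "real (card R) * M > 0" using cR M0 by simp
  ultimately show ?thesis by blast
qed

context minpoly
begin

text \<open>
  This is how the extensions of \<open>v\<close> to \<open>K(\<alpha>)\<close> arise: an extension to one large field is pulled back along all
  embeddings.
\<close>

lemma conjugate_abs_value:
  assumes g: "abs_value F g" and F: "K \<subseteq> F" "\<beta> \<in> F" and b: "\<beta> \<in> conjugates"
  shows "abs_value (simple_ext K \<alpha>) (\<lambda>y. g (conj_map \<beta> y))"
proof -
  interpret F: abs_value F g by fact
  interpret S: Qbar_subfield "simple_ext K \<alpha>" by (rule simple_ext_subfield)
  interpret b: minpoly K \<beta> f using minpoly_conjugate b by (simp add: conjugates_def)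
  have sub: "simple_ext K \<beta> \<subseteq> F"
    by (rule b.simple_ext_subset) (use F b F.Qbar_subfield_axioms in auto)
  have mem: "conj_map \<beta> y \<in> F" if "y \<in> simple_ext K \<alpha>" for y
    using conj_map_hom(4)[OF b that that] sub by blast
  show ?thesis
  proof
    fix x y assume xy: "x \<in> simple_ext K \<alpha>" "y \<in> simple_ext K \<alpha>"
    show "g (conj_map \<beta> (x * y)) = g (conj_map \<beta> x) * g (conj_map \<beta> y)"
      using conj_map_hom(2)[OF b xy] F.mult mem xy by simp
    show "g (conj_map \<beta> (x + y)) \<le> g (conj_map \<beta> x) + g (conj_map \<beta> y)"
      using conj_map_hom(1)[OF b xy] F.triangle mem xy by simp
  next
    fix x assume x: "x \<in> simple_ext K \<alpha>"
    show "0 \<le> g (conj_map \<beta> x)" using F.nonneg mem x by blast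
    show "g (conj_map \<beta> x) = 0 \<longleftrightarrow> x = 0" using F.eq_0_iff[OF mem[OF x]] conj_map_hom(3)[OF b x x] by simp
  qed
qed

text \<open>
  Let \<open>v\<close> be extended to a field containing all conjugates of \<open>\<alpha>\<close>.  A combination of the powers \<open>1, \<dots>, \<alpha>\<^bsup>d-1\<^esup>\<close> is the value
  of a polynomial at \<open>\<alpha>\<close>, and its values at the places above \<open>v\<close> include the values of the polynomial at all \<open>d\<close>
  conjugates.  By interpolation they control the coefficients.
\<close>

theorem sum_local_degrees_simple:
  assumes K: "number_field K" and v: "v \<in> places K"
  shows "(\<Sum>w\<in>places_above K (simple_ext K \<alpha>) v. local_degree_at K (simple_ext K \<alpha>) w) = d"
proof -
  define L where "L = simple_ext K \<alpha>"
  have L: "number_field L" unfolding L_def by (rule number_field_extension[OF K simple_ext_finite])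
  have KL: "K \<subseteq> L" unfolding L_def by (rule simple_ext_base)
  have Lsub: "Qbar_subfield L" by (rule number_field_subfield[OF L])
  define W where "W = places_above K L v"
  have W: "finite W" "W \<subseteq> places L" "W \<subseteq> places_above K L v"
    unfolding W_def using finite_places_above[OF K L KL v] by auto
  interpret A: norms_above K L "place_norm v" "place_norm ` W" by (rule norms_above_places[OF K L KL v W(3)])
  obtain I where I: "\<forall>g\<in>place_norm ` W. local_basis K L g (I g) (\<lambda>b. b)"
    "(\<Sum>g\<in>place_norm ` W. card (I g)) = (\<Sum>w\<in>W. local_degree_at K L w)"
    by (rule place_norm_local_bases[OF K L KL W(2)])
  obtain F g where F: "abs_value F g" "K \<subseteq> F" "conjugates \<subseteq> F" "\<forall>a\<in>K. g a = place_norm v a"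
    using abs_value_extension_finite[OF finite_conjugates place_norm_abs_value[OF K v]] by blast
  interpret F: abs_value F g by (rule F(1))
  have ne: "conjugates \<noteq> {}" using f_root by (auto simp: conjugates_def)
  obtain C where C: "C > 0" "\<forall>p\<in>poly_over F. Polynomial.degree p < d \<longrightarrow>
      (\<forall>k<d. \<exists>\<beta>\<in>conjugates. g (poly.coeff p k) \<le> C * g (poly p \<beta>))"
    using F.lagrange_bound[OF finite_conjugates F(3) ne] unfolding card_conjugates by blast
  have "d \<le> (\<Sum>g\<in>place_norm ` W. card (I g))"
  proof (rule A.sum_local_basis_ge[where x = "\<lambda>_ b. b" and b = "\<lambda>k. \<alpha> ^ k" and C = C])
    show "finite (place_norm ` W)" using W(1) by simp
    show "local_basis K L g (I g) (\<lambda>b. b)" if "g \<in> place_norm ` W" for g using I(1) that by blast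
    show "\<alpha> ^ k \<in> L" for k using Qbar_subfield.power_mem[OF Lsub] simple_ext_generator by (simp add: L_def)
    show "C > 0" by (rule C(1))
    fix a k assume a: "\<And>k. k < d \<Longrightarrow> a k \<in> K" and k: "k < d"
    define p where "p = (\<Sum>k<d. Polynomial.monom (a k) k)"
    have cf: "poly.coeff p i = (if i < d then a i else 0)" for i unfolding p_def by (simp add: coeff_sum)
    have pK: "p \<in> poly_over K" unfolding poly_over_def using a by (simp add: cf)
    hence pF: "p \<in> poly_over F" using F(2) by (auto simp: poly_over_def)
    have "Polynomial.degree p \<le> d - 1" by (rule degree_le) (auto simp: cf)
    hence "Polynomial.degree p < d" using d_pos by linarith
    then obtain \<beta> where b: "\<beta> \<in> conjugates" "g (poly.coeff p k) \<le> C * g (poly p \<beta>)"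
      using C(2) pF k by blast
    define h where "h = restrict (\<lambda>y. g (conj_map \<beta> y)) L"
    have hK: "h x = place_norm v x" if "x \<in> K" for x
      using conj_map_base[OF b(1) that] F(4) that KL by (auto simp: h_def)
    have "abs_value L h"
      by (rule abs_value_cong[OF conjugate_abs_value[OF F(1,2) subsetD[OF F(3) b(1)] b(1), folded L_def]]) (simp add: h_def)
    moreover have "(\<lambda>r. h (of_rat r)) = (\<lambda>r. place_norm v (of_rat r))" using hK by auto
    hence "(\<lambda>r. h (of_rat r)) \<in> usual_abs_rat" using place_norm_in(2)[OF K v] by (simp add: normalized_norms_def)
    ultimately have hn: "h \<in> normalized_norms L" using normalized_norms_iff[OF Lsub] by (simp add: h_def)
    define w where "w = place_of L h"
    have w: "w \<in> places L" "place_norm w = h"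
      unfolding w_def using place_of_in(1)[OF hn] place_norm_place_of[OF L hn] by auto
    have "restrict h K = place_norm v"
    proof (rule extensionalityI)
      show "place_norm v \<in> extensional K"
        using place_norm_in(2)[OF K v] normalized_norms_iff[OF Qbar_subfield_axioms] by blast
    qed (use hK in auto)
    hence "w \<in> W" unfolding W_def using divides_place_iff[OF K L KL v w(1)] w by auto
    moreover have "place_norm v (a k) \<le> C * h (\<Sum>k<d. a k * \<alpha> ^ k)"
    proof -
      have s: "(\<Sum>k<d. a k * \<alpha> ^ k) = poly p \<alpha>" unfolding p_def by (simp add: poly_sum poly_monom)
      have "h (poly p \<alpha>) = g (poly p \<beta>)"
        using conj_map_poly[OF b(1) pK] simple_ext_poly[OF pK] by (simp add: h_def L_def)
      thus ?thesis using b(2) F(4) a[OF k] k cf[of k] unfolding s by simp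
    qed
    ultimately show "\<exists>g\<in>place_norm ` W. place_norm v (a k) \<le> C * g (\<Sum>k<d. a k * \<alpha> ^ k)"
      using w(2) by blast
  qed
  moreover have "(\<Sum>w\<in>W. local_degree_at K L w) \<le> d"
    using sum_local_degrees_le[OF K L KL v W(3,1)] simple_ext_degree by (simp add: L_def)
  ultimately show ?thesis using I(2) unfolding W_def L_def by simp
qed

end

lemma sum_places_above_tower:
  fixes h :: "place \<Rightarrow> 'a :: comm_monoid_add"
  assumes "number_field K" "number_field L" "number_field M" "K \<subseteq> L" "L \<subseteq> M" "v \<in> places K"
  shows "(\<Sum>u\<in>places_above K M v. h u) = (\<Sum>w\<in>places_above K L v. \<Sum>u\<in>places_above L M w. h u)"
proof -
  have KM: "K \<subseteq> M" using assms by auto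
  have "(\<Sum>w\<in>places_above K L v. \<Sum>u\<in>places_above L M w. h u)
      = sum h (\<Union>w\<in>places_above K L v. places_above L M w)"
  proof (rule sum.UNION_disjoint[symmetric])
    show "finite (places_above K L v)" by (rule finite_places_above[OF assms(1,2,4,6)])
    show "\<forall>w\<in>places_above K L v. finite (places_above L M w)"
      using finite_places_above[OF assms(2,3,5)] by blast
    show "\<forall>w\<in>places_above K L v. \<forall>w'\<in>places_above K L v. w \<noteq> w' \<longrightarrow>
        places_above L M w \<inter> places_above L M w' = {}"
      using place_below(3)[OF assms(2,3,5)] by blast
  qed
  also have "(\<Union>w\<in>places_above K L v. places_above L M w) = places_above K M v"
  proof (rule Set.set_eqI, rule iffI)
    fix u assume "u \<in> (\<Union>w\<in>places_above K L v. places_above L M w)"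
    then obtain w where w: "w \<in> places L" "divides_place K w v" "u \<in> places M" "divides_place L u w" by blast
    have "w = place_below L u" using place_below(3)[OF assms(2,3,5) w(3,1)] w(4) by blast
    hence "v = place_below K u"
      using place_below(3)[OF assms(1,2,4) w(1) assms(6)] w(2) place_below_trans[OF assms(1-5) w(3)] by simp
    thus "u \<in> places_above K M v" using place_below(3)[OF assms(1,3) KM w(3) assms(6)] w(3) by blast
  next
    fix u assume u: "u \<in> places_above K M v"
    hence uM: "u \<in> places M" by blast
    note L = place_below[OF assms(2,3,5) uM]
    have "v = place_below K u" using place_below(3)[OF assms(1,3) KM uM assms(6)] u by blast
    hence "v = place_below K (place_below L u)" using place_below_trans[OF assms(1-5) uM] by simp
    hence "place_below L u \<in> places_above K L v" using place_below(3)[OF assms(1,2,4) L(1) assms(6)] L(1) by blast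
    moreover have "u \<in> places_above L M (place_below L u)" using L(3)[OF L(1)] uM by blast
    ultimately show "u \<in> (\<Union>w\<in>places_above K L v. places_above L M w)" by blast
  qed
  finally show ?thesis by simp
qed

lemma sum_local_degrees_trans:
  assumes "number_field K" "number_field L" "number_field M" "K \<subseteq> L" "L \<subseteq> M" "v \<in> places K"
    and KL: "(\<Sum>w\<in>places_above K L v. local_degree_at K L w) = ext_degree K L"
    and LM: "\<And>w. w \<in> places L \<Longrightarrow> (\<Sum>u\<in>places_above L M w. local_degree_at L M u) = ext_degree L M"
  shows "(\<Sum>u\<in>places_above K M v. local_degree_at K M u) = ext_degree K M"
proof -
  have "(\<Sum>u\<in>places_above K M v. local_degree_at K M u)
      = (\<Sum>w\<in>places_above K L v. \<Sum>u\<in>places_above L M w. local_degree_at K M u)"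
    by (rule sum_places_above_tower[OF assms(1-6)])
  also have "\<dots> = (\<Sum>w\<in>places_above K L v. \<Sum>u\<in>places_above L M w. local_degree_at K L w * local_degree_at L M u)"
    using place_below(3)[OF assms(2,3,5)] local_degree_at_tower[OF assms(1-5)]
    by (intro sum.cong refl) auto
  also have "\<dots> = ext_degree K L * ext_degree L M"
    using LM by (simp add: KL flip: sum_distrib_left sum_distrib_right)
  also have "\<dots> = ext_degree K M"
    using finite_extension_trans(2)[OF number_field_finite_extension[OF assms(1,2,4)]
        number_field_finite_extension[OF assms(2,3,5)]] by simp
  finally show ?thesis .
qed

text \<open>Both sides are multiplicative in towers, so elements can be adjoined one after the other.\<close>

theorem sum_local_degrees:
  assumes "number_field K" "number_field L" "K \<subseteq> L" "v \<in> places K"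
  shows "(\<Sum>w\<in>places_above K L v. local_degree_at K L w) = ext_degree K L"
  using assms
proof (induction "ext_degree K L" arbitrary: K v rule: less_induct)
  case less
  interpret K: Qbar_subfield K by (rule number_field_subfield[OF less.prems(1)])
  interpret L: Qbar_subfield L by (rule number_field_subfield[OF less.prems(2)])
  show ?case
  proof (cases "K = L")
    case True
    obtain f where "minpoly K 1 f" using K.minpoly_exists by blast
    then interpret m: minpoly K 1 f .
    have "simple_ext K 1 = K"
      using m.simple_ext_subset[OF K.Qbar_subfield_axioms] m.simple_ext_base by auto
    thus ?thesis using m.sum_local_degrees_simple[OF less.prems(1,4)] m.simple_ext_degree True by simp
  next
    case False
    then obtain \<alpha> where a: "\<alpha> \<in> L" "\<alpha> \<notin> K" using less.prems(3) by blast
    obtain f where "minpoly K \<alpha> f" using K.minpoly_exists by blast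
    then interpret m: minpoly K \<alpha> f .
    define M where "M = simple_ext K \<alpha>"
    have M: "number_field M" unfolding M_def by (rule number_field_extension[OF less.prems(1) m.simple_ext_finite])
    have KM: "K \<subseteq> M" unfolding M_def by (rule m.simple_ext_base)
    have MsubL: "M \<subseteq> L" unfolding M_def by (rule m.simple_ext_subset[OF L.Qbar_subfield_axioms less.prems(3) a(1)])
    have feKM: "finite_extension K M" and feL: "finite_extension M L"
      using number_field_finite_extension less.prems M KM MsubL by auto
    have dKM: "ext_degree K M > 1"
    proof (rule ccontr)
      assume "\<not> ?thesis"
      hence "m.d = 1" using m.simple_ext_degree m.d_pos by (simp add: M_def)
      then obtain p where p: "p \<in> poly_over K" "Polynomial.degree p < 1" "\<alpha> = poly p \<alpha>"
        using m.simple_ext_reduced[OF m.simple_ext_generator] by metis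
      then obtain c where "p = [:c:]" by (metis degree_eq_zeroE less_one)
      with p a(2) show False by (simp add: K.poly_over_pCons)
    qed
    have "ext_degree K L = ext_degree K M * ext_degree M L" by (rule finite_extension_trans(2)[OF feKM feL])
    hence lt: "ext_degree M L < ext_degree K L" using dKM ext_degree_pos[OF feL] by simp
    show ?thesis
    proof (rule sum_local_degrees_trans[OF less.prems(1) M less.prems(2) KM MsubL less.prems(4)])
      show "(\<Sum>w\<in>places_above K M v. local_degree_at K M w) = ext_degree K M"
        using m.sum_local_degrees_simple[OF less.prems(1,4)] m.simple_ext_degree by (simp add: M_def)
      show "(\<Sum>u\<in>places_above M L w. local_degree_at M L u) = ext_degree M L" if "w \<in> places M" for w
        by (rule less.hyps[OF lt M less.prems(2) MsubL that])
    qed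
  qed
qed

section \<open>Consistent maps\<close>

lemma number_field_adjoin:
  assumes "finite A" "number_field K"
  shows "\<exists>G. number_field G \<and> K \<subseteq> G \<and> A \<subseteq> G"
  using assms
proof (induction A rule: finite_induct)
  case empty
  thus ?case by blast
next
  case (insert \<alpha> A)
  then obtain G where G: "number_field G" "K \<subseteq> G" "A \<subseteq> G" by blast
  interpret Qbar_subfield G by (rule number_field_subfield[OF G(1)])
  obtain f where "minpoly G \<alpha> f" using minpoly_exists by blast
  then interpret m: minpoly G \<alpha> f .
  have "number_field (simple_ext G \<alpha>)" by (rule number_field_extension[OF G(1) m.simple_ext_finite])
  thus ?case using G m.simple_ext_base m.simple_ext_generator by blast
qed

lemma number_field_compositum:
  assumes "number_field K" "number_field L"
  shows "\<exists>G. number_field G \<and> K \<subseteq> G \<and> L \<subseteq> G"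
proof -
  have fe: "finite_extension \<rat> L" using assms(2) by (simp add: number_field_def)
  obtain b where b: "lin_indep \<rat> {..<ext_degree \<rat> L} b" "lin_span \<rat> {..<ext_degree \<rat> L} b = L"
    "\<forall>i<ext_degree \<rat> L. b i \<in> L" by (rule finite_extension_basis[OF fe])
  obtain G where G: "number_field G" "K \<subseteq> G" "b ` {..<ext_degree \<rat> L} \<subseteq> G"
    using number_field_adjoin[OF _ assms(1), of "b ` {..<ext_degree \<rat> L}"] by blast
  interpret G: Qbar_subfield G by (rule number_field_subfield[OF G(1)])
  have "lin_span \<rat> {..<ext_degree \<rat> L} b \<subseteq> G"
    using G(3) G.Rats_subset by (auto simp: lin_span_def intro!: G.sum_mem G.mult_mem)
  thus ?thesis using G b(2) by blast
qed

lemma Rats_number_field: "number_field \<rat>"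
  unfolding number_field_def by (rule finite_extension_refl) (simp add: Qbar_subfield_def Rats_subfield)

lemma number_field_containing: "\<exists>G. number_field G \<and> \<alpha> \<in> G"
  using number_field_adjoin[OF _ Rats_number_field, of "{\<alpha>}"] by auto

lemma consistent_mapD:
  assumes "c \<in> consistent_maps" "number_field K" "number_field L" "K \<subseteq> L" "v \<in> places K"
  shows "c (K, v) = (\<Sum>w\<in>places_above K L v. c (L, w))"
  using assms number_field_finite_extension[OF assms(2-4)] unfolding consistent_maps_def by blast

definition local_degree_value :: "Qbar set \<Rightarrow> (place \<Rightarrow> real) \<Rightarrow> Qbar set \<Rightarrow> place \<Rightarrow> real"
  where "local_degree_value K y L w = real (local_degree_at K L w) / real (ext_degree K L) * y (place_below K w)"

text \<open>
  By the tower law the terms of the sum are proportional to the local degrees over \<open>w\<close>, whose sum is \<open>[M : L]\<close>.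
\<close>

lemma local_degree_value_consistent:
  assumes "number_field K" "number_field L" "number_field M" "K \<subseteq> L" "L \<subseteq> M" "w \<in> places L"
  shows "local_degree_value K y L w = (\<Sum>u\<in>places_above L M w. local_degree_value K y M u)"
proof -
  have fe: "finite_extension K L" "finite_extension L M" using number_field_finite_extension assms by auto
  have eq: "local_degree_value K y M u = real (local_degree_at L M u) *
      (real (local_degree_at K L w) / (real (ext_degree K L) * real (ext_degree L M)) * y (place_below K w))"
    if u: "u \<in> places_above L M w" for u
  proof -
    have uM: "u \<in> places M" using u by blast
    have w: "w = place_below L u" using place_below(3)[OF assms(2,3,5) uM assms(6)] u by blast
    have "local_degree_at K M u = local_degree_at K L w * local_degree_at L M u"
      unfolding w by (rule local_degree_at_tower[OF assms(1-5) uM])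
    moreover have "place_below K u = place_below K w"
      unfolding w by (rule place_below_trans[OF assms(1-5) uM, symmetric])
    ultimately show ?thesis using finite_extension_trans(2)[OF fe] by (simp add: local_degree_value_def)
  qed
  have "(\<Sum>u\<in>places_above L M w. local_degree_value K y M u)
      = real (\<Sum>u\<in>places_above L M w. local_degree_at L M u) *
        (real (local_degree_at K L w) / (real (ext_degree K L) * real (ext_degree L M)) * y (place_below K w))"
    unfolding of_nat_sum sum_distrib_right by (rule sum.cong[OF refl eq])
  also have "\<dots> = local_degree_value K y L w"
    unfolding sum_local_degrees[OF assms(2,3,5,6)] local_degree_value_def
    using ext_degree_pos[OF fe(2)] by (simp add: field_simps)
  finally show ?thesis by simp
qed

lemma has_local_degree_values_iff:
  assumes K: "number_field K"
  shows "has_local_degree_values K y c \<longleftrightarrow>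
    (\<forall>L w. number_field L \<and> K \<subseteq> L \<and> w \<in> places L \<longrightarrow> c (L, w) = local_degree_value K y L w)"
proof
  assume h: "has_local_degree_values K y c"
  show "\<forall>L w. number_field L \<and> K \<subseteq> L \<and> w \<in> places L \<longrightarrow> c (L, w) = local_degree_value K y L w"
  proof (intro allI impI, elim conjE)
    fix L w assume L: "number_field L" "K \<subseteq> L" "w \<in> places L"
    note b = place_below[OF K L]
    have "divides_place K w (place_below K w)" using b(3)[OF b(1)] by simp
    thus "c (L, w) = local_degree_value K y L w"
      using h b(1) L(3) number_field_finite_extension[OF K L(1,2)]
      unfolding has_local_degree_values_def local_degree_value_def local_degree_at_def by blast
  qed
next
  assume h: "\<forall>L w. number_field L \<and> K \<subseteq> L \<and> w \<in> places L \<longrightarrow> c (L, w) = local_degree_value K y L w"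
  show "has_local_degree_values K y c"
    unfolding has_local_degree_values_def
  proof (intro ballI allI impI)
    fix v L w assume v: "v \<in> places K" and fe: "finite_extension K L" and w: "w \<in> places L" and d: "divides_place K w v"
    have L: "number_field L" "K \<subseteq> L" using number_field_extension[OF K fe] finite_extension_subfields[OF fe] by auto
    have "v = place_below K w" using place_below(3)[OF K L w v] d by blast
    thus "c (L, w) = real (local_degree K v L w) / real (ext_degree K L) * y v"
      using h L w by (auto simp: local_degree_value_def local_degree_at_def)
  qed
qed

text \<open>
  A consistent map is determined by its values on the fields containing \<open>K\<close>, as every number field
  has an extension among these.  Conversely, a map that is consistent on these fields extends: the
  value at a place of \<open>F\<close> may be computed in any field containing \<open>K\<close> and \<open>F\<close>.
\<close>

lemma consistent_map_unique:
  assumes K: "number_field K" and c: "c \<in> consistent_maps" and c': "c' \<in> consistent_maps"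
    and eq: "\<And>L w. number_field L \<Longrightarrow> K \<subseteq> L \<Longrightarrow> w \<in> places L \<Longrightarrow> c (L, w) = c' (L, w)"
  shows "c = c'"
proof
  fix j :: "Qbar set \<times> place"
  obtain F u where j: "j = (F, u)" by fastforce
  show "c j = c' j"
  proof (cases "j \<in> index_set")
    case True
    hence F: "number_field F" "u \<in> places F" by (auto simp: index_set_def j)
    obtain G where G: "number_field G" "K \<subseteq> G" "F \<subseteq> G" using number_field_compositum[OF K F(1)] by blast
    have "c (F, u) = (\<Sum>w\<in>places_above F G u. c (G, w))" by (rule consistent_mapD[OF c F(1) G(1,3) F(2)])
    also have "\<dots> = (\<Sum>w\<in>places_above F G u. c' (G, w))" using eq[OF G(1,2)] by (intro sum.cong) auto
    also have "\<dots> = c' (F, u)" by (rule consistent_mapD[OF c' F(1) G(1,3) F(2), symmetric])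
    finally show ?thesis by (simp add: j)
  next
    case False
    hence "c j = 0" "c' j = 0" using c c' unfolding consistent_maps_def by blast+
    thus ?thesis by simp
  qed
qed

lemma consistent_map_extension:
  assumes K: "number_field K"
    and e: "\<And>L M w. number_field L \<Longrightarrow> number_field M \<Longrightarrow> K \<subseteq> L \<Longrightarrow> L \<subseteq> M \<Longrightarrow> w \<in> places L \<Longrightarrow>
      e L w = (\<Sum>u\<in>places_above L M w. e M u)"
  shows "\<exists>c\<in>consistent_maps. \<forall>L w. number_field L \<and> K \<subseteq> L \<and> w \<in> places L \<longrightarrow> c (L, w) = e L w"
proof -
  define G where "G F = (SOME G. number_field G \<and> K \<subseteq> G \<and> F \<subseteq> G)" for F
  have G: "number_field (G F)" "K \<subseteq> G F" "F \<subseteq> G F" if "number_field F" for F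
    using someI_ex[OF number_field_compositum[OF K that]] unfolding G_def by auto
  define c where "c j = (if j \<in> index_set then \<Sum>w\<in>places_above (fst j) (G (fst j)) (snd j). e (G (fst j)) w else 0)" for j
  have any: "c (F, u) = (\<Sum>w\<in>places_above F H u. e H w)"
    if F: "number_field F" "u \<in> places F" and H: "number_field H" "K \<subseteq> H" "F \<subseteq> H" for F u H
  proof -
    have up: "(\<Sum>w\<in>places_above F H u. e H w) = (\<Sum>w\<in>places_above F M u. e M w)"
      if H: "number_field H" "K \<subseteq> H" "F \<subseteq> H" and M: "number_field M" "H \<subseteq> M" for H M
    proof -
      have "(\<Sum>w\<in>places_above F M u. e M w) = (\<Sum>w\<in>places_above F H u. \<Sum>z\<in>places_above H M w. e M z)"
        by (rule sum_places_above_tower[OF F(1) H(1) M(1) H(3) M(2) F(2)])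
      also have "\<dots> = (\<Sum>w\<in>places_above F H u. e H w)"
        by (rule sum.cong[OF refl], rule e[OF H(1) M(1) H(2) M(2), symmetric]) simp
      finally show ?thesis by simp
    qed
    obtain M where M: "number_field M" "G F \<subseteq> M" "H \<subseteq> M"
      using number_field_compositum[OF G(1)[OF F(1)] H(1)] by blast
    have "c (F, u) = (\<Sum>w\<in>places_above F (G F) u. e (G F) w)" using F by (simp add: c_def index_set_def)
    also have "\<dots> = (\<Sum>w\<in>places_above F M u. e M w)" by (rule up[OF G[OF F(1)] M(1,2)])
    also have "\<dots> = (\<Sum>w\<in>places_above F H u. e H w)" by (rule up[OF H M(1,3), symmetric])
    finally show ?thesis .
  qed
  have "c \<in> consistent_maps"
    unfolding consistent_maps_def
  proof (intro CollectI conjI allI impI, goal_cases)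
    case (1 j)
    thus ?case by (simp add: c_def)
  next
    case (2 F v L)
    hence F: "number_field F" "v \<in> places F" "finite_extension F L" by auto
    have L: "number_field L" "F \<subseteq> L" using number_field_extension[OF F(1,3)] finite_extension_subfields[OF F(3)] by auto
    note GL = G[OF L(1)]
    have FG: "F \<subseteq> G L" using L(2) GL(3) by blast
    have "c (F, v) = (\<Sum>w\<in>places_above F (G L) v. e (G L) w)" by (rule any[OF F(1,2) GL(1,2) FG])
    also have "\<dots> = (\<Sum>w\<in>places_above F L v. \<Sum>u\<in>places_above L (G L) w. e (G L) u)"
      by (rule sum_places_above_tower[OF F(1) L(1) GL(1) L(2) GL(3) F(2)])
    also have "\<dots> = (\<Sum>w\<in>places_above F L v. c (L, w))"
      by (rule sum.cong[OF refl], rule any[OF L(1) _ GL, symmetric]) simp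
    finally show ?case .
  qed
  moreover have "c (L, w) = e L w" if "number_field L" "K \<subseteq> L" "w \<in> places L" for L w
    by (rule trans[OF any[OF that(1,3,1,2) order_refl] e[OF that(1,1,2) order_refl that(3), symmetric]])
  ultimately show ?thesis by blast
qed

section \<open>The linear form of a consistent map\<close>

text \<open>
  These places lie above one and the same place of \<open>\<rat>\<close>.
\<close>

lemma finite_places_over_rational_norm:
  assumes K: "number_field K"
  shows "finite {v \<in> places K. (\<lambda>r. place_norm v (of_rat r)) = h}" (is "finite ?V")
proof (cases "?V = {}")
  case False
  then obtain v where v: "v \<in> places K" "(\<lambda>r. place_norm v (of_rat r)) = h" by blast
  have QK: "\<rat> \<subseteq> K" using Qbar_subfield.Rats_subset[OF number_field_subfield[OF K]] .
  note bl = place_below[OF Rats_number_field K QK]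
  have "u \<in> places_above \<rat> K (place_below \<rat> v)" if u: "u \<in> ?V" for u
  proof -
    have uK: "u \<in> places K" using u by blast
    have "place_norm u x = place_norm v x" if "x \<in> \<rat>" for x
      using that u v fun_cong[of _ h] by (elim Rats_cases) (metis (mono_tags, lifting) mem_Collect_eq)
    hence "restrict (place_norm u) \<rat> = restrict (place_norm v) \<rat>" by (auto simp: restrict_def)
    hence "place_below \<rat> u = place_below \<rat> v" by (simp add: place_below_def)
    thus ?thesis using bl(3)[OF uK bl(1)[OF v(1)]] uK by simp
  qed
  hence "?V \<subseteq> places_above \<rat> K (place_below \<rat> v)" by blast
  thus ?thesis using finite_places_above[OF Rats_number_field K QK bl(1)[OF v(1)]] finite_subset by blast
next
  case True
  thus ?thesis by (simp only: finite.emptyI)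
qed

lemma finite_padic_gt_1: "finite {p. prime p \<and> padic_abs p r > 1}"
proof -
  obtain a b where ab: "quotient_of r = (a, b)" by fastforce
  have b: "b > 0" using quotient_of_denom_pos[OF ab] .
  have "int p dvd b" if p: "prime p" "padic_abs p r > 1" for p
  proof (rule ccontr)
    assume "\<not> int p dvd b"
    hence "multiplicity (int p) b = 0" by (rule not_dvd_imp_multiplicity_0)
    hence e: "int (multiplicity (int p) b) - int (multiplicity (int p) a) = - int (multiplicity (int p) a)" by simp
    have "real p ^ multiplicity (int p) a \<ge> 1" using prime_gt_0_nat[OF p(1)] by (intro one_le_power) simp
    hence "inverse (real p ^ multiplicity (int p) a) \<le> 1" by (simp add: inverse_le_1_iff)
    hence "padic_abs p r \<le> 1" unfolding padic_abs_def ab fst_conv snd_conv e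
      by (simp add: power_int_minus)
    with p(2) show False by simp
  qed
  hence "int ` {p. prime p \<and> padic_abs p r > 1} \<subseteq> {x. x dvd b}" by auto
  moreover have "finite {x. x dvd b}" using b by simp
  ultimately show ?thesis using finite_subset finite_imageD[of int] by (metis inj_on_of_nat)
qed

lemma (in abs_value) ultrametric_sum:
  assumes "\<And>n. f (of_nat n) \<le> 1" "\<And>i. i \<in> I \<Longrightarrow> x i \<in> L" "\<And>i. i \<in> I \<Longrightarrow> f (x i) \<le> M" "M \<ge> 0"
  shows "f (\<Sum>i\<in>I. x i) \<le> M"
  using assms(2-3)
proof (induction I rule: infinite_finite_induct)
  case (insert i I)
  have "f (x i + sum x I) \<le> max (f (x i)) (f (sum x I))"
    using insert.prems by (intro ultrametric assms(1) sum_mem) auto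
  also have "\<dots> \<le> M" using insert by auto
  finally show ?case using insert.hyps by simp
qed (use assms(4) in auto)

text \<open>
  An algebraic number is integral at all places above primes that do not occur in the denominators
  of its minimal polynomial.
\<close>

lemma finite_places_gt_1:
  assumes K: "number_field K" and a: "\<alpha> \<in> K"
  shows "finite {v \<in> places K. place_norm v \<alpha> > 1}"
proof -
  interpret Q: Qbar_subfield \<rat> by (rule number_field_subfield[OF Rats_number_field])
  obtain f where "minpoly \<rat> \<alpha> f" using Q.minpoly_exists by blast
  then interpret m: minpoly \<rat> \<alpha> f .
  have "\<forall>k. \<exists>r. poly.coeff f k = of_rat r"
    using Q.poly_over_coeff[OF m.f_over] by (auto elim!: Rats_cases)
  from choice[OF this] obtain q where q: "\<And>k. poly.coeff f k = of_rat (q k)" by blast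
  define B where "B = (\<Union>k<m.d. {p. prime p \<and> padic_abs p (q k) > 1})"
  have finB: "finite B" unfolding B_def using finite_padic_gt_1 by auto
  define T where "T = insert (\<lambda>r. real_of_rat \<bar>r\<bar>) (padic_abs ` B)"
  have "(\<lambda>r. place_norm v (of_rat r)) \<in> T" if v: "v \<in> places K" and gt: "place_norm v \<alpha> > 1" for v
  proof (rule ccontr)
    assume notT: "(\<lambda>r. place_norm v (of_rat r)) \<notin> T"
    interpret v: abs_value K "place_norm v" by (rule place_norm_abs_value[OF K v])
    have "(\<lambda>r. place_norm v (of_rat r)) \<in> usual_abs_rat"
      using place_norm_in(2)[OF K v] by (simp add: normalized_norms_def)
    then obtain p where p: "prime p" "(\<lambda>r. place_norm v (of_rat r)) = padic_abs p"
      using notT by (auto simp: usual_abs_rat_def T_def)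
    have pB: "p \<notin> B" using notT p(2) by (auto simp: T_def)
    have vp: "place_norm v (of_rat r) = padic_abs p r" for r using fun_cong[OF p(2), of r] .
    have nat: "place_norm v (of_nat n) \<le> 1" for n
      using vp[of "of_nat n"] padic_abs_of_nat_le_1[OF p(1), of n] by simp
    have cf: "place_norm v (poly.coeff f k) \<le> 1" if "k < m.d" for k
      using pB that p(1) unfolding q vp by (auto simp: B_def not_less)
    have cK: "poly.coeff f k \<in> K" for k using q by simp
    have "0 = (\<Sum>k\<le>m.d. poly.coeff f k * \<alpha> ^ k)" using m.f_root by (simp add: Polynomial.poly_altdef)
    also have "{..m.d} = insert m.d {..<m.d}" by auto
    also have "(\<Sum>k\<in>insert m.d {..<m.d}. poly.coeff f k * \<alpha> ^ k)
        = \<alpha> ^ m.d + (\<Sum>k<m.d. poly.coeff f k * \<alpha> ^ k)" using m.f_monic by simp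
    finally have "\<alpha> ^ m.d = - (\<Sum>k<m.d. poly.coeff f k * \<alpha> ^ k)" by (simp add: eq_neg_iff_add_eq_0)
    hence "place_norm v \<alpha> ^ m.d = place_norm v (- (\<Sum>k<m.d. poly.coeff f k * \<alpha> ^ k))"
      using v.power[OF a, of m.d] by simp
    also have "\<dots> = place_norm v (\<Sum>k<m.d. poly.coeff f k * \<alpha> ^ k)"
      using a cK by (intro v.uminus v.sum_mem v.mult_mem v.power_mem)
    also have "\<dots> \<le> place_norm v \<alpha> ^ (m.d - 1)"
    proof (rule v.ultrametric_sum[OF nat])
      fix k assume "k \<in> {..<m.d}"
      hence k: "k < m.d" by simp
      show "poly.coeff f k * \<alpha> ^ k \<in> K" using a cK by (intro v.mult_mem v.power_mem)
      have "place_norm v (poly.coeff f k * \<alpha> ^ k) = place_norm v (poly.coeff f k) * place_norm v \<alpha> ^ k"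
        using v.mult[OF cK v.power_mem[OF a]] v.power[OF a] by simp
      also have "\<dots> \<le> 1 * place_norm v \<alpha> ^ (m.d - 1)"
        using cf[OF k] gt k v.nonneg[OF cK] by (intro mult_mono power_increasing) auto
      finally show "place_norm v (poly.coeff f k * \<alpha> ^ k) \<le> place_norm v \<alpha> ^ (m.d - 1)" by simp
    qed (use gt in auto)
    finally have "place_norm v \<alpha> ^ m.d \<le> place_norm v \<alpha> ^ (m.d - 1)" .
    moreover have "place_norm v \<alpha> ^ (m.d - 1) < place_norm v \<alpha> ^ m.d"
      using gt m.d_pos by (intro power_strict_increasing) auto
    ultimately show False by simp
  qed
  hence "{v \<in> places K. place_norm v \<alpha> > 1} \<subseteq> (\<Union>h\<in>T. {v \<in> places K. (\<lambda>r. place_norm v (of_rat r)) = h})" by blast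
  moreover have "finite (\<Union>h\<in>T. {v \<in> places K. (\<lambda>r. place_norm v (of_rat r)) = h})"
    using finB finite_places_over_rational_norm[OF K] by (intro finite_UN_I) (auto simp: T_def)
  ultimately show ?thesis using finite_subset by blast
qed

definition norm_support :: "Qbar set \<Rightarrow> Qbar \<Rightarrow> place set"
  where "norm_support K \<alpha> = {v \<in> places K. place_norm v \<alpha> \<noteq> 1}"

lemma finite_norm_support:
  assumes K: "number_field K" and a: "\<alpha> \<in> K" "\<alpha> \<noteq> 0"
  shows "finite (norm_support K \<alpha>)"
proof -
  have inv: "inverse \<alpha> \<in> K" using Qbar_subfield.inverse_mem[OF number_field_subfield[OF K] a(1)] .
  have "place_norm v \<alpha> > 1 \<or> place_norm v (inverse \<alpha>) > 1" if v: "v \<in> places K" and ne: "place_norm v \<alpha> \<noteq> 1" for v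
  proof -
    interpret v: abs_value K "place_norm v" by (rule place_norm_abs_value[OF K v])
    show ?thesis using ne v.pos[OF a] v.inverse[OF a(1)] one_less_inverse[of "place_norm v \<alpha>"] by fastforce
  qed
  hence "norm_support K \<alpha> \<subseteq> {v \<in> places K. place_norm v \<alpha> > 1} \<union> {v \<in> places K. place_norm v (inverse \<alpha>) > 1}"
    unfolding norm_support_def by blast
  thus ?thesis using finite_places_gt_1[OF K a(1)] finite_places_gt_1[OF K inv] finite_subset by blast
qed

definition Phi_on :: "Qbar set \<Rightarrow> (Qbar set \<times> place \<Rightarrow> real) \<Rightarrow> Qbar \<Rightarrow> real"
  where "Phi_on K c \<alpha> = (\<Sum>v\<in>norm_support K \<alpha>. c (K, v) * ln (place_norm v \<alpha>))"

lemma Phi_on_superset: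
  assumes "norm_support K \<alpha> \<subseteq> S" "S \<subseteq> places K" "finite S"
  shows "Phi_on K c \<alpha> = (\<Sum>v\<in>S. c (K, v) * ln (place_norm v \<alpha>))"
  unfolding Phi_on_def using assms by (intro sum.mono_neutral_left) (auto simp: norm_support_def)

lemma infsum_eq_Phi_on:
  assumes "number_field K" "\<alpha> \<in> K" "\<alpha> \<noteq> 0"
  shows "(\<Sum>\<^sub>\<infinity>v\<in>places K. c (K, v) * ln (place_norm v \<alpha>)) = Phi_on K c \<alpha>"
proof -
  have "(\<Sum>\<^sub>\<infinity>v\<in>places K. c (K, v) * ln (place_norm v \<alpha>))
      = (\<Sum>\<^sub>\<infinity>v\<in>norm_support K \<alpha>. c (K, v) * ln (place_norm v \<alpha>))"
    by (rule infsum_cong_neutral) (auto simp: norm_support_def)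
  thus ?thesis using finite_norm_support[OF assms] by (simp add: Phi_on_def)
qed

text \<open>
  The places of \<open>L\<close> are grouped by the places of \<open>K\<close> below them, and consistency sums up each group.
\<close>

lemma Phi_on_extend:
  assumes c: "c \<in> consistent_maps" and K: "number_field K" and L: "number_field L" and KL: "K \<subseteq> L"
    and a: "\<alpha> \<in> K" "\<alpha> \<noteq> 0"
  shows "Phi_on K c \<alpha> = Phi_on L c \<alpha>"
proof -
  let ?S = "norm_support K \<alpha>"
  have vK: "v \<in> places K" if "v \<in> ?S" for v using that by (simp add: norm_support_def)
  have same: "place_norm w \<alpha> = place_norm v \<alpha>" if "v \<in> places K" "w \<in> places_above K L v" for v w
  proof -
    have "restrict (place_norm w) K = place_norm v" using divides_place_iff[OF K L KL that(1)] that(2) by blast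
    thus ?thesis using a(1) by (metis restrict_apply')
  qed
  have "Phi_on K c \<alpha> = (\<Sum>v\<in>?S. \<Sum>w\<in>places_above K L v. c (L, w) * ln (place_norm w \<alpha>))"
    unfolding Phi_on_def
  proof (rule sum.cong[OF refl])
    fix v assume v: "v \<in> ?S"
    have "c (K, v) * ln (place_norm v \<alpha>) = (\<Sum>w\<in>places_above K L v. c (L, w) * ln (place_norm v \<alpha>))"
      unfolding consistent_mapD[OF c K L KL vK[OF v]] by (rule sum_distrib_right)
    also have "\<dots> = (\<Sum>w\<in>places_above K L v. c (L, w) * ln (place_norm w \<alpha>))"
      using same[OF vK[OF v]] by (intro sum.cong refl) simp
    finally show "c (K, v) * ln (place_norm v \<alpha>) = (\<Sum>w\<in>places_above K L v. c (L, w) * ln (place_norm w \<alpha>))" .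
  qed
  also have "\<dots> = (\<Sum>w\<in>(\<Union>v\<in>?S. places_above K L v). c (L, w) * ln (place_norm w \<alpha>))"
  proof (rule sum.UNION_disjoint[symmetric])
    show "finite ?S" by (rule finite_norm_support[OF K a])
    show "\<forall>v\<in>?S. finite (places_above K L v)" using finite_places_above[OF K L KL] vK by blast
    show "\<forall>v\<in>?S. \<forall>v'\<in>?S. v \<noteq> v' \<longrightarrow> places_above K L v \<inter> places_above K L v' = {}"
      using place_below(3)[OF K L KL] vK by blast
  qed
  also have "(\<Union>v\<in>?S. places_above K L v) = norm_support L \<alpha>"
  proof (rule Set.set_eqI, rule iffI)
    fix w assume "w \<in> (\<Union>v\<in>?S. places_above K L v)"
    then obtain v where "v \<in> ?S" "w \<in> places_above K L v" by blast
    thus "w \<in> norm_support L \<alpha>" using same[of v w] by (simp add: norm_support_def)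
  next
    fix w assume w: "w \<in> norm_support L \<alpha>"
    hence wL: "w \<in> places L" by (simp add: norm_support_def)
    note b = place_below[OF K L KL wL]
    have "w \<in> places_above K L (place_below K w)" using b(3)[OF b(1)] wL by simp
    moreover from same[OF b(1) this] have "place_below K w \<in> ?S" using b(1) w by (simp add: norm_support_def)
    ultimately show "w \<in> (\<Union>v\<in>?S. places_above K L v)" by blast
  qed
  finally show ?thesis by (simp add: Phi_on_def)
qed

lemma Phi_eq_Phi_on:
  assumes c: "c \<in> consistent_maps" and K: "number_field K" and a: "\<alpha> \<in> K" "\<alpha> \<noteq> 0"
  shows "Phi c \<alpha> = Phi_on K c \<alpha>"
proof -
  define F where "F = (SOME K. number_field K \<and> \<alpha> \<in> K)"
  have F: "number_field F" "\<alpha> \<in> F" using someI_ex[OF number_field_containing[of \<alpha>]] unfolding F_def by auto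
  obtain G where G: "number_field G" "K \<subseteq> G" "F \<subseteq> G" using number_field_compositum[OF K F(1)] by blast
  have "Phi c \<alpha> = Phi_on F c \<alpha>" unfolding Phi_def Let_def F_def[symmetric] by (rule infsum_eq_Phi_on[OF F a(2)])
  also have "\<dots> = Phi_on G c \<alpha>" by (rule Phi_on_extend[OF c F(1) G(1,3) F(2) a(2)])
  also have "\<dots> = Phi_on K c \<alpha>" by (rule Phi_on_extend[OF c K G(1,2) a, symmetric])
  finally show ?thesis .
qed

lemma Phi_mult:
  assumes c: "c \<in> consistent_maps" and "\<alpha> \<noteq> 0" "\<beta> \<noteq> 0"
  shows "Phi c (\<alpha> * \<beta>) = Phi c \<alpha> + Phi c \<beta>"
proof -
  obtain K where K: "number_field K" "\<alpha> \<in> K" "\<beta> \<in> K"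
    using number_field_adjoin[OF _ Rats_number_field, of "{\<alpha>, \<beta>}"] by auto
  have ab: "\<alpha> * \<beta> \<in> K" using Qbar_subfield.mult_mem[OF number_field_subfield[OF K(1)]] K by blast
  define S where "S = norm_support K \<alpha> \<union> norm_support K \<beta> \<union> norm_support K (\<alpha> * \<beta>)"
  have S: "finite S" "S \<subseteq> places K" unfolding S_def using finite_norm_support[OF K(1)] K ab assms
    by (auto simp: norm_support_def)
  have val: "Phi c x = (\<Sum>v\<in>S. c (K, v) * ln (place_norm v x))" if "x \<in> {\<alpha>, \<beta>, \<alpha> * \<beta>}" for x
  proof -
    have x: "x \<in> K" "x \<noteq> 0" "norm_support K x \<subseteq> S" using that K ab assms by (auto simp: S_def)
    show ?thesis using Phi_eq_Phi_on[OF c K(1) x(1,2)] Phi_on_superset[OF x(3) S(2,1)] by simp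
  qed
  have "(\<Sum>v\<in>S. c (K, v) * ln (place_norm v (\<alpha> * \<beta>)))
      = (\<Sum>v\<in>S. c (K, v) * ln (place_norm v \<alpha>) + c (K, v) * ln (place_norm v \<beta>))"
  proof (rule sum.cong[OF refl])
    fix v assume "v \<in> S"
    hence v: "v \<in> places K" using S by blast
    interpret v: abs_value K "place_norm v" by (rule place_norm_abs_value[OF K(1) v])
    show "c (K, v) * ln (place_norm v (\<alpha> * \<beta>)) = c (K, v) * ln (place_norm v \<alpha>) + c (K, v) * ln (place_norm v \<beta>)"
      using v.pos[OF K(2) assms(2)] v.pos[OF K(3) assms(3)]
      by (simp add: v.mult[OF K(2,3)] ln_mult distrib_left)
  qed
  thus ?thesis using val by (simp add: sum.distrib)
qed

lemma Phi_1: "c \<in> consistent_maps \<Longrightarrow> Phi c 1 = 0"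
  using Phi_mult[of c 1 1] by simp

lemma Phi_power: "c \<in> consistent_maps \<Longrightarrow> \<alpha> \<noteq> 0 \<Longrightarrow> Phi c (\<alpha> ^ n) = real n * Phi c \<alpha>"
  by (induction n) (auto simp: Phi_1 Phi_mult algebra_simps)

lemma Phi_prod:
  assumes "c \<in> consistent_maps" "\<And>i. i \<in> I \<Longrightarrow> x i \<noteq> 0"
  shows "Phi c (\<Prod>i\<in>I. x i) = (\<Sum>i\<in>I. Phi c (x i))"
  using assms(2)
proof (induction I rule: infinite_finite_induct)
  case (insert i I)
  hence "prod x I \<noteq> 0" by auto
  thus ?case using insert Phi_mult[OF assms(1), of "x i" "prod x I"] by simp
qed (auto simp: Phi_1 assms(1))

lemma Phi_root_of_unity:
  assumes c: "c \<in> consistent_maps" and z: "\<zeta> \<in> roots_of_unity"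
  shows "Phi c \<zeta> = 0"
proof -
  obtain n where n: "n > 0" "\<zeta> ^ n = 1" using z by (auto simp: roots_of_unity_def)
  hence "\<zeta> \<noteq> 0" by (auto simp: power_0_left)
  hence "real n * Phi c \<zeta> = 0" using Phi_power[OF c, of \<zeta> n] n(2) Phi_1[OF c] by simp
  thus ?thesis using n(1) by simp
qed

text \<open>
  The linear form vanishes on roots of unity and is therefore constant on their cosets.
\<close>

lemma rational_consistent_mapsI:
  assumes c: "c \<in> consistent_maps" and rat: "\<And>\<alpha>. \<alpha> \<noteq> 0 \<Longrightarrow> Phi c \<alpha> \<in> \<rat>"
  shows "c \<in> rational_consistent_maps"
proof -
  have "Phi_quot c A \<in> \<rat>" if A: "A \<in> carrier Qbar_mod_torsion" for A
  proof -
    obtain a where a: "a \<in> Units Qbar_ring" "A = (\<lambda>\<zeta>. \<zeta> * a) ` roots_of_unity"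
      using A unfolding Qbar_mod_torsion_def FactGroup_def RCOSETS_def r_coset_def units_of_def by auto
    have a0: "a \<noteq> 0" using a(1) by (auto simp: Units_def)
    have "Phi c (\<zeta> * a) = Phi c a" if z: "\<zeta> \<in> roots_of_unity" for \<zeta>
    proof -
      have "\<zeta> \<noteq> 0" using z by (auto simp: roots_of_unity_def power_0_left)
      thus ?thesis using Phi_mult[OF c _ a0] Phi_root_of_unity[OF c z] by simp
    qed
    moreover have "1 \<in> roots_of_unity" by (auto simp: roots_of_unity_def)
    ultimately have "Phi c ` A = {Phi c a}" unfolding a(2) by force
    thus ?thesis unfolding Phi_quot_def using rat[OF a0] by simp
  qed
  thus ?thesis using c by (simp add: rational_consistent_maps_def)
qed

section \<open>Conjugate elements\<close>

context minpoly
begin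

text \<open>
  A place of \<open>K(\<beta>)\<close>, pulled back along the isomorphism \<open>K(\<alpha>) \<rightarrow> K(\<beta>)\<close>.
\<close>

definition conj_place :: "Qbar \<Rightarrow> place \<Rightarrow> place"
  where "conj_place \<beta> u = place_of (simple_ext K \<alpha>)
    (restrict (\<lambda>y. place_norm u (conj_map \<beta> y)) (simple_ext K \<alpha>))"

context
  fixes \<beta> :: Qbar
  assumes K: "number_field K" and b: "\<beta> \<in> conjugates"
begin

interpretation b: minpoly K \<beta> f
  using minpoly_conjugate b by (simp add: conjugates_def)

lemma conj_fields: "number_field (simple_ext K \<alpha>)" "number_field (simple_ext K \<beta>)"
  using number_field_extension[OF K] simple_ext_finite b.simple_ext_finite by auto

lemma conj_place:
  assumes u: "u \<in> places (simple_ext K \<beta>)"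
  shows "conj_place \<beta> u \<in> places (simple_ext K \<alpha>)"
    and "y \<in> simple_ext K \<alpha> \<Longrightarrow> place_norm (conj_place \<beta> u) y = place_norm u (conj_map \<beta> y)"
proof -
  define h where "h = restrict (\<lambda>y. place_norm u (conj_map \<beta> y)) (simple_ext K \<alpha>)"
  have "abs_value (simple_ext K \<alpha>) (\<lambda>y. place_norm u (conj_map \<beta> y))"
    by (rule conjugate_abs_value[OF place_norm_abs_value[OF conj_fields(2) u] b.simple_ext_base b.simple_ext_generator b])
  hence "abs_value (simple_ext K \<alpha>) h" by (rule abs_value_cong) (simp add: h_def)
  moreover have "h (of_rat r) = place_norm u (of_rat r)" for r
    using conj_map_base[OF b of_rat_mem] subsetD[OF simple_ext_base of_rat_mem] by (simp add: h_def)
  hence "(\<lambda>r. h (of_rat r)) \<in> usual_abs_rat"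
    using place_norm_in(2)[OF conj_fields(2) u] by (simp add: normalized_norms_def)
  ultimately have h: "h \<in> normalized_norms (simple_ext K \<alpha>)"
    using normalized_norms_iff[OF simple_ext_subfield] by (simp add: h_def)
  show "conj_place \<beta> u \<in> places (simple_ext K \<alpha>)"
    unfolding conj_place_def h_def[symmetric] by (rule place_of_in(1)[OF h])
  show "place_norm (conj_place \<beta> u) y = place_norm u (conj_map \<beta> y)" if "y \<in> simple_ext K \<alpha>"
    unfolding conj_place_def h_def[symmetric] place_norm_place_of[OF conj_fields(1) h]
    using that by (simp add: h_def)
qed

lemma conj_place_inj:
  assumes u: "u \<in> places (simple_ext K \<beta>)" "u' \<in> places (simple_ext K \<beta>)" and eq: "conj_place \<beta> u = conj_place \<beta> u'"
  shows "u = u'"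
proof (rule place_norm_inj[OF conj_fields(2) u])
  show "place_norm u = place_norm u'"
  proof (rule extensionalityI)
    show "place_norm u \<in> extensional (simple_ext K \<beta>)" "place_norm u' \<in> extensional (simple_ext K \<beta>)"
      using place_norm_in(2)[OF conj_fields(2)] u normalized_norms_iff[OF b.simple_ext_subfield] by blast+
    fix y assume "y \<in> simple_ext K \<beta>"
    then obtain x where x: "x \<in> simple_ext K \<alpha>" "conj_map \<beta> x = y" using conj_map_surj[OF b] by blast
    show "place_norm u y = place_norm u' y"
      using conj_place(2)[OF u(1) x(1)] conj_place(2)[OF u(2) x(1)] eq x(2) by simp
  qed
qed

lemma conj_place_below:
  assumes u: "u \<in> places (simple_ext K \<beta>)"
  shows "place_below K (conj_place \<beta> u) = place_below K u"
proof -
  have "restrict (place_norm (conj_place \<beta> u)) K = restrict (place_norm u) K"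
  proof (rule restrict_ext)
    fix x assume "x \<in> K"
    thus "place_norm (conj_place \<beta> u) x = place_norm u x"
      using conj_place(2)[OF u subsetD[OF simple_ext_base]] conj_map_base[OF b] by simp
  qed
  thus ?thesis by (simp add: place_below_def)
qed

lemma conj_place_local_degree:
  assumes u: "u \<in> places (simple_ext K \<beta>)"
  shows "local_degree_at K (simple_ext K \<alpha>) (conj_place \<beta> u) = local_degree_at K (simple_ext K \<beta>) u"
proof -
  let ?L = "simple_ext K \<alpha>" and ?w = "conj_place \<beta> u"
  note w = conj_place(1)[OF u]
  obtain B where B: "local_basis K ?L (place_norm ?w) B (\<lambda>b. b)"
    using place_local_basis_exists[OF K conj_fields(1) simple_ext_base w] by blast
  have "local_basis K (conj_map \<beta> ` ?L) (place_norm u) B (conj_map \<beta>)"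
    by (rule local_basis_transport[OF B Qbar_subfield_axioms simple_ext_subfield simple_ext_base])
      (use conj_map_hom[OF b] conj_map_base[OF b] conj_place(2)[OF u] in auto)
  moreover have "conj_map \<beta> ` ?L = simple_ext K \<beta>"
    using conj_map_hom(4)[OF b] conj_map_surj[OF b] by blast
  ultimately have lb: "local_basis K (simple_ext K \<beta>) (place_norm u) B (conj_map \<beta>)" by simp
  show ?thesis
    using local_degree_at_eq[OF K conj_fields(2) b.simple_ext_base u lb]
      local_degree_at_eq[OF K conj_fields(1) simple_ext_base w B] by simp
qed

end

lemma conj_place_bij:
  assumes K: "number_field K" and b: "\<beta> \<in> conjugates"
  shows "bij_betw (conj_place \<beta>) (places (simple_ext K \<beta>)) (places (simple_ext K \<alpha>))"
  unfolding bij_betw_def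
proof
  interpret b: minpoly K \<beta> f using minpoly_conjugate b by (simp add: conjugates_def)
  have a: "\<alpha> \<in> b.conjugates" using f_root by (simp add: b.conjugates_def)
  show "inj_on (conj_place \<beta>) (places (simple_ext K \<beta>))" using conj_place_inj[OF K b] by (auto simp: inj_on_def)
  show "conj_place \<beta> ` places (simple_ext K \<beta>) = places (simple_ext K \<alpha>)"
  proof
    show "conj_place \<beta> ` places (simple_ext K \<beta>) \<subseteq> places (simple_ext K \<alpha>)" using conj_place(1)[OF K b] by blast
    show "places (simple_ext K \<alpha>) \<subseteq> conj_place \<beta> ` places (simple_ext K \<beta>)"
    proof
      fix w assume w: "w \<in> places (simple_ext K \<alpha>)"
      define u where "u = b.conj_place \<alpha> w"
      have u: "u \<in> places (simple_ext K \<beta>)" "\<And>y. y \<in> simple_ext K \<beta> \<Longrightarrow> place_norm u y = place_norm w (b.conj_map \<alpha> y)"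
        unfolding u_def using b.conj_place[OF K a w] by auto
      have "place_norm (conj_place \<beta> u) = place_norm w"
      proof (rule extensionalityI)
        show "place_norm (conj_place \<beta> u) \<in> extensional (simple_ext K \<alpha>)" "place_norm w \<in> extensional (simple_ext K \<alpha>)"
          using place_norm_in(2)[OF conj_fields(1)[OF K b]] conj_place(1)[OF K b u(1)] w
            normalized_norms_iff[OF simple_ext_subfield] by blast+
        fix y assume y: "y \<in> simple_ext K \<alpha>"
        then obtain p where p: "p \<in> poly_over K" "y = poly p \<alpha>" by (auto simp: simple_ext_def)
        have "b.conj_map \<alpha> (conj_map \<beta> y) = y"
          unfolding p(2) using conj_map_poly[OF b p(1)] b.conj_map_poly[OF a p(1)] by simp
        thus "place_norm (conj_place \<beta> u) y = place_norm w y"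
          using conj_place(2)[OF K b u(1) y] u(2)[OF conj_map_hom(4)[OF b y y]] by simp
      qed
      hence "conj_place \<beta> u = w"
        using place_norm_inj[OF conj_fields(1)[OF K b] conj_place(1)[OF K b u(1)] w] by blast
      thus "w \<in> conj_place \<beta> ` places (simple_ext K \<beta>)" using u(1) by blast
    qed
  qed
qed

text \<open>
  The linear form of a map with the prescribed values takes the same value at
  conjugate elements, as the isomorphism \<open>K(\<alpha>) \<rightarrow> K(\<beta>)\<close> preserves local degrees.
\<close>

lemma Phi_conjugate:
  assumes K: "number_field K" and b: "\<beta> \<in> conjugates" and "\<alpha> \<noteq> 0" "\<beta> \<noteq> 0"
    and c: "c \<in> consistent_maps" "has_local_degree_values K y c"
  shows "Phi c \<beta> = Phi c \<alpha>"
proof -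
  interpret b: minpoly K \<beta> f using minpoly_conjugate b by (simp add: conjugates_def)
  let ?L = "simple_ext K \<alpha>" and ?M = "simple_ext K \<beta>"
  note nf = conj_fields[OF K b]
  have cval: "c (L, w) = local_degree_value K y L w" if "number_field L" "K \<subseteq> L" "w \<in> places L" for L w
    using c(2) that has_local_degree_values_iff[OF K] by blast
  have nb: "place_norm (conj_place \<beta> u) \<alpha> = place_norm u \<beta>" if "u \<in> places ?M" for u
    using conj_place(2)[OF K b that simple_ext_generator] conj_map_generator[OF b] by simp
  have bij: "bij_betw (conj_place \<beta>) (norm_support ?M \<beta>) (norm_support ?L \<alpha>)"
    unfolding bij_betw_def
  proof
    show "inj_on (conj_place \<beta>) (norm_support ?M \<beta>)"
      using conj_place_inj[OF K b] by (auto simp: inj_on_def norm_support_def)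
    show "conj_place \<beta> ` norm_support ?M \<beta> = norm_support ?L \<alpha>"
    proof (rule Set.set_eqI, rule iffI)
      fix w assume "w \<in> conj_place \<beta> ` norm_support ?M \<beta>"
      thus "w \<in> norm_support ?L \<alpha>" using conj_place(1)[OF K b] nb by (auto simp: norm_support_def)
    next
      fix w assume w: "w \<in> norm_support ?L \<alpha>"
      then obtain u where u: "u \<in> places ?M" "w = conj_place \<beta> u"
        using conj_place_bij[OF K b] by (auto simp: norm_support_def bij_betw_def)
      thus "w \<in> conj_place \<beta> ` norm_support ?M \<beta>" using nb w by (auto simp: norm_support_def)
    qed
  qed
  have "Phi c \<alpha> = (\<Sum>w\<in>norm_support ?L \<alpha>. c (?L, w) * ln (place_norm w \<alpha>))"
    using Phi_eq_Phi_on[OF c(1) nf(1) simple_ext_generator assms(3)] by (simp add: Phi_on_def)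
  also have "\<dots> = (\<Sum>u\<in>norm_support ?M \<beta>. c (?L, conj_place \<beta> u) * ln (place_norm (conj_place \<beta> u) \<alpha>))"
    by (rule sum.reindex_bij_betw[OF bij, symmetric])
  also have "\<dots> = (\<Sum>u\<in>norm_support ?M \<beta>. c (?M, u) * ln (place_norm u \<beta>))"
  proof (rule sum.cong[OF refl])
    fix u assume "u \<in> norm_support ?M \<beta>"
    hence u: "u \<in> places ?M" by (simp add: norm_support_def)
    have "c (?L, conj_place \<beta> u) = c (?M, u)"
      unfolding cval[OF nf(1) simple_ext_base conj_place(1)[OF K b u]] cval[OF nf(2) b.simple_ext_base u]
        local_degree_value_def conj_place_local_degree[OF K b u] conj_place_below[OF K b u]
        simple_ext_degree b.simple_ext_degree ..
    thus "c (?L, conj_place \<beta> u) * ln (place_norm (conj_place \<beta> u) \<alpha>) = c (?M, u) * ln (place_norm u \<beta>)"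
      using nb[OF u] by simp
  qed
  also have "\<dots> = Phi c \<beta>"
    using Phi_eq_Phi_on[OF c(1) nf(2) b.simple_ext_generator assms(4)] by (simp add: Phi_on_def)
  finally show ?thesis by simp
qed

lemma prod_conjugates: "(\<Prod>\<beta>\<in>conjugates. \<beta>) \<in> K"
proof -
  have "poly f 0 = (\<Prod>\<beta>\<in>conjugates. - \<beta>)"
    by (subst f_eq_prod) (simp add: poly_prod)
  also have "\<dots> = (-1) ^ card conjugates * (\<Prod>\<beta>\<in>conjugates. \<beta>)"
    using prod.distrib[of "\<lambda>_. -1" "\<lambda>\<beta>. \<beta>" conjugates] by simp
  finally have "(-1) ^ card conjugates * poly f 0 = (\<Prod>\<beta>\<in>conjugates. \<beta>)"
    by (simp add: mult.assoc[symmetric] flip: power_mult_distrib)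
  moreover have "(-1) ^ card conjugates * poly f 0 \<in> K"
    using f_over by (intro mult_mem power_mem uminus_mem poly_mem) auto
  ultimately show ?thesis by simp
qed

text \<open>
  The linear form has the same value at all \<open>d\<close> conjugates, so that \<open>d\<close> times this value is its value at their product,
  the norm of \<open>\<alpha>\<close>, which lies in \<open>K\<close>.
\<close>

lemma Phi_rational:
  assumes K: "number_field K" and a: "\<alpha> \<noteq> 0"
    and c: "c \<in> consistent_maps" "has_local_degree_values K y c" and rat: "\<forall>x\<in>K - {0}. Phi c x \<in> \<rat>"
  shows "Phi c \<alpha> \<in> \<rat>"
proof -
  have nz: "\<beta> \<noteq> 0" if "\<beta> \<in> conjugates" for \<beta>
    using conj_map_hom(3)[OF that simple_ext_generator simple_ext_generator] conj_map_generator[OF that] a by simp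
  have "Phi c (\<Prod>\<beta>\<in>conjugates. \<beta>) = (\<Sum>\<beta>\<in>conjugates. Phi c \<beta>)" by (rule Phi_prod[OF c(1) nz])
  also have "\<dots> = (\<Sum>\<beta>\<in>conjugates. Phi c \<alpha>)"
    using Phi_conjugate[OF K _ a nz c] by (intro sum.cong) auto
  also have "\<dots> = real d * Phi c \<alpha>" by (simp add: card_conjugates)
  finally have "Phi c \<alpha> = Phi c (\<Prod>\<beta>\<in>conjugates. \<beta>) / real d" using d_pos by simp
  moreover have "(\<Prod>\<beta>\<in>conjugates. \<beta>) \<noteq> 0" using nz finite_conjugates by simp
  hence "Phi c (\<Prod>\<beta>\<in>conjugates. \<beta>) \<in> \<rat>" using rat prod_conjugates by blast
  ultimately show ?thesis by simp
qed

end

theorem theorem1p3: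
  fixes K :: "Qbar set" and y :: "place \<Rightarrow> real"
  assumes "number_field K"
  shows "(\<exists>!c. c \<in> consistent_maps \<and> has_local_degree_values K y c) \<and>
    (\<forall>c. c \<in> consistent_maps \<and> has_local_degree_values K y c \<and>
         (\<forall>\<alpha>\<in>K - {0}. Phi c \<alpha> \<in> \<rat>) \<longrightarrow> c \<in> rational_consistent_maps)"
proof (intro conjI allI impI)
  obtain c where c: "c \<in> consistent_maps"
    "\<forall>L w. number_field L \<and> K \<subseteq> L \<and> w \<in> places L \<longrightarrow> c (L, w) = local_degree_value K y L w"
    using consistent_map_extension[OF assms local_degree_value_consistent[OF assms]] by blast
  show "\<exists>!c. c \<in> consistent_maps \<and> has_local_degree_values K y c"
  proof (rule ex1I[of _ c])
    show "c \<in> consistent_maps \<and> has_local_degree_values K y c"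
      using c has_local_degree_values_iff[OF assms] by blast
    fix c' assume c': "c' \<in> consistent_maps \<and> has_local_degree_values K y c'"
    show "c' = c"
    proof (rule consistent_map_unique[OF assms])
      show "c' (L, w) = c (L, w)" if "number_field L" "K \<subseteq> L" "w \<in> places L" for L w
        using c c' that has_local_degree_values_iff[OF assms] by simp
    qed (use c c' in auto)
  qed
next
  fix c assume c: "c \<in> consistent_maps \<and> has_local_degree_values K y c \<and> (\<forall>\<alpha>\<in>K - {0}. Phi c \<alpha> \<in> \<rat>)"
  interpret Qbar_subfield K by (rule number_field_subfield[OF assms])
  show "c \<in> rational_consistent_maps"
  proof (rule rational_consistent_mapsI)
    show "c \<in> consistent_maps" using c by blast
    fix \<alpha> :: Qbar assume "\<alpha> \<noteq> 0"
    obtain f where "minpoly K \<alpha> f" using minpoly_exists by blast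
    then interpret m: minpoly K \<alpha> f .
    show "Phi c \<alpha> \<in> \<rat>" using m.Phi_rational[OF assms \<open>\<alpha> \<noteq> 0\<close>] c by blast
  qed
qed

end
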